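(* Let $n\ge3$. Assume that $g$ is a real-valued continuous function on $(\mathbb S^n\setminus\{\mathbf n,\mathbf s\})\times(0,\infty)$ with $g(\cdot,s)$ bounded from below in $\mathbb S^n\setminus\{\mathbf n,\mathbf s\}$ for each $s\in(0,\infty)$, and that: (1) for each $s>0$ the function $\theta\mapsto g(\theta,s)$ is rotationally symmetric about the line through $\mathbf n$ and $\mathbf s$; (2) for each $\theta\in\mathbb S^n\setminus\{\mathbf n,\mathbf s\}$ the function $s\mapsto s^{-(n+2)/(n-2)}g(\theta,s)$ is non-increasing on $(0,\infty)$; (3) for each $s>0$ and any $\theta,\theta'$ on the same geodesic passing through $\mathbf n$ and $\mathbf s$, $g(\theta,s)\ge g(\theta',s)$ if $\theta_{n+1}>\theta'_{n+1}>0$, and $g(\theta,s)\ge g(\theta',s)$ if $\theta_{n+1}<\theta'_{n+1}<0$; (4) either the inequalities in (3) are strict or the functions in (2) are strictly decreasing. If $v\in C^2(\mathbb S^n\setminus\{\mathbf n,\mathbf s\})$ is a solution of $$-\mathcal L_{\mathbb S^n}v=g(\theta,v)\quad\text{and}\quad v>0\quad\text{on }\mathbb S^n\setminus\{\mathbf n,\mathbf s\}$$ satisfying $\liminf_{\theta\to\mathbf n}v(\theta)>0$ and $\liminf_{\theta\to\mathbf s}v(\theta)>0$, then $v$ is rotationally symmetric about the line through $\mathbf n$ and $\mathbf s$.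
   Context: $\mathbb S^n\subset\mathbb R^{n+1}$ is the unit sphere with its standard metric, points written $\theta=(\theta_1,\dots,\theta_{n+1})$; $\mathbf n=(0,\dots,0,1)$ and $\mathbf s=(0,\dots,0,-1)$ are the north and south poles. The conformal Laplacian is $\mathcal L_{\mathbb S^n}:=\Delta_{\mathbb S^n}-\frac{n(n-2)}4$, with $\Delta_{\mathbb S^n}$ the Laplace–Beltrami operator. *)

theory Defs
  imports "HOL-Analysis.Analysis"
begin

(* Points of R^(n+1) are pairs (x, t) with x in R^n, n = CARD('n), and t the last coordinate;
   the norm of the product type is the Euclidean one, so S^n is the library's sphere 0 1. *)

definition north :: "(real ^ 'n) \<times> real" where
  "north = (0, 1)"

definition south :: "(real ^ 'n) \<times> real" where
  "south = (0, -1)"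

definition punctured_sphere :: "((real ^ 'n) \<times> real) set" where
  "punctured_sphere = sphere 0 1 - {north, south}"

(* The rotations of R^(n+1) fixing the axis through the poles are the maps
   (x, t) |-> (A x, t) with A in SO(n). *)
definition rotationally_symmetric :: "((real ^ 'n) \<times> real \<Rightarrow> real) \<Rightarrow> bool" where
  "rotationally_symmetric f \<longleftrightarrow>
     (\<forall>A. rotation_matrix A \<longrightarrow> (\<forall>(x, t) \<in> punctured_sphere. f (A *v x, t) = f (x, t)))"

(* The complete great circle through both poles with initial direction w (norm w = 1) at north. *)
definition polar_geodesic :: "real ^ 'n \<Rightarrow> ((real ^ 'n) \<times> real) set" where
  "polar_geodesic w = range (\<lambda>a. cos a *\<^sub>R north + sin a *\<^sub>R (w, 0))"

definition same_polar_geodesic :: "(real ^ 'n) \<times> real \<Rightarrow> (real ^ 'n) \<times> real \<Rightarrow> bool" where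
  "same_polar_geodesic \<theta> \<theta>' \<longleftrightarrow>
     (\<exists>w. norm w = 1 \<and> \<theta> \<in> polar_geodesic w \<and> \<theta>' \<in> polar_geodesic w)"


definition C2_on :: "'a::real_normed_vector set \<Rightarrow> ('a \<Rightarrow> real) \<Rightarrow> bool" where
  "C2_on S f \<longleftrightarrow>
     (\<exists>(f' :: 'a \<Rightarrow> 'a \<Rightarrow>\<^sub>L real) (f'' :: 'a \<Rightarrow> 'a \<Rightarrow>\<^sub>L ('a \<Rightarrow>\<^sub>L real)).
        (\<forall>x\<in>S. (f has_derivative blinfun_apply (f' x)) (at x) \<and>
               (f' has_derivative blinfun_apply (f'' x)) (at x)) \<and>
        continuous_on S f'')"

definition partial :: "'n \<Rightarrow> (real ^ 'n \<Rightarrow> 'b::real_normed_vector) \<Rightarrow> real ^ 'n \<Rightarrow> 'b" where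
  "partial i f y = vector_derivative (\<lambda>h. f (y + h *\<^sub>R axis i 1)) (at 0)"

definition metric_tensor ::
    "(real ^ 'n \<Rightarrow> 'b::real_inner) \<Rightarrow> real ^ 'n \<Rightarrow> real ^ 'n ^ 'n" where
  "metric_tensor X y = (\<chi> i j. partial i X y \<bullet> partial j X y)"

(* (det g)^(-1/2) d_i ((det g)^(1/2) g^(ij) d_j f), where g is the metric induced by the
   parametrization X and f is the coordinate expression of the function. *)
definition laplace_beltrami ::
    "(real ^ 'n \<Rightarrow> 'b::real_inner) \<Rightarrow> (real ^ 'n \<Rightarrow> real) \<Rightarrow> real ^ 'n \<Rightarrow> real" where
  "laplace_beltrami X f y =
     (1 / sqrt (det (metric_tensor X y))) *
     (\<Sum>i\<in>UNIV. partial i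
        (\<lambda>z. sqrt (det (metric_tensor X z)) *
              (\<Sum>j\<in>UNIV. matrix_inv (metric_tensor X z) $ i $ j * partial j f z)) y)"

(* Stereographic projection from north, as a parametrization of the sphere and as a coordinate
   map. South corresponds to y = 0, so this single chart covers the punctured sphere. *)
definition stereo :: "real ^ 'n \<Rightarrow> (real ^ 'n) \<times> real" where
  "stereo y = ((2 / (1 + (norm y)\<^sup>2)) *\<^sub>R y, ((norm y)\<^sup>2 - 1) / (1 + (norm y)\<^sup>2))"

definition stereo_coord :: "(real ^ 'n) \<times> real \<Rightarrow> real ^ 'n" where
  "stereo_coord \<theta> = (1 / (1 - snd \<theta>)) *\<^sub>R fst \<theta>"

lemma stereo_coord_stereo: "stereo_coord (stereo y) = y"
proof -
  have p: "1 + (norm y)\<^sup>2 > 0" by (simp add: add_pos_nonneg)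
  then have "1 - ((norm y)\<^sup>2 - 1) / (1 + (norm y)\<^sup>2) = 2 / (1 + (norm y)\<^sup>2)"
    by (simp add: field_simps)
  moreover have "(1 + (norm y)\<^sup>2) / 2 * (2 / (1 + (norm y)\<^sup>2)) = 1" using p by simp
  ultimately show ?thesis
    by (simp only: stereo_coord_def stereo_def fst_conv snd_conv scaleR_scaleR
        divide_divide_eq_right mult_1_left scaleR_one)
qed

lemma stereo_stereo_coord:
  fixes \<theta> :: "(real ^ 'n) \<times> real"
  assumes "\<theta> \<in> sphere 0 1" "\<theta> \<noteq> north"
  shows "stereo (stereo_coord \<theta>) = \<theta>"
proof -
  obtain x t where \<theta>: "\<theta> = (x, t)" by (cases \<theta>)
  have n: "(norm x)\<^sup>2 + t\<^sup>2 = 1" using assms(1) by (simp add: \<theta> norm_Pair)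
  have t1: "t \<noteq> 1" using n assms(2) by (auto simp: \<theta> north_def)
  then have nz: "1 - t \<noteq> 0" by simp
  have nx: "(norm x)\<^sup>2 = (1 - t) * (1 + t)" using n by (simp add: algebra_simps power2_eq_square)
  have q: "(norm (stereo_coord \<theta>))\<^sup>2 = (1 + t) / (1 - t)"
    using nz by (simp add: \<theta> stereo_coord_def power_divide nx) (simp add: power2_eq_square)
  have 1: "1 + (1 + t) / (1 - t) = 2 / (1 - t)"
    and 2: "(1 + t) / (1 - t) - 1 = 2 * t / (1 - t)"
    using nz by (simp_all add: field_simps)
  show ?thesis
    unfolding stereo_def q 1 2 using nz by (simp add: \<theta> stereo_coord_def)
qed

lemma bij_betw_stereo: "bij_betw stereo (- {0}) punctured_sphere"
proof (rule bij_betw_byWitness[where f' = stereo_coord])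
  show "\<forall>y\<in>- {0}. stereo_coord (stereo y) = y" by (simp add: stereo_coord_stereo)
  show "\<forall>\<theta>\<in>punctured_sphere. stereo (stereo_coord \<theta>) = \<theta>"
    by (simp add: punctured_sphere_def stereo_stereo_coord)
  show "stereo ` (- {0}) \<subseteq> (punctured_sphere :: ((real ^ 'n) \<times> real) set)"
  proof (rule image_subsetI)
    fix y :: "real ^ 'n" assume "y \<in> - {0}"
    then have y: "y \<noteq> 0" by simp
    have p: "1 + (norm y)\<^sup>2 > 0" by (simp add: add_pos_nonneg)
    have "(norm (stereo y))\<^sup>2 =
        (2 / (1 + (norm y)\<^sup>2) * norm y)\<^sup>2 + (((norm y)\<^sup>2 - 1) / (1 + (norm y)\<^sup>2))\<^sup>2"
      using p by (simp add: stereo_def norm_Pair power_divide power_mult_distrib)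
    also have "\<dots> = 1"
      using p by (simp add: divide_simps) (simp add: power2_eq_square algebra_simps)
    finally have "norm (stereo y) = 1"
      using power2_eq_imp_eq[of "norm (stereo y)" 1] by simp
    moreover have "fst (stereo y) \<noteq> 0" using y p by (simp add: stereo_def)
    ultimately show "stereo y \<in> punctured_sphere"
      by (auto simp: punctured_sphere_def north_def south_def)
  qed
  show "stereo_coord ` punctured_sphere \<subseteq> - {0 :: real ^ 'n}"
  proof (rule image_subsetI)
    fix \<theta> :: "(real ^ 'n) \<times> real"
    assume \<theta>: "\<theta> \<in> punctured_sphere"
    then have "stereo (stereo_coord \<theta>) = \<theta>"
      by (simp add: punctured_sphere_def stereo_stereo_coord)
    with \<theta> have "stereo_coord \<theta> \<noteq> 0"
      by (auto simp: stereo_def punctured_sphere_def south_def)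
    then show "stereo_coord \<theta> \<in> - {0}" by simp
  qed
qed

(* In this chart the induced metric is the standard one, 4 |dy|^2 / (1 + |y|^2)^2. *)
lemma partial_stereo:
  "partial i stereo y =
     ((2 / (1 + (norm y)\<^sup>2)) *\<^sub>R axis i 1 - (4 * y $ i / (1 + (norm y)\<^sup>2)\<^sup>2) *\<^sub>R y,
      4 * y $ i / (1 + (norm y)\<^sup>2)\<^sup>2)"
proof -
  let ?N = "\<lambda>h. 1 + (y + h *\<^sub>R axis i 1) \<bullet> (y + h *\<^sub>R axis i 1)"
  have N: "1 + z \<bullet> z \<noteq> 0" for z :: "real ^ 'a"
    by (metis add_pos_nonneg inner_ge_zero less_irrefl zero_less_one)
  have dN: "(?N has_real_derivative 2 * y $ i) (at 0)"
  proof -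
    have "?N = (\<lambda>h. 1 + y \<bullet> y + 2 * h * y $ i + h\<^sup>2)"
      by (simp add: fun_eq_iff inner_add_left inner_add_right inner_axis inner_axis'
          power2_eq_square algebra_simps)
    then show ?thesis by (auto intro!: derivative_eq_intros)
  qed
  have d1: "((\<lambda>h. 2 / ?N h) has_real_derivative - (4 * y $ i / (1 + y \<bullet> y)\<^sup>2)) (at 0)"
    using DERIV_divide[OF DERIV_const[of 2] dN] N[of y] by (simp add: power2_eq_square)
  have d2: "((\<lambda>h. (?N h - 2) / ?N h) has_real_derivative 4 * y $ i / (1 + y \<bullet> y)\<^sup>2) (at 0)"
    using DERIV_divide[OF DERIV_diff[OF dN DERIV_const[of 2]] dN] N[of y]
    by (simp add: power2_eq_square algebra_simps)
  have dz: "((\<lambda>h. y + h *\<^sub>R axis i 1) has_vector_derivative axis i 1) (at 0)"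
    by (auto intro!: derivative_eq_intros simp: has_vector_derivative_def)
  have "((\<lambda>h. ((2 / ?N h) *\<^sub>R (y + h *\<^sub>R axis i 1), (?N h - 2) / ?N h)) has_vector_derivative
     ((2 / (1 + y \<bullet> y)) *\<^sub>R axis i 1 - (4 * y $ i / (1 + y \<bullet> y)\<^sup>2) *\<^sub>R y,
      4 * y $ i / (1 + y \<bullet> y)\<^sup>2)) (at 0)"
    using has_vector_derivative_Pair[OF has_vector_derivative_scaleR[OF d1 dz]
        d2[unfolded has_real_derivative_iff_has_vector_derivative]] by simp
  then show ?thesis
    unfolding partial_def stereo_def power2_norm_eq_inner
    by (intro vector_derivative_at) (simp add: algebra_simps)
qed

lemma metric_tensor_stereo: "metric_tensor stereo y = mat (4 / (1 + (norm y)\<^sup>2)\<^sup>2)"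
proof -
  define N where "N = 1 + (norm y)\<^sup>2"
  have N: "N \<noteq> 0" unfolding N_def by (metis add_pos_nonneg zero_le_power2 less_irrefl zero_less_one)
  have yy: "y \<bullet> y = N - 1" by (simp add: N_def power2_norm_eq_inner)
  have "partial i stereo y \<bullet> partial j stereo y = (if i = j then 4 / N\<^sup>2 else 0)" for i j
  proof -
    have ax: "(axis i 1 :: real ^ 'a) \<bullet> axis j 1 = (if i = j then 1 else 0)"
      by (simp add: inner_axis_axis)
    have "partial i stereo y \<bullet> partial j stereo y =
        (2 / N)\<^sup>2 * (if i = j then 1 else 0) - 16 * y $ i * y $ j / N ^ 3
        + 16 * y $ i * y $ j / N ^ 4 * (N - 1) + 16 * y $ i * y $ j / N ^ 4"
      using N by (simp add: partial_stereo ax yy inner_diff_left inner_diff_right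
          inner_axis inner_axis' flip: N_def)
        (simp add: axis_def field_simps power2_eq_square power3_eq_cube power4_eq_xxxx)
    also have "\<dots> = (if i = j then 4 / N\<^sup>2 else 0)"
      using N by (simp add: field_simps power2_eq_square power3_eq_cube power4_eq_xxxx)
    finally show ?thesis .
  qed
  then show ?thesis
    by (simp add: metric_tensor_def mat_def vec_eq_iff N_def)
qed

(* Laplace-Beltrami operator of the standard metric at a point other than north. *)
definition sphere_laplacian ::
    "((real ^ 'n) \<times> real \<Rightarrow> real) \<Rightarrow> (real ^ 'n) \<times> real \<Rightarrow> real" where
  "sphere_laplacian v \<theta> = laplace_beltrami stereo (v \<circ> stereo) (stereo_coord \<theta>)"

definition conformal_laplacian ::
    "((real ^ 'n) \<times> real \<Rightarrow> real) \<Rightarrow> (real ^ 'n) \<times> real \<Rightarrow> real" where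
  "conformal_laplacian v \<theta> =
     sphere_laplacian v \<theta> - (real CARD('n) * (real CARD('n) - 2) / 4) * v \<theta>"

definition C2_punctured_sphere :: "((real ^ 'n) \<times> real \<Rightarrow> real) \<Rightarrow> bool" where
  "C2_punctured_sphere v \<longleftrightarrow> C2_on (- {0}) (v \<circ> stereo)"

end

theory Submission
  imports Defs
begin

text \<open>
  The proof is the method of moving spheres, run on the sphere itself. Fix a unit vector \<open>e\<close>
  orthogonal to the axis. For \<open>0 < c < 1\<close> the conformal reflection of the sphere in the
  hypersphere \<open>\<theta> \<bullet> e = c\<close> exchanges the cap \<open>\<theta> \<bullet> e > c\<close> with its complement. As the centre
  \<open>e / c\<close> of this inversion lies in the equatorial hyperplane, the reflection multiplies the last
  coordinate by its conformal factor \<open>\<mu>\<close>, and \<open>\<mu> > 1\<close> on the cap. So it moves every point of the cap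
  off the equator closer to the pole of its own hemisphere and leaves the equator invariant.

  Let \<open>L\<close> be the conformal Laplacian and write the equation as \<open>- L v = v\<^sup>p k\<close> with
  \<open>p = (n + 2) / (n - 2)\<close> and \<open>k(\<theta>) = v\<^sup>-\<^sup>p g(\<theta>, v)\<close>.
  By conformal invariance the reflected copy \<open>v\<^sub>c(\<theta>) = \<mu>\<^sup>a v(R \<theta>)\<close>, \<open>a = (n - 2) / 2\<close>, satisfies
  \<open>- L v\<^sub>c = v\<^sub>c\<^sup>p k(R \<theta>)\<close>. Conditions (1) to (3) say that \<open>k(R \<theta>) \<ge> k(\<theta>)\<close> wherever
  \<open>v(R \<theta>) \<le> v(\<theta>)\<close>, and (4) makes this strict off the equator if \<open>v(R \<theta>) < v(\<theta>)\<close>. The goal is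
  \<open>v \<le> v\<^sub>c\<close> on the cap for every \<open>c\<close>: letting \<open>c\<close> tend to 0 for both \<open>e\<close> and \<open>-e\<close> shows that
  \<open>v\<close> is invariant under the reflection in the hyperplane orthogonal to \<open>e\<close>, and two points of the
  same latitude are exchanged by such a reflection.

  The function \<open>g\<close> is merely continuous in its second argument, so the difference
  \<open>w = v\<^sub>c - v\<close> need not satisfy a linear equation with bounded coefficients. It does satisfy the one-sided
  inequality \<open>\<Delta> w \<le> C |w|\<close> (in the chart) where \<open>v(R \<theta>) \<le> v(\<theta>)\<close>, and since
  \<open>\<mu> > 1\<close> this covers both the points with \<open>w < 0\<close> and those where \<open>w\<close> is small (lemma
  \<open>gap_bound_coefficient\<close>). Three arguments use it.

  \<^item> If \<open>w \<ge> 0\<close> on the cap then \<open>w > 0\<close> there (\<open>dominated_imp_less\<close>): a zero off the equator contradicts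
    the strict monotonicity, and a zero on the equator is excluded by a barrier.
  \<^item> In that case \<open>w\<close> also stays away from 0 near the two points that the reflection sends to the
    poles, where \<open>v\<^sub>c\<close> may be singular (\<open>dominated_imp_pole_margin\<close>); a barrier built from the
    fundamental solution gives this. Expressed at the poles it is a condition that is open in \<open>c\<close>.
  \<^item> If \<open>w\<close> took negative values for parameters \<open>c\<^sub>i\<close> tending to \<open>c\<^sub>0\<close>, the minima of
    \<open>w\<close> divided by a positive function \<open>\<Phi>\<close> would accumulate only at the boundary sphere of the cap
    (a point if \<open>c\<^sub>0 = 1\<close>). A function \<open>\<Phi>\<close> that is sharply peaked along that boundary has \<open>- \<Delta> \<Phi> > C \<Phi>\<close> there, which is impossible at such
    minima (\<open>moving_spheres_step\<close>). The same argument starts the process at \<open>c\<^sub>0 = 1\<close>, where the poles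
    cause no trouble because \<open>v\<close> is bounded below by a positive constant and \<open>\<mu>\<close> tends to infinity at
    the two singular points.

  All computations take place in the stereographic chart, where \<open>L\<close> becomes the Euclidean Laplacian of
  the function rescaled by a power of the conformal factor, and the reflection becomes a Euclidean
  inversion.
\<close>

section \<open>Divergence and Laplacian in Euclidean space\<close>

definition has_div :: "(real ^ 'n \<Rightarrow> real ^ 'n) \<Rightarrow> real ^ 'n \<Rightarrow> real \<Rightarrow> bool" where
  "has_div A y d \<longleftrightarrow> (\<exists>H. (A has_derivative H) (at y) \<and> (\<Sum>i\<in>UNIV. H (axis i 1) $ i) = d)"

text \<open>
  The gradient field is an argument because product and composition rules need its value. Only
  a first derivative of the gradient at the single point is recorded, so continuity of the second
  derivatives is never an issue.
\<close>
definition has_laplacian ::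
    "(real ^ 'n \<Rightarrow> real) \<Rightarrow> (real ^ 'n \<Rightarrow> real ^ 'n) \<Rightarrow> real ^ 'n \<Rightarrow> real \<Rightarrow> bool" where
  "has_laplacian f G y L \<longleftrightarrow> (\<forall>\<^sub>F z in nhds y. GDERIV f z :> G z) \<and> has_div G y L"

lemma has_div_add:
  assumes "has_div A y a" "has_div B y b"
  shows "has_div (\<lambda>z. A z + B z) y (a + b)"
proof -
  obtain H K where "(A has_derivative H) (at y)" "(\<Sum>i\<in>UNIV. H (axis i 1) $ i) = a"
    "(B has_derivative K) (at y)" "(\<Sum>i\<in>UNIV. K (axis i 1) $ i) = b"
    using assms unfolding has_div_def by blast
  then show ?thesis unfolding has_div_def
    by (intro exI[of _ "\<lambda>h. H h + K h"]) (auto simp: sum.distrib intro!: derivative_intros)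
qed

text \<open>
  The derivative of the scalar factor enters through its value at the vector field itself, because a
  linear form is the sum of its values on the axes times the coordinates. This form avoids
  computing the gradient of a factor like an inner product with a vector field.
\<close>
lemma has_div_scaleR:
  fixes A :: "real ^ 'n \<Rightarrow> real ^ 'n"
  assumes f: "(f has_derivative f') (at y)" and "has_div A y d"
  shows "has_div (\<lambda>z. f z *\<^sub>R A z) y (f y * d + f' (A y))"
proof -
  obtain H where H: "(A has_derivative H) (at y)" "(\<Sum>i\<in>UNIV. H (axis i 1) $ i) = d"
    using assms unfolding has_div_def by blast
  have "((\<lambda>z. f z *\<^sub>R A z) has_derivative (\<lambda>h. f y *\<^sub>R H h + f' h *\<^sub>R A y)) (at y)"
    using has_derivative_scaleR[OF f H(1)] by simp
  moreover have "f' a = (\<Sum>i\<in>UNIV. f' (axis i 1) * a $ i)" for a :: "real ^ 'n"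
  proof -
    interpret linear f' by (rule has_derivative_linear[OF f])
    have "f' a = f' (\<Sum>i\<in>UNIV. (a $ i) *\<^sub>R axis i 1)"
      using basis_expansion[of a] by (simp add: scalar_mult_eq_scaleR)
    then show ?thesis by (simp add: sum scale mult.commute)
  qed
  from this[of "A y"]
  have "(\<Sum>i\<in>UNIV. (f y *\<^sub>R H (axis i 1) + f' (axis i 1) *\<^sub>R A y) $ i) = f y * d + f' (A y)"
    by (simp add: sum.distrib flip: H(2) sum_distrib_left)
  ultimately show ?thesis unfolding has_div_def by blast
qed

lemma has_div_scaleR_gderiv:
  assumes "GDERIV f y :> g" "has_div A y d"
  shows "has_div (\<lambda>z. f z *\<^sub>R A z) y (f y * d + g \<bullet> A y)"
  using has_div_scaleR[OF assms(1)[unfolded gderiv_def] assms(2)] by (simp add: inner_commute)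

lemma has_div_diff_const: "has_div (\<lambda>z. z - x) (y :: real ^ 'n) (real CARD('n))"
  unfolding has_div_def
  by (intro exI[of _ "\<lambda>h. h"]) (auto intro!: derivative_eq_intros)

lemma has_laplacian_ev: "has_laplacian f G y L \<Longrightarrow> \<forall>\<^sub>F z in nhds y. GDERIV f z :> G z"
  unfolding has_laplacian_def by blast

lemma has_laplacian_gderiv: "has_laplacian f G y L \<Longrightarrow> GDERIV f y :> G y"
  unfolding has_laplacian_def by (auto dest: eventually_nhds_x_imp_x)

lemma has_laplacian_isCont: "has_laplacian f G y L \<Longrightarrow> isCont f y"
  using has_laplacian_gderiv has_derivative_continuous unfolding gderiv_def by blast

lemma has_laplacian_const: "has_laplacian (\<lambda>z. a) (\<lambda>z. 0) y 0"
  unfolding has_laplacian_def has_div_def gderiv_def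
  by (auto intro!: exI[of _ "\<lambda>h. 0"])

lemma has_laplacian_add:
  assumes "has_laplacian f F y L" "has_laplacian g G y M"
  shows "has_laplacian (\<lambda>z. f z + g z) (\<lambda>z. F z + G z) y (L + M)"
proof -
  have "\<forall>\<^sub>F z in nhds y. GDERIV (\<lambda>z. f z + g z) z :> F z + G z"
    using eventually_conj[OF has_laplacian_ev[OF assms(1)] has_laplacian_ev[OF assms(2)]]
    by (rule eventually_mono) (auto intro: GDERIV_add)
  then show ?thesis using assms has_div_add unfolding has_laplacian_def by blast
qed

lemma has_laplacian_mult:
  assumes "has_laplacian f F y L" "has_laplacian g G y M"
  shows "has_laplacian (\<lambda>z. f z * g z) (\<lambda>z. f z *\<^sub>R G z + g z *\<^sub>R F z) y
           (f y * M + 2 * (F y \<bullet> G y) + g y * L)"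
proof -
  have ev: "\<forall>\<^sub>F z in nhds y. GDERIV (\<lambda>z. f z * g z) z :> f z *\<^sub>R G z + g z *\<^sub>R F z"
    using eventually_conj[OF has_laplacian_ev[OF assms(1)] has_laplacian_ev[OF assms(2)]]
    by (rule eventually_mono) (auto intro: GDERIV_mult)
  have "has_div (\<lambda>z. f z *\<^sub>R G z + g z *\<^sub>R F z) y ((f y * M + F y \<bullet> G y) + (g y * L + G y \<bullet> F y))"
    using assms has_laplacian_gderiv[OF assms(1)] has_laplacian_gderiv[OF assms(2)]
    unfolding has_laplacian_def by (intro has_div_add has_div_scaleR_gderiv) auto
  with ev show ?thesis unfolding has_laplacian_def
    by (simp add: inner_commute algebra_simps)
qed

lemma has_laplacian_cmult:
  assumes "has_laplacian f F y L"
  shows "has_laplacian (\<lambda>z. a * f z) (\<lambda>z. a *\<^sub>R F z) y (a * L)"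
  using has_laplacian_mult[OF has_laplacian_const assms] by simp

lemma has_laplacian_diff:
  assumes "has_laplacian f F y L" "has_laplacian g G y M"
  shows "has_laplacian (\<lambda>z. f z - g z) (\<lambda>z. F z - G z) y (L - M)"
  using has_laplacian_add[OF assms(1) has_laplacian_cmult[OF assms(2), of "-1"]] by simp

lemma has_laplacian_compose:
  fixes h h' :: "real \<Rightarrow> real"
  assumes q: "has_laplacian q Q y M" and S: "open S" "q y \<in> S"
    and h: "\<And>s. s \<in> S \<Longrightarrow> (h has_real_derivative h' s) (at s)"
    and h': "(h' has_real_derivative d) (at (q y))"
  shows "has_laplacian (\<lambda>z. h (q z)) (\<lambda>z. h' (q z) *\<^sub>R Q z) y
           (h' (q y) * M + d * (Q y \<bullet> Q y))"
proof -
  have "\<forall>\<^sub>F z in nhds y. q z \<in> S"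
    using has_laplacian_isCont[OF q] S unfolding isCont_def
    by (metis eventually_nhds_conv_at topological_tendstoD)
  from eventually_conj[OF has_laplacian_ev[OF q] this]
  have ev: "\<forall>\<^sub>F z in nhds y. GDERIV (\<lambda>z. h (q z)) z :> h' (q z) *\<^sub>R Q z"
    by (rule eventually_mono) (auto intro: GDERIV_DERIV_compose h)
  have "GDERIV (\<lambda>z. h' (q z)) y :> d *\<^sub>R Q y"
    by (rule GDERIV_DERIV_compose[OF has_laplacian_gderiv[OF q] h'])
  then have "has_div (\<lambda>z. h' (q z) *\<^sub>R Q z) y (h' (q y) * M + (d *\<^sub>R Q y) \<bullet> Q y)"
    using q unfolding has_laplacian_def by (intro has_div_scaleR_gderiv) auto
  with ev show ?thesis unfolding has_laplacian_def by simp
qed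

lemma has_laplacian_sq_dist:
  "has_laplacian (\<lambda>z. (z - x) \<bullet> (z - x)) (\<lambda>z. 2 *\<^sub>R (z - x)) (y :: real ^ 'n) (2 * real CARD('n))"
proof -
  have "GDERIV (\<lambda>z. (z - x) \<bullet> (z - x)) z :> 2 *\<^sub>R (z - x)" for z
    unfolding gderiv_def
    by (auto intro!: derivative_eq_intros simp: inner_commute)
  moreover have "has_div (\<lambda>z. 2 *\<^sub>R (z - x)) y (2 * real CARD('n))"
    using has_div_scaleR_gderiv[OF GDERIV_const[of 2] has_div_diff_const] by simp
  ultimately show ?thesis unfolding has_laplacian_def by simp
qed

lemma has_laplacian_transform:
  assumes "has_laplacian f G y L" "\<forall>\<^sub>F z in nhds y. g z = f z"
  shows "has_laplacian g G y L"
proof -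
  have "\<forall>\<^sub>F z in nhds y. \<forall>\<^sub>F u in nhds z. g u = f u"
    using assms(2) by (simp add: eventually_eventually)
  from eventually_conj[OF has_laplacian_ev[OF assms(1)] this]
  have "\<forall>\<^sub>F z in nhds y. GDERIV g z :> G z"
  proof (rule eventually_mono)
    fix z assume z: "GDERIV f z :> G z \<and> (\<forall>\<^sub>F u in nhds z. g u = f u)"
    then have "\<forall>\<^sub>F u in at z. f u = g u" "f z = g z"
      by (auto simp: eventually_at_filter elim: eventually_mono dest: eventually_nhds_x_imp_x)
    with z show "GDERIV g z :> G z"
      unfolding gderiv_def using has_derivative_transform_eventually by blast
  qed
  then show ?thesis using assms(1) unfolding has_laplacian_def by blast
qed

text \<open>
  The derivative vanishes at the minimum; a negative second derivative would make it negative
  just to the right, and the function would decrease.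
\<close>
lemma second_derivative_test:
  fixes f :: "real \<Rightarrow> real"
  assumes f: "\<forall>\<^sub>F h in nhds 0. (f has_real_derivative f' h) (at h)"
    and f': "(f' has_real_derivative d) (at 0)"
    and mn: "\<forall>\<^sub>F h in nhds 0. f 0 \<le> f h"
  shows "0 \<le> d"
proof (rule ccontr)
  assume "\<not> 0 \<le> d"
  then have "d < 0" by simp
  obtain r1 where r1: "r1 > 0" "\<And>h. \<bar>h\<bar> < r1 \<Longrightarrow> (f has_real_derivative f' h) (at h) \<and> f 0 \<le> f h"
    using eventually_conj[OF f mn] unfolding eventually_nhds_metric by (auto simp: dist_real_def)
  have "f' 0 = 0"
  proof (rule DERIV_local_min)
    show "(f has_real_derivative f' 0) (at 0)" using r1(2)[of 0] r1(1) by simp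
    show "0 < r1" by fact
    show "\<forall>y. \<bar>0 - y\<bar> < r1 \<longrightarrow> f 0 \<le> f y" using r1 by simp
  qed
  obtain r2 where r2: "r2 > 0" "\<And>h. 0 < h \<Longrightarrow> h < r2 \<Longrightarrow> f' (0 + h) < f' 0"
    using DERIV_neg_dec_right[OF f' \<open>d < 0\<close>] by blast
  define h where "h = min r1 r2 / 2"
  have h: "0 < h" "h < r1" "h < r2" using r1 r2 by (auto simp: h_def min_def)
  obtain z where z: "0 < z" "z < h" "f h - f 0 = (h - 0) * f' z"
    using MVT2[OF h(1), of f f'] r1(2) h by auto
  have "f' z < 0" using r2(2)[of z] z h \<open>f' 0 = 0\<close> by simp
  then have "f h < f 0" using z h by (smt (verit) mult_pos_neg)
  then show False using r1(2)[of h] h by simp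
qed

text \<open>
  The only form of the maximum principle that the proof uses; every comparison below applies it to
  a difference of a solution and an explicit barrier.
\<close>
lemma laplacian_nonneg_at_min:
  fixes f :: "real ^ 'n \<Rightarrow> real"
  assumes f: "has_laplacian f G y L" and mn: "\<forall>\<^sub>F z in nhds y. f y \<le> f z"
  shows "0 \<le> L"
proof -
  obtain H where H: "(G has_derivative H) (at y)" "(\<Sum>i\<in>UNIV. H (axis i 1) $ i) = L"
    using f unfolding has_laplacian_def has_div_def by blast
  have "0 \<le> H (axis i 1) $ i" for i
  proof (rule second_derivative_test)
    let ?a = "\<lambda>h. y + h *\<^sub>R axis i (1::real)"
    have lim: "filterlim ?a (nhds y) (nhds 0)"
      by (auto intro!: tendsto_eq_intros filterlim_ident)
    have da: "(?a has_derivative (\<lambda>k. k *\<^sub>R axis i 1)) (at h)" for h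
      by (auto intro!: derivative_eq_intros)
    have ev: "\<forall>\<^sub>F h in nhds 0. GDERIV f (?a h) :> G (?a h)"
      by (rule eventually_compose_filterlim[OF has_laplacian_ev[OF f] lim])
    show "\<forall>\<^sub>F h in nhds 0. ((\<lambda>h. f (?a h)) has_real_derivative G (?a h) $ i) (at h)"
      using ev
    proof eventually_elim
      fix h assume "GDERIV f (?a h) :> G (?a h)"
      from has_derivative_compose[OF da this[unfolded gderiv_def]]
      show "((\<lambda>h. f (?a h)) has_real_derivative G (?a h) $ i) (at h)"
        unfolding has_field_derivative_def by (simp add: inner_axis' mult.commute[of _ "G _ $ i"])
    qed
    have "((\<lambda>h. G (?a h) $ i) has_derivative (\<lambda>k. H (k *\<^sub>R axis i 1) $ i)) (at 0)"
      using bounded_linear.has_derivative[OF bounded_linear_vec_nth has_derivative_compose[OF da[of 0], of G H]] H(1)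
      by simp
    moreover have "H (k *\<^sub>R axis i 1) = k *\<^sub>R H (axis i 1)" for k
      using has_derivative_linear[OF H(1)] by (simp add: linear_cmul)
    ultimately show "((\<lambda>h. G (?a h) $ i) has_real_derivative H (axis i 1) $ i) (at 0)"
      unfolding has_field_derivative_def by (simp add: mult.commute[of _ "H _ $ i"])
    show "\<forall>\<^sub>F h in nhds 0. f (y + 0 *\<^sub>R axis i 1) \<le> f (?a h)"
      using eventually_compose_filterlim[OF mn lim] by simp
  qed
  then show ?thesis using H(2) by (auto intro: sum_nonneg)
qed

lemma has_laplacian_eq: "has_laplacian f G y L \<Longrightarrow> L = M \<Longrightarrow> has_laplacian f G y M"
  by simp

lemma has_div_eq: "has_div A y L \<Longrightarrow> L = M \<Longrightarrow> has_div A y M"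
  by simp

section \<open>Inversions and the Kelvin transform\<close>

definition inversion :: "'a::real_inner \<Rightarrow> real \<Rightarrow> 'a \<Rightarrow> 'a" where
  "inversion x l y = x + (l / ((y - x) \<bullet> (y - x))) *\<^sub>R (y - x)"

lemma has_derivative_inversion:
  fixes x :: "'a::real_inner"
  assumes "y \<noteq> x"
  shows "(inversion x l has_derivative
     (\<lambda>h. (l / ((y - x) \<bullet> (y - x))) *\<^sub>R h -
          (2 * l * ((y - x) \<bullet> h) / ((y - x) \<bullet> (y - x))\<^sup>2) *\<^sub>R (y - x))) (at y)"
proof -
  have "((\<lambda>z. l / ((z - x) \<bullet> (z - x))) has_derivative
      (\<lambda>h. - (2 * l * ((y - x) \<bullet> h) / ((y - x) \<bullet> (y - x))\<^sup>2))) (at y)"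
    using assms by (auto intro!: derivative_eq_intros simp: power2_eq_square inner_commute field_simps)
  from has_derivative_add[OF has_derivative_const[of x]
      has_derivative_scaleR[OF this has_derivative_diff[OF has_derivative_ident has_derivative_const[of x]]]]
  show ?thesis unfolding inversion_def
    by (rule has_derivative_eq_rhs) (simp add: fun_eq_iff)
qed

lemma sum_axis_inner: "(\<Sum>i\<in>UNIV. (axis i 1 \<bullet> a) * b $ i) = a \<bullet> (b :: real ^ 'n)"
  by (simp add: inner_axis' inner_vec_def[of a b])

text \<open>
  The derivative of an inversion is \<open>l / s\<close> times a reflection, so the second-order
  part of the Laplacian is merely scaled; the first-order term comes from the Laplacian of the
  inversion map.
\<close>
lemma laplacian_comp_inversion:
  fixes x :: "real ^ 'n"
  assumes U: "has_laplacian U G (inversion x l y) L" and y: "y \<noteq> x"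
  defines "s \<equiv> \<lambda>z. (z - x) \<bullet> (z - x)" and "A \<equiv> \<lambda>z. G (inversion x l z)"
  shows "has_laplacian (\<lambda>z. U (inversion x l z))
     (\<lambda>z. (l / s z) *\<^sub>R A z + (- 2 * l / (s z)\<^sup>2 * ((z - x) \<bullet> A z)) *\<^sub>R (z - x)) y
     ((l / s y)\<^sup>2 * L - 2 * (real CARD('n) - 2) * l / (s y)\<^sup>2 * ((y - x) \<bullet> A y))"
proof -
  have s: "s y > 0" using y by (simp add: s_def)
  have "isCont (inversion x l) y"
    using has_derivative_inversion[OF y] has_derivative_continuous by blast
  then have "filterlim (inversion x l) (nhds (inversion x l y)) (nhds y)"
    by (simp add: isCont_def tendsto_at_iff_tendsto_nhds)
  from eventually_compose_filterlim[OF has_laplacian_ev[OF U] this]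
  have "\<forall>\<^sub>F z in nhds y. GDERIV U (inversion x l z) :> A z" by (simp add: A_def)
  moreover have "\<forall>\<^sub>F z in nhds y. z \<noteq> x" using y by (rule t1_space_nhds)
  ultimately have ev: "\<forall>\<^sub>F z in nhds y. GDERIV (\<lambda>z. U (inversion x l z)) z :>
      (l / s z) *\<^sub>R A z + (- 2 * l / (s z)\<^sup>2 * ((z - x) \<bullet> A z)) *\<^sub>R (z - x)"
  proof (rule eventually_elim2)
    fix z assume z: "GDERIV U (inversion x l z) :> A z" "z \<noteq> x"
    from has_derivative_compose[OF has_derivative_inversion[OF z(2), of l] z(1)[unfolded gderiv_def]]
    moreover have "(a *\<^sub>R h - (2 * l * (w \<bullet> h) / t) *\<^sub>R w) \<bullet> b =
        h \<bullet> (a *\<^sub>R b + (- 2 * l / t * (w \<bullet> b)) *\<^sub>R w)" for a t :: real and h w b :: "real ^ 'n"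
      by (simp add: inner_add_right inner_diff_left inner_commute[of h w] algebra_simps)
    ultimately show "GDERIV (\<lambda>z. U (inversion x l z)) z :>
      (l / s z) *\<^sub>R A z + (- 2 * l / (s z)\<^sup>2 * ((z - x) \<bullet> A z)) *\<^sub>R (z - x)"
      unfolding gderiv_def s_def by simp
  qed
  obtain H where H: "(G has_derivative H) (at (inversion x l y))" "(\<Sum>i\<in>UNIV. H (axis i 1) $ i) = L"
    using U unfolding has_laplacian_def has_div_def by blast
  interpret H: linear H by (rule has_derivative_linear[OF H(1)])
  let ?z = "y - x"
  let ?D = "\<lambda>h. (l / s y) *\<^sub>R h - (2 * l * (?z \<bullet> h) / (s y)\<^sup>2) *\<^sub>R ?z"
  have A: "(A has_derivative (\<lambda>h. H (?D h))) (at y)"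
    unfolding A_def s_def by (rule has_derivative_compose[OF has_derivative_inversion[OF y] H(1)])
  have "(\<Sum>i\<in>UNIV. H (?D (axis i 1)) $ i) =
      (\<Sum>i\<in>UNIV. (l / s y) * (H (axis i 1) $ i) - (2 * l / (s y)\<^sup>2) * ((axis i 1 \<bullet> ?z) * (H ?z $ i)))"
    by (simp add: H.diff H.scale inner_commute[of _ "axis _ 1"] mult.assoc)
  also have "\<dots> = (l / s y) * L - (2 * l / (s y)\<^sup>2) * (?z \<bullet> H ?z)"
    by (simp only: sum_subtractf sum_distrib_left[symmetric] sum_axis_inner H(2) inner_commute)
  finally have dA: "has_div A y ((l / s y) * L - (2 * l / (s y)\<^sup>2) * (?z \<bullet> H ?z))"
    using A unfolding has_div_def by blast
  have ds: "(s has_derivative (\<lambda>h. 2 * (?z \<bullet> h))) (at y)"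
    unfolding s_def by (auto intro!: derivative_eq_intros simp: inner_commute)
  have "((\<lambda>t. l / t) has_real_derivative - (l / (s y)\<^sup>2)) (at (s y))"
    using s by (auto intro!: derivative_eq_intros simp: power2_eq_square)
  from has_derivative_compose[OF ds this[unfolded has_field_derivative_def]]
  have d1: "((\<lambda>z. l / s z) has_derivative (\<lambda>h. - 2 * l / (s y)\<^sup>2 * (?z \<bullet> h))) (at y)"
    by (rule has_derivative_eq_rhs) (simp add: fun_eq_iff)
  have "((\<lambda>t. - 2 * l * (inverse t)\<^sup>2) has_real_derivative
      - 2 * l * (2 * (inverse (s y) * (- (inverse (s y) * inverse (s y)))))) (at (s y))"
    using s by (auto intro!: derivative_eq_intros)
  then have "((\<lambda>t. - 2 * l / t\<^sup>2) has_real_derivative 4 * l / (s y)^3) (at (s y))"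
    by (simp add: power2_eq_square power3_eq_cube divide_inverse mult.assoc)
  from has_derivative_compose[OF ds this[unfolded has_field_derivative_def]]
  have d2: "((\<lambda>z. - 2 * l / (s z)\<^sup>2) has_derivative (\<lambda>h. 8 * l / (s y)^3 * (?z \<bullet> h))) (at y)"
    by (rule has_derivative_eq_rhs) (simp add: fun_eq_iff)
  have d3: "((\<lambda>z. (z - x) \<bullet> A z) has_derivative (\<lambda>h. ?z \<bullet> H (?D h) + h \<bullet> A y)) (at y)"
    by (rule has_derivative_eq_rhs[OF has_derivative_inner[OF
          has_derivative_diff[OF has_derivative_ident has_derivative_const] A]]) simp
  have d4: "((\<lambda>z. - 2 * l / (s z)\<^sup>2 * ((z - x) \<bullet> A z)) has_derivative
     (\<lambda>h. - 2 * l / (s y)\<^sup>2 * (?z \<bullet> H (?D h) + h \<bullet> A y) +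
       8 * l / (s y)^3 * (?z \<bullet> h) * (?z \<bullet> A y))) (at y)"
    by (rule has_derivative_mult[OF d2 d3])
  have Dz: "H (?D ?z) = - (l / s y) *\<^sub>R H ?z"
  proof -
    have "?D ?z = (l / s y - 2 * l * s y / (s y)\<^sup>2) *\<^sub>R ?z"
      by (simp add: s_def scaleR_left_diff_distrib)
    also have "l / s y - 2 * l * s y / (s y)\<^sup>2 = - (l / s y)"
      using s by (simp add: power2_eq_square field_simps)
    finally show ?thesis by (simp only: H.scale)
  qed
  have zz: "?z \<bullet> ?z = s y" by (simp add: s_def)
  have "has_div (\<lambda>z. (l / s z) *\<^sub>R A z + (- 2 * l / (s z)\<^sup>2 * ((z - x) \<bullet> A z)) *\<^sub>R (z - x)) y
     ((l / s y)\<^sup>2 * L - 2 * (real CARD('n) - 2) * l / (s y)\<^sup>2 * (?z \<bullet> A y))"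
  proof (rule has_div_eq)
    show "has_div (\<lambda>z. (l / s z) *\<^sub>R A z + (- 2 * l / (s z)\<^sup>2 * ((z - x) \<bullet> A z)) *\<^sub>R (z - x)) y
     ((l / s y * ((l / s y) * L - (2 * l / (s y)\<^sup>2) * (?z \<bullet> H ?z)) + - 2 * l / (s y)\<^sup>2 * (?z \<bullet> A y)) +
      (- 2 * l / (s y)\<^sup>2 * (?z \<bullet> A y) * real CARD('n) +
       (- 2 * l / (s y)\<^sup>2 * (?z \<bullet> H (?D ?z) + ?z \<bullet> A y) +
       8 * l / (s y)^3 * (?z \<bullet> ?z) * (?z \<bullet> A y))))"
      by (rule has_div_add[OF has_div_scaleR[OF d1 dA] has_div_scaleR[OF d4 has_div_diff_const]])
    have zH: "?z \<bullet> H (?D ?z) = - (l / s y) * (?z \<bullet> H ?z)" by (simp only: Dz inner_scaleR_right)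
    have key: "r * (r * L - 2 * m * p) + - 2 * m * q +
        (- 2 * m * q * n + (- 2 * m * (- r * p + q) + 8 * m * q)) = r\<^sup>2 * L - 2 * (n - 2) * m * q"
      for r m p q n :: real
      by (simp add: algebra_simps power2_eq_square)
    have m: "2 * l / (s y)\<^sup>2 = 2 * (l / (s y)\<^sup>2)" "- 2 * l / (s y)\<^sup>2 = - 2 * (l / (s y)\<^sup>2)"
      "8 * l / (s y)^3 * s y = 8 * (l / (s y)\<^sup>2)"
      "2 * (real CARD('n) - 2) * l / (s y)\<^sup>2 = 2 * (real CARD('n) - 2) * (l / (s y)\<^sup>2)"
      using s by (simp_all add: power2_eq_square power3_eq_cube)
    show "((l / s y * ((l / s y) * L - (2 * l / (s y)\<^sup>2) * (?z \<bullet> H ?z)) + - 2 * l / (s y)\<^sup>2 * (?z \<bullet> A y)) +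
      (- 2 * l / (s y)\<^sup>2 * (?z \<bullet> A y) * real CARD('n) +
       (- 2 * l / (s y)\<^sup>2 * (?z \<bullet> H (?D ?z) + ?z \<bullet> A y) +
       8 * l / (s y)^3 * (?z \<bullet> ?z) * (?z \<bullet> A y)))) =
     (l / s y)\<^sup>2 * L - 2 * (real CARD('n) - 2) * l / (s y)\<^sup>2 * (?z \<bullet> A y)"
      unfolding zH unfolding zz unfolding m by (rule key)
  qed
  with ev show ?thesis unfolding has_laplacian_def by (rule conjI)
qed

text \<open>
  For \<open>a = 1 - n / 2\<close> the Laplacian vanishes: this is the fundamental solution.
\<close>
lemma has_laplacian_sq_dist_powr:
  fixes x :: "real ^ 'n"
  assumes "y \<noteq> x"
  defines "s \<equiv> \<lambda>z. (z - x) \<bullet> (z - x)"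
  shows "has_laplacian (\<lambda>z. s z powr a) (\<lambda>z. (a * s z powr (a - 1)) *\<^sub>R (2 *\<^sub>R (z - x))) y
    (2 * a * (real CARD('n) + 2 * a - 2) * s y powr (a - 1))"
proof -
  have s: "s y > 0" using assms by simp
  have "has_laplacian (\<lambda>z. s z powr a) (\<lambda>z. (a * s z powr (a - 1)) *\<^sub>R (2 *\<^sub>R (z - x))) y
    (a * s y powr (a - 1) * (2 * real CARD('n)) +
      a * ((a - 1) * s y powr (a - 1 - 1)) * ((2 *\<^sub>R (y - x)) \<bullet> (2 *\<^sub>R (y - x))))"
  proof (rule has_laplacian_compose[where S = "{0<..}"])
    show "has_laplacian s (\<lambda>z. 2 *\<^sub>R (z - x)) y (2 * real CARD('n))"
      unfolding s_def by (rule has_laplacian_sq_dist)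
  qed (use s in \<open>auto intro!: derivative_eq_intros\<close>)
  moreover have "(2 *\<^sub>R (y - x)) \<bullet> (2 *\<^sub>R (y - x)) = 4 * s y" by (simp add: s_def)
  moreover have "a * s y powr (a - 1) * (2 * real CARD('n)) +
      a * ((a - 1) * s y powr (a - 1 - 1)) * (4 * s y) =
      2 * a * (real CARD('n) + 2 * a - 2) * s y powr (a - 1)"
  proof -
    have "s y powr (a - 1 - 1) * s y = s y powr (a - 1)"
      using s by (simp add: powr_diff power2_eq_square)
    then have "a * ((a - 1) * s y powr (a - 1 - 1)) * (4 * s y) = 4 * a * (a - 1) * s y powr (a - 1)"
      by simp
    then show ?thesis by (simp add: algebra_simps)
  qed
  ultimately show ?thesis by (simp only:)
qed

text \<open>
  The factor is harmonic, and twice the inner product of its gradient with that of the composition cancels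
  the first-order term in \<open>laplacian_comp_inversion\<close>.
\<close>
lemma kelvin_transform:
  fixes x :: "real ^ 'n"
  assumes U: "has_laplacian U G (inversion x l y) L" and y: "y \<noteq> x" and l: "l > 0"
  defines "s \<equiv> \<lambda>z. (z - x) \<bullet> (z - x)" and "a \<equiv> (real CARD('n) - 2) / 2"
  shows "\<exists>F. has_laplacian (\<lambda>z. (l / s z) powr a * U (inversion x l z)) F y
     ((l / s y) powr (a + 2) * L)"
proof -
  define A where "A = G (inversion x l y)"
  have s: "s y > 0" using y by (simp add: s_def)
  have zz: "(y - x) \<bullet> (y - x) = s y" by (simp add: s_def)
  have n: "real CARD('n) = 2 * a + 2" by (simp add: a_def field_simps)
  have "has_laplacian (\<lambda>z. l powr a * s z powr (- a))
      (\<lambda>z. l powr a *\<^sub>R ((- a * s z powr (- a - 1)) *\<^sub>R (2 *\<^sub>R (z - x)))) y 0"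
    unfolding s_def
    by (rule has_laplacian_eq[OF has_laplacian_cmult[OF has_laplacian_sq_dist_powr[OF y]]])
      (simp add: n)
  then have "\<exists>F. has_laplacian (\<lambda>z. l powr a * s z powr (- a)) F y 0 \<and>
      F y = (- 2 * a * l powr a * s y powr (- a - 1)) *\<^sub>R (y - x)"
    by (intro exI conjI, assumption) (simp only: scaleR_scaleR, simp add: mult_ac)
  then obtain F where F: "has_laplacian (\<lambda>z. l powr a * s z powr (- a)) F y 0"
      "F y = (- 2 * a * l powr a * s y powr (- a - 1)) *\<^sub>R (y - x)" by blast
  obtain V where V: "has_laplacian (\<lambda>z. U (inversion x l z)) V y
     ((l / s y)\<^sup>2 * L - 4 * a * l / (s y)\<^sup>2 * ((y - x) \<bullet> A))"
     "V y = (l / s y) *\<^sub>R A + (- 2 * l / (s y)\<^sup>2 * ((y - x) \<bullet> A)) *\<^sub>R (y - x)"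
    using laplacian_comp_inversion[OF U y] unfolding A_def s_def n by (simp add: algebra_simps)
  define w where "w = (y - x) \<bullet> A"
  have FV: "F y \<bullet> V y = 2 * a * l powr a * s y powr (- a - 1) * (l / s y) * w"
  proof -
    have "F y \<bullet> V y = - 2 * a * l powr a * s y powr (- a - 1) * (l / s y * w - 2 * l / (s y)\<^sup>2 * w * s y)"
      unfolding F(2) V(2)
      by (simp only: inner_add_right inner_scaleR_left inner_scaleR_right zz w_def[symmetric])
        (simp add: algebra_simps)
    also have "l / s y * w - 2 * l / (s y)\<^sup>2 * w * s y = - (l / s y * w)"
      using s by (simp add: field_simps power2_eq_square)
    finally show ?thesis by simp
  qed
  have e1: "l powr a * s y powr (- a) * ((l / s y)\<^sup>2 * L - 4 * a * l / (s y)\<^sup>2 * w) +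
        2 * (2 * a * l powr a * s y powr (- a - 1) * (l / s y) * w) =
      (l powr a * s y powr (- a)) * (l / s y)\<^sup>2 * L"
  proof -
    have "s y powr (- a - 1) = s y powr (- a) * inverse (s y)"
      using s by (simp add: powr_diff divide_inverse)
    then show ?thesis by (simp add: divide_inverse power2_eq_square algebra_simps)
  qed
  have e2: "(l powr a * s y powr (- a)) * (l / s y)\<^sup>2 * L = (l / s y) powr (a + 2) * L"
    using s l by (simp add: powr_add powr_divide powr_minus_divide power_divide)
  have "has_laplacian (\<lambda>z. l powr a * s z powr (- a) * U (inversion x l z))
     (\<lambda>z. (l powr a * s z powr (- a)) *\<^sub>R V z + U (inversion x l z) *\<^sub>R F z) y
     ((l / s y) powr (a + 2) * L)"
    by (rule has_laplacian_eq[OF has_laplacian_mult[OF F(1) V(1)]]) (use FV e1 e2 in \<open>simp add: w_def\<close>)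
  moreover have "\<forall>\<^sub>F z in nhds y. (l / s z) powr a * U (inversion x l z) =
      l powr a * s z powr (- a) * U (inversion x l z)"
    using t1_space_nhds[OF y]
    by eventually_elim (use l in \<open>simp add: s_def powr_divide powr_minus_divide\<close>)
  ultimately show ?thesis by (intro exI) (rule has_laplacian_transform)
qed

section \<open>The conformal Laplacian in the stereographic chart\<close>

text \<open>
  The conformal factor of the chart: the metric of the sphere is its square times the Euclidean one.
\<close>
definition stereo_factor :: "real ^ 'n \<Rightarrow> real" where
  "stereo_factor y = 2 / (1 + y \<bullet> y)"

lemma one_plus_inner_pos: "0 < 1 + y \<bullet> (y :: 'a::real_inner)"
  by (metis add_pos_nonneg inner_ge_zero zero_less_one)

lemma stereo_factor_pos: "0 < stereo_factor y"
  using one_plus_inner_pos[of y] by (simp add: stereo_factor_def)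

lemma stereo_eq: "stereo y = (stereo_factor y *\<^sub>R y, 1 - stereo_factor y)"
  using one_plus_inner_pos[of y]
  by (simp add: stereo_def stereo_factor_def power2_norm_eq_inner field_simps)

lemma has_laplacian_stereo_factor_powr:
  fixes y :: "real ^ 'n"
  defines "n \<equiv> real CARD('n)"
  shows "has_laplacian (\<lambda>z. stereo_factor z powr a)
     (\<lambda>z. (- a * stereo_factor z powr (a + 1)) *\<^sub>R z) y
     (a * (2 * a + 2 - n) * stereo_factor y powr (a + 1) - a * (a + 1) * stereo_factor y powr (a + 2))"
proof -
  let ?f = "stereo_factor y"
  have q: "0 < 1 + y \<bullet> y" by (rule one_plus_inner_pos)
  have f: "?f > 0" by (rule stereo_factor_pos)
  have "has_laplacian (\<lambda>z. (2 / (1 + (z - 0) \<bullet> (z - 0))) powr a)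
     (\<lambda>z. (- (a / 2) * (2 / (1 + (z - 0) \<bullet> (z - 0))) powr (a + 1)) *\<^sub>R (2 *\<^sub>R (z - 0))) y
     (- (a / 2) * (2 / (1 + (y - 0) \<bullet> (y - 0))) powr (a + 1) * (2 * n) +
      (a * (a + 1) / 4 * (2 / (1 + (y - 0) \<bullet> (y - 0))) powr (a + 2)) *
         ((2 *\<^sub>R (y - 0)) \<bullet> (2 *\<^sub>R (y - 0))))"
  proof (rule has_laplacian_compose[where S = "{-1<..}" and q = "\<lambda>z. (z - 0) \<bullet> (z - 0)"])
    show "has_laplacian (\<lambda>z. (z - 0) \<bullet> (z - 0)) (\<lambda>z. 2 *\<^sub>R (z - 0)) y (2 * n)"
      unfolding n_def by (rule has_laplacian_sq_dist)
    have *: "((\<lambda>s. (2 / (1 + s)) powr b) has_real_derivative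
        - (b / 2) * (2 / (1 + s)) powr (b + 1)) (at s)" if "s > -1" for b s :: real
    proof -
      have d: "((\<lambda>s. (2 / (1 + s)) powr b) has_real_derivative
          b * (2 / (1 + s)) powr (b - 1) * (- (2 / (1 + s)\<^sup>2))) (at s)"
        using that by (auto intro!: derivative_eq_intros simp: power2_eq_square)
      define r where "r = 2 / (1 + s)"
      have "r > 0" and r2: "2 / (1 + s)\<^sup>2 = r * r / 2"
        using that by (simp_all add: r_def power2_eq_square)
      have "b * (2 / (1 + s)) powr (b - 1) * (- (2 / (1 + s)\<^sup>2)) =
          - (b / 2) * (2 / (1 + s)) powr (b + 1)"
        unfolding r2 unfolding r_def[symmetric]
        using \<open>r > 0\<close> by (simp add: powr_add powr_diff)
      with d show ?thesis by (rule DERIV_cong)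
    qed
    show "((\<lambda>s. (2 / (1 + s)) powr a) has_real_derivative
        - (a / 2) * (2 / (1 + s)) powr (a + 1)) (at s)" if "s \<in> {-1<..}" for s
      using * that by simp
    have "0 \<le> y \<bullet> y" by simp
    then have "y \<bullet> y > -1" by linarith
    show "((\<lambda>s. - (a / 2) * (2 / (1 + s)) powr (a + 1)) has_real_derivative
       a * (a + 1) / 4 * (2 / (1 + (y - 0) \<bullet> (y - 0))) powr (a + 2)) (at ((y - 0) \<bullet> (y - 0)))"
      by (rule DERIV_cong[OF DERIV_cmult[OF *]])
        (use \<open>y \<bullet> y > -1\<close> in \<open>simp_all add: field_simps\<close>)
    show "(y - 0) \<bullet> (y - 0) \<in> {-1<..}" using \<open>y \<bullet> y > -1\<close> by simp
  qed auto
  moreover have yy: "y \<bullet> y = 2 / ?f - 1"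
    using q by (simp add: stereo_factor_def add_divide_distrib)
  have "(- (a / 2) * ?f powr (a + 1) * (2 * n) + (a * (a + 1) / 4 * ?f powr (a + 2)) * (4 * (2 / ?f - 1))) =
     (a * (2 * a + 2 - n) * ?f powr (a + 1) - a * (a + 1) * ?f powr (a + 2))"
  proof -
    define P where "P = ?f powr (a + 1)"
    have "?f powr (a + 2) = P * ?f"
      using f powr_add[of ?f "a + 1" 1] by (simp add: P_def add.commute)
    moreover have "a * (a + 1) / 4 * (P * ?f) * (4 * (2 / ?f - 1)) = a * (a + 1) * P * (2 - ?f)"
      using f by (simp add: right_diff_distrib)
    ultimately show ?thesis unfolding P_def[symmetric] by (simp add: algebra_simps)
  qed
  ultimately show ?thesis by (simp add: yy flip: stereo_factor_def)
qed

lemma partial_has_derivative: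
  assumes "(f has_derivative H) (at y)"
  shows "partial i f y = H (axis i 1)"
proof -
  have "((\<lambda>h. f (y + h *\<^sub>R axis i 1)) has_derivative (\<lambda>k. H (k *\<^sub>R axis i 1))) (at 0)"
    by (rule has_derivative_compose[where g = f])
      (auto intro!: derivative_eq_intros simp: assms)
  moreover have "H (k *\<^sub>R axis i 1) = k *\<^sub>R H (axis i 1)" for k
    using has_derivative_linear[OF assms] by (rule linear_cmul)
  ultimately show ?thesis
    unfolding partial_def by (intro vector_derivative_at) (simp add: has_vector_derivative_def)
qed

lemma partial_gderiv: "GDERIV f y :> g \<Longrightarrow> partial i f y = g $ i"
  unfolding gderiv_def by (simp add: partial_has_derivative inner_axis')

lemma mat_mult_mat: "mat a ** mat b = (mat (a * b) :: real ^ 'n ^ 'n)"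
  by (simp add: matrix_matrix_mult_def mat_def vec_eq_iff if_distrib[of "\<lambda>x. x * _"] cong: if_cong)

lemma matrix_inv_mat:
  assumes "k \<noteq> (0 :: real)"
  shows "matrix_inv (mat k) = (mat (1 / k) :: real ^ 'n ^ 'n)"
proof -
  have k: "mat k ** mat (1 / k) = (mat 1 :: real ^ 'n ^ 'n)" "mat (1 / k) ** mat k = (mat 1 :: real ^ 'n ^ 'n)"
    using assms by (simp_all add: mat_mult_mat)
  then have "mat k ** matrix_inv (mat k) = (mat 1 :: real ^ 'n ^ 'n)"
    unfolding matrix_inv_def by (rule someI2[where a = "mat (1 / k)", OF conjI]) simp
  then have "mat (1 / k) ** (mat k ** matrix_inv (mat k)) = (mat (1 / k) :: real ^ 'n ^ 'n)"
    by simp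
  then show ?thesis by (simp add: matrix_mul_assoc k)
qed

lemma metric_tensor_stereo_factor: "metric_tensor stereo y = mat ((stereo_factor y)\<^sup>2)"
  by (simp add: metric_tensor_stereo stereo_factor_def power_divide power2_norm_eq_inner)

lemma sqrt_det_metric_stereo:
  "sqrt (det (metric_tensor stereo (y :: real ^ 'n))) = stereo_factor y ^ CARD('n)"
proof -
  have "det (mat k :: real ^ 'n ^ 'n) = k ^ CARD('n)" for k
    by (subst det_diagonal) (simp_all add: mat_def)
  then show ?thesis
    using stereo_factor_pos[of y]
    by (simp add: metric_tensor_stereo_factor real_sqrt_power)
qed

text \<open>
  For the metric \<open>f\<^sup>2 |dy|\<^sup>2\<close> the operator is \<open>f\<^sup>-\<^sup>n div (f\<^bsup>n - 2\<^esup> \<nabla> V)\<close>, and the gradient of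
  the stereographic factor \<open>f\<close> is \<open>- f\<^sup>2 y\<close>.
\<close>
lemma laplace_beltrami_stereo:
  fixes y :: "real ^ 'n"
  assumes V: "has_laplacian V G y L"
  shows "laplace_beltrami stereo V y =
    (L - (real CARD('n) - 2) * stereo_factor y * (y \<bullet> G y)) / (stereo_factor y)\<^sup>2"
proof -
  define n where "n = real CARD('n)"
  let ?f = "stereo_factor :: real ^ 'n \<Rightarrow> real"
  define B where "B = (\<lambda>z. ?f z powr (n - 2) *\<^sub>R G z)"
  have f: "?f z > 0" for z by (rule stereo_factor_pos)
  have fn: "?f z ^ CARD('n) = ?f z powr n" for z
    using f[of z] by (simp add: n_def powr_realpow)
  have grad: "GDERIV (\<lambda>z. ?f z powr (n - 2)) y :> (- (n - 2) * ?f y powr (n - 2 + 1)) *\<^sub>R y"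
    by (rule has_laplacian_gderiv[OF has_laplacian_stereo_factor_powr])
  have "has_div B y (?f y powr (n - 2) * L + ((- (n - 2) * ?f y powr (n - 2 + 1)) *\<^sub>R y) \<bullet> G y)"
    unfolding B_def by (rule has_div_scaleR_gderiv[OF grad]) (use V in \<open>simp add: has_laplacian_def\<close>)
  then obtain H where H: "(B has_derivative H) (at y)"
    "(\<Sum>i\<in>UNIV. H (axis i 1) $ i) =
       ?f y powr (n - 2) * L + ((- (n - 2) * ?f y powr (n - 2 + 1)) *\<^sub>R y) \<bullet> G y"
    unfolding has_div_def by blast
  have "partial i (\<lambda>z. sqrt (det (metric_tensor stereo z)) *
      (\<Sum>j\<in>UNIV. matrix_inv (metric_tensor stereo z) $ i $ j * partial j V z)) y = H (axis i 1) $ i" for i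
  proof -
    have "\<forall>\<^sub>F z in nhds y. sqrt (det (metric_tensor stereo z)) *
      (\<Sum>j\<in>UNIV. matrix_inv (metric_tensor stereo z) $ i $ j * partial j V z) = B z $ i"
      using has_laplacian_ev[OF V]
    proof eventually_elim
      case (elim z)
      have "(\<Sum>j\<in>UNIV. matrix_inv (metric_tensor stereo z) $ i $ j * partial j V z) =
          1 / (?f z)\<^sup>2 * G z $ i"
      proof -
        have "matrix_inv (metric_tensor stereo z) = mat (1 / (?f z)\<^sup>2)"
          unfolding metric_tensor_stereo_factor using f[of z] by (intro matrix_inv_mat) simp
        then show ?thesis
          by (simp add: partial_gderiv[OF elim] mat_def if_distrib[of "\<lambda>x. x * _"] cong: if_cong)
      qed
      moreover have "?f z powr (n - 2) = ?f z powr n / (?f z)\<^sup>2"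
        using f[of z] by (simp add: powr_diff powr_numeral)
      ultimately show ?case by (simp add: sqrt_det_metric_stereo fn B_def)
    qed
    then have ev: "\<forall>\<^sub>F z in at y. B z $ i = sqrt (det (metric_tensor stereo z)) *
      (\<Sum>j\<in>UNIV. matrix_inv (metric_tensor stereo z) $ i $ j * partial j V z)"
      and eq: "B y $ i = sqrt (det (metric_tensor stereo y)) *
      (\<Sum>j\<in>UNIV. matrix_inv (metric_tensor stereo y) $ i $ j * partial j V y)"
      by (auto simp: eventually_at_filter elim: eventually_mono dest: eventually_nhds_x_imp_x)
    have "((\<lambda>z. B z $ i) has_derivative (\<lambda>h. H h $ i)) (at y)"
      by (rule bounded_linear.has_derivative[OF bounded_linear_vec_nth H(1)])
    from partial_has_derivative[OF has_derivative_transform_eventually[OF this ev eq UNIV_I]]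
    show ?thesis .
  qed
  moreover have "(\<Sum>i\<in>UNIV. H (axis i 1) $ i) =
      ?f y powr (n - 2) * L - (n - 2) * ?f y powr (n - 2 + 1) * (y \<bullet> G y)"
    unfolding H(2) inner_scaleR_left by (simp add: algebra_simps)
  ultimately have "laplace_beltrami stereo V y =
     (?f y powr (n - 2) * L - (n - 2) * ?f y powr (n - 2 + 1) * (y \<bullet> G y)) / ?f y powr n"
    by (simp add: laplace_beltrami_def sqrt_det_metric_stereo fn)
  also have "?f y powr (n - 2 + 1) = ?f y powr (n - 2) * ?f y"
    using f[of y] powr_add[of "?f y" "n - 2" 1] by simp
  also have "(?f y powr (n - 2) * L - (n - 2) * (?f y powr (n - 2) * ?f y) * (y \<bullet> G y)) / ?f y powr n =
     (?f y powr (n - 2) / ?f y powr n) * (L - (n - 2) * ?f y * (y \<bullet> G y))"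
    by (simp add: algebra_simps diff_divide_distrib)
  also have "?f y powr (n - 2) / ?f y powr n = 1 / (?f y)\<^sup>2"
    using f[of y] by (simp add: powr_diff)
  finally show ?thesis by (simp add: n_def)
qed

text \<open>
  Conformal covariance: multiplication by \<open>f\<^sup>a\<close> with \<open>a = (n - 2) / 2\<close> removes the first-order term, and
  the Laplacian of \<open>f\<^sup>a\<close> itself produces the zeroth-order term of the conformal Laplacian.
\<close>
lemma has_laplacian_conformal:
  fixes y :: "real ^ 'n"
  assumes V: "has_laplacian V G y L"
  defines "n \<equiv> real CARD('n)"
  defines "a \<equiv> (n - 2) / 2"
  shows "\<exists>F. has_laplacian (\<lambda>z. stereo_factor z powr a * V z) F y
     (stereo_factor y powr (a + 2) * (laplace_beltrami stereo V y - n * (n - 2) / 4 * V y))"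
proof -
  let ?f = "stereo_factor y" and ?w = "y \<bullet> G y"
  have f: "?f > 0" by (rule stereo_factor_pos)
  have n: "n = 2 * a + 2" by (simp add: a_def field_simps)
  define P where "P = ?f powr a"
  have p: "?f powr (a + 1) = P * ?f" "?f powr (a + 2) = P * ?f\<^sup>2"
    using f by (simp_all add: P_def powr_add)
  have lap: "laplace_beltrami stereo V y = (L - 2 * a * ?f * ?w) / ?f\<^sup>2"
    using laplace_beltrami_stereo[OF V] by (simp add: n flip: n_def)
  have "has_laplacian (\<lambda>z. stereo_factor z powr a * V z)
     (\<lambda>z. stereo_factor z powr a *\<^sub>R G z + V z *\<^sub>R ((- a * stereo_factor z powr (a + 1)) *\<^sub>R z)) y
     (P * L + 2 * (((- a * ?f powr (a + 1)) *\<^sub>R y) \<bullet> G y) +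
        V y * (a * (2 * a + 2 - n) * ?f powr (a + 1) - a * (a + 1) * ?f powr (a + 2)))"
    unfolding P_def n_def by (rule has_laplacian_mult[OF has_laplacian_stereo_factor_powr V])
  moreover have "P * L + 2 * (((- a * ?f powr (a + 1)) *\<^sub>R y) \<bullet> G y) +
        V y * (a * (2 * a + 2 - n) * ?f powr (a + 1) - a * (a + 1) * ?f powr (a + 2)) =
     ?f powr (a + 2) * (laplace_beltrami stereo V y - n * (n - 2) / 4 * V y)"
  proof -
    define X where "X = (L - 2 * a * ?f * ?w) / ?f\<^sup>2"
    have "?f\<^sup>2 * X = L - 2 * a * ?f * ?w"
      using f by (simp add: X_def)
    then have "P * ?f\<^sup>2 * (X - Y) = P * (L - 2 * a * ?f * ?w) - P * ?f\<^sup>2 * Y" for Y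
      by (simp only: right_diff_distrib mult.assoc)
    moreover have nn: "n * (n - 2) / 4 = a * (a + 1)" by (simp add: n algebra_simps)
    ultimately show ?thesis unfolding p lap X_def[symmetric] nn by (simp add: n algebra_simps)
  qed
  ultimately show ?thesis by auto
qed

lemma C2_on_has_laplacian:
  fixes V :: "real ^ 'n \<Rightarrow> real"
  assumes "C2_on S V" "open S"
  obtains G where "\<And>y. y \<in> S \<Longrightarrow> \<exists>L. has_laplacian V G y L"
proof -
  obtain f' :: "real ^ 'n \<Rightarrow> (real ^ 'n) \<Rightarrow>\<^sub>L real" and f'' where
    f': "\<And>x. x \<in> S \<Longrightarrow> (V has_derivative blinfun_apply (f' x)) (at x)" and
    f'': "\<And>x. x \<in> S \<Longrightarrow> (f' has_derivative blinfun_apply (f'' x)) (at x)"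
    using assms(1) unfolding C2_on_def by blast
  define G where "G = (\<lambda>x. \<Sum>i\<in>UNIV. blinfun_apply (f' x) (axis i 1) *\<^sub>R (axis i 1 :: real ^ 'n))"
  have Gh: "blinfun_apply (f' x) h = h \<bullet> G x" for x h
  proof -
    have "blinfun_apply (f' x) h = blinfun_apply (f' x) (\<Sum>i\<in>UNIV. (h $ i) *\<^sub>R axis i 1)"
      using basis_expansion[of h] by (simp add: scalar_mult_eq_scaleR)
    then show ?thesis
      by (simp add: G_def inner_sum_right inner_axis blinfun.sum_right blinfun.scaleR_right mult.commute)
  qed
  have "\<exists>L. has_laplacian V G y L" if y: "y \<in> S" for y
  proof -
    have "\<forall>\<^sub>F z in nhds y. z \<in> S" using assms(2) y by (rule eventually_nhds_in_open)
    then have "\<forall>\<^sub>F z in nhds y. GDERIV V z :> G z"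
    proof (rule eventually_mono)
      fix z assume "z \<in> S"
      then show "GDERIV V z :> G z"
        using f'[of z] unfolding gderiv_def by (simp add: Gh[abs_def])
    qed
    moreover have "(G has_derivative (\<lambda>h. \<Sum>i\<in>UNIV. blinfun_apply (blinfun_apply (f'' y) h) (axis i 1) *\<^sub>R
        (axis i 1 :: real ^ 'n))) (at y)"
      unfolding G_def
      by (intro has_derivative_sum has_derivative_scaleR_left
          bounded_linear.has_derivative[OF blinfun.bounded_linear_left] f'' y)
    ultimately show ?thesis unfolding has_laplacian_def has_div_def by blast
  qed
  then show ?thesis by (rule that)
qed

section \<open>Conformal reflections of the sphere\<close>

definition cap_den :: "real ^ 'n \<Rightarrow> real \<Rightarrow> (real ^ 'n) \<times> real \<Rightarrow> real" where
  "cap_den e c \<theta> = 1 - 2 * c * (fst \<theta> \<bullet> e) + c\<^sup>2"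

definition stretch :: "real ^ 'n \<Rightarrow> real \<Rightarrow> (real ^ 'n) \<times> real \<Rightarrow> real" where
  "stretch e c \<theta> = (1 - c\<^sup>2) / cap_den e c \<theta>"

text \<open>
  The inversion of the ambient space with centre \<open>e / c\<close> and squared radius \<open>1 / c\<^sup>2 - 1\<close>, restricted to the
  unit sphere and cleared of denominators, so that it also makes sense for \<open>c = 0\<close>, where it is the
  reflection in the hyperplane orthogonal to \<open>e\<close>. Its conformal factor is \<open>stretch\<close>.
\<close>
definition cap_refl :: "real ^ 'n \<Rightarrow> real \<Rightarrow> (real ^ 'n) \<times> real \<Rightarrow> (real ^ 'n) \<times> real" where
  "cap_refl e c \<theta> = (1 / cap_den e c \<theta>) *\<^sub>R ((1 - c\<^sup>2) *\<^sub>R \<theta> + (2 * (c - fst \<theta> \<bullet> e)) *\<^sub>R (e, 0))"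

lemma punctured_sphere_iff:
  fixes \<theta> :: "(real ^ 'n) \<times> real"
  shows "\<theta> \<in> punctured_sphere \<longleftrightarrow> norm \<theta> = 1 \<and> fst \<theta> \<noteq> 0"
proof -
  obtain x t where \<theta>: "\<theta> = (x, t)" by (cases \<theta>)
  have "norm (0 :: real ^ 'n, t) = 1 \<longleftrightarrow> t = 1 \<or> t = -1"
    by (auto simp: norm_Pair)
  then show ?thesis by (auto simp: \<theta> punctured_sphere_def north_def south_def)
qed

lemma norm_stereo: "norm (stereo y) = 1"
proof -
  define f where "f = stereo_factor y"
  have f: "f * (1 + y \<bullet> y) = 2"
    using one_plus_inner_pos[of y] nonzero_eq_divide_eq[of "1 + y \<bullet> y" f 2]
    by (simp add: f_def stereo_factor_def)
  have "(norm (stereo y))\<^sup>2 = f * (f * (1 + y \<bullet> y)) + 1 - 2 * f"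
    unfolding power2_norm_eq_inner
    by (simp add: stereo_eq f_def[symmetric] inner_prod_def algebra_simps)
  then have "(norm (stereo y))\<^sup>2 = 1\<^sup>2" by (simp add: f)
  then show ?thesis by (rule power2_eq_imp_eq) simp_all
qed

lemma sphere_inner_less:
  assumes "norm e = 1" "norm (\<theta> :: (real ^ 'n) \<times> real) = 1"
  shows "fst \<theta> \<bullet> e \<le> 1"
proof -
  have "fst \<theta> \<bullet> e \<le> norm (fst \<theta>) * norm e" by (rule norm_cauchy_schwarz)
  also have "\<dots> \<le> 1" using norm_fst_le[of "fst \<theta>" "snd \<theta>"] assms by simp
  finally show ?thesis .
qed

context
  fixes e :: "real ^ 'n" and c :: real
  assumes e: "norm e = 1" and c: "0 \<le> c" "c < 1"
begin

lemma inner_e_e: "e \<bullet> e = 1" using e by (simp add: norm_eq_1)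

lemma cap_den_pos:
  assumes "norm \<theta> = 1"
  shows "cap_den e c \<theta> > 0"
proof -
  have "c * (fst \<theta> \<bullet> e) \<le> c" using mult_left_mono[OF sphere_inner_less[OF e assms] c(1)] by simp
  then have "cap_den e c \<theta> \<ge> (1 - c)\<^sup>2" by (simp add: cap_den_def power2_eq_square algebra_simps)
  moreover have "(1 - c)\<^sup>2 > 0" using c by simp
  ultimately show ?thesis by linarith
qed

lemma one_minus_csq: "1 - c\<^sup>2 > 0"
  using c by (simp add: power_less_one_iff abs_square_less_1)

lemma stretch_pos: "norm \<theta> = 1 \<Longrightarrow> stretch e c \<theta> > 0"
  using cap_den_pos one_minus_csq by (simp add: stretch_def)

lemma stretch_gt_1:
  assumes "norm \<theta> = 1" "fst \<theta> \<bullet> e > c" "c > 0"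
  shows "stretch e c \<theta> > 1"
  using cap_den_pos[OF assms(1)] mult_strict_left_mono[OF assms(2,3)]
  by (simp add: stretch_def cap_den_def power2_eq_square)

lemma snd_refl: "snd (cap_refl e c \<theta>) = stretch e c \<theta> * snd \<theta>"
  by (simp add: cap_refl_def stretch_def)

lemma fst_refl: "fst (cap_refl e c \<theta>) = (1 / cap_den e c \<theta>) *\<^sub>R ((1 - c\<^sup>2) *\<^sub>R fst \<theta> + (2 * (c - fst \<theta> \<bullet> e)) *\<^sub>R e)"
  by (simp add: cap_refl_def)

lemma fst_refl_inner:
  "fst (cap_refl e c \<theta>) \<bullet> e = ((1 - c\<^sup>2) * (fst \<theta> \<bullet> e) + 2 * (c - fst \<theta> \<bullet> e)) / cap_den e c \<theta>"
  by (simp add: fst_refl inner_add_left inner_e_e add_divide_distrib)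

lemma c_minus_refl:
  assumes "norm \<theta> = 1"
  shows "c - fst (cap_refl e c \<theta>) \<bullet> e = (fst \<theta> \<bullet> e - c) * stretch e c \<theta>"
proof -
  have "c * cap_den e c \<theta> - ((1 - c\<^sup>2) * (fst \<theta> \<bullet> e) + 2 * (c - fst \<theta> \<bullet> e)) = (fst \<theta> \<bullet> e - c) * (1 - c\<^sup>2)"
    by (simp add: cap_den_def power2_eq_square algebra_simps)
  then show ?thesis using cap_den_pos[OF assms]
    by (simp add: fst_refl_inner stretch_def divide_simps)
qed

lemma norm_refl:
  assumes "norm \<theta> = 1"
  shows "norm (cap_refl e c \<theta>) = 1"
proof -
  define s where "s = fst \<theta> \<bullet> e"
  have "\<theta> \<bullet> \<theta> = 1" using assms by (simp add: norm_eq_1)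
  moreover have "\<theta> \<bullet> (e, 0) = s" "(e, 0::real) \<bullet> (e, 0) = 1" by (simp_all add: s_def inner_prod_def inner_e_e)
  ultimately have "((1 - c\<^sup>2) *\<^sub>R \<theta> + (2 * (c - s)) *\<^sub>R (e, 0)) \<bullet> ((1 - c\<^sup>2) *\<^sub>R \<theta> + (2 * (c - s)) *\<^sub>R (e, 0)) =
     (1 - c\<^sup>2)\<^sup>2 + 4 * (c - s) * (1 - c\<^sup>2) * s + 4 * (c - s)\<^sup>2"
    by (simp only: inner_add_left inner_add_right inner_scaleR_left inner_scaleR_right
        inner_commute[of "(e, 0)" \<theta>]) (simp add: power2_eq_square algebra_simps)
  also have "\<dots> = (cap_den e c \<theta>)\<^sup>2"
    by (simp add: cap_den_def flip: s_def) (simp add: power2_eq_square algebra_simps)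
  finally show ?thesis using cap_den_pos[OF assms]
    by (simp add: cap_refl_def norm_eq_sqrt_inner power2_eq_square flip: s_def)
qed

lemma stretch_refl:
  assumes "norm \<theta> = 1"
  shows "stretch e c (cap_refl e c \<theta>) = 1 / stretch e c \<theta>"
proof -
  have D: "cap_den e c \<theta> > 0" by (rule cap_den_pos[OF assms])
  have "cap_den e c (cap_refl e c \<theta>) = 1 - c\<^sup>2 + 2 * c * (c - fst (cap_refl e c \<theta>) \<bullet> e)"
    by (simp add: cap_den_def power2_eq_square algebra_simps)
  also have "\<dots> = (1 - c\<^sup>2) * (cap_den e c \<theta> + 2 * c * (fst \<theta> \<bullet> e - c)) / cap_den e c \<theta>"
    unfolding c_minus_refl[OF assms] using D by (simp add: stretch_def field_simps)
  also have "cap_den e c \<theta> + 2 * c * (fst \<theta> \<bullet> e - c) = 1 - c\<^sup>2"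
    by (simp add: cap_den_def power2_eq_square algebra_simps)
  finally show ?thesis using one_minus_csq by (simp add: stretch_def)
qed

lemma refl_refl:
  assumes "norm \<theta> = 1"
  shows "cap_refl e c (cap_refl e c \<theta>) = \<theta>"
proof -
  define D where "D = cap_den e c \<theta>"
  define D' where "D' = cap_den e c (cap_refl e c \<theta>)"
  define s where "s = fst \<theta> \<bullet> e"
  define k where "k = 1 - c\<^sup>2"
  have D: "D > 0" "D' > 0" "k > 0"
    using cap_den_pos assms norm_refl one_minus_csq by (simp_all add: D_def D'_def k_def)
  have kD: "k / D' = D / k" using stretch_refl[OF assms] by (simp add: stretch_def D_def D'_def k_def)
  then have kk: "1 / D' = D / k / k" using D by (simp add: field_simps)
  have cs: "2 * (c - fst (cap_refl e c \<theta>) \<bullet> e) = - (2 * (c - s)) * (k / D)"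
  proof -
    have "stretch e c \<theta> = k / D" by (simp add: stretch_def k_def D_def)
    then show ?thesis unfolding c_minus_refl[OF assms] s_def[symmetric]
      by (simp only:) (simp only: mult.assoc[symmetric] minus_mult_right, simp)
  qed
  have "cap_refl e c (cap_refl e c \<theta>) =
      (1 / D') *\<^sub>R (k *\<^sub>R ((1 / D) *\<^sub>R (k *\<^sub>R \<theta> + (2 * (c - s)) *\<^sub>R (e, 0))) + (- (2 * (c - s)) * (k / D)) *\<^sub>R (e, 0))"
    unfolding cap_refl_def[of e c "cap_refl e c \<theta>"] cs D'_def[symmetric] k_def[symmetric]
    unfolding cap_refl_def D_def[symmetric] k_def[symmetric] s_def[symmetric] ..
  also have "k *\<^sub>R ((1 / D) *\<^sub>R (k *\<^sub>R \<theta> + (2 * (c - s)) *\<^sub>R (e, 0 :: real))) = (k / D * k) *\<^sub>R \<theta> + ((2 * (c - s)) * (k / D)) *\<^sub>R (e, 0)"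
    by (simp only: scaleR_add_right scaleR_scaleR) (simp add: mult_ac)
  also have "(1 / D') *\<^sub>R ((k / D * k) *\<^sub>R \<theta> + ((2 * (c - s)) * (k / D)) *\<^sub>R (e, 0 :: real) + (- (2 * (c - s)) * (k / D)) *\<^sub>R (e, 0)) =
      (1 / D' * (k / D * k)) *\<^sub>R \<theta>"
    by (simp only: add.assoc scaleR_add_left[symmetric] scaleR_scaleR mult_minus_left) (simp add: zero_prod_def[symmetric])
  also have "1 / D' * (k / D * k) = 1" unfolding kk using D by simp
  finally show ?thesis by simp
qed

text \<open>
  In the chart the hypersphere is the Euclidean sphere with centre \<open>e / c\<close> and squared radius \<open>1 / c\<^sup>2 - 1\<close>,
  so the reflection is the inversion in that sphere. The second identity is the chain rule for
  conformal factors.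
\<close>
lemma stereo_inversion:
  assumes c0: "c > 0" and y: "y \<noteq> (1 / c) *\<^sub>R e"
  defines "J \<equiv> inversion ((1 / c) *\<^sub>R e) (1 / c\<^sup>2 - 1)"
  defines "r \<equiv> (y - (1 / c) *\<^sub>R e) \<bullet> (y - (1 / c) *\<^sub>R e)"
  shows "stereo (J y) = cap_refl e c (stereo y)"
    and "stretch e c (stereo y) * stereo_factor y = (1 / c\<^sup>2 - 1) / r * stereo_factor (J y)"
proof -
  define p q K f D where "p = y \<bullet> e" and "q = y \<bullet> y" and "K = c\<^sup>2 * r"
    and "f = stereo_factor y" and "D = cap_den e c (stereo y)"
  have r0: "r > 0" using y by (simp add: r_def)
  have r: "r = q - 2 * p / c + 1 / c\<^sup>2"
    using c0 by (simp add: r_def inner_diff_left inner_diff_right p_def q_def inner_commute inner_e_e power2_eq_square)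
  have K: "K = c\<^sup>2 * q - 2 * c * p + 1" "K > 0"
    using c0 r0 by (simp_all add: K_def) (simp add: r field_simps power2_eq_square)
  have f: "f > 0" "f * (1 + q) = 2"
    using stereo_factor_pos[of y] one_plus_inner_pos[of y] nonzero_eq_divide_eq[of "1 + q" f 2]
    by (simp_all add: f_def stereo_factor_def q_def)
  have D_eq: "D = 1 - 2 * c * (f * p) + c\<^sup>2"
    by (simp add: D_def cap_den_def stereo_eq f_def p_def)
  have D: "D > 0" unfolding D_def by (rule cap_den_pos[OF norm_stereo])
  have lr: "(1 / c\<^sup>2 - 1) / r = (1 - c\<^sup>2) / K"
    using c0 r0 by (simp add: K_def field_simps)
  have J: "J y = ((1 - c\<^sup>2) / K) *\<^sub>R y + ((1 - (1 - c\<^sup>2) / K) / c) *\<^sub>R e"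
    unfolding J_def inversion_def r_def[symmetric] lr
    by (simp add: scaleR_diff_right scaleR_left_diff_distrib diff_divide_distrib)
  define m where "m = (1 - c\<^sup>2) / K"
  have JJ: "J y \<bullet> J y = m\<^sup>2 * q + 2 * m * ((1 - m) / c) * p + ((1 - m) / c)\<^sup>2"
    unfolding J m_def[symmetric]
    by (simp add: inner_add_left inner_add_right inner_commute inner_e_e p_def q_def power2_eq_square algebra_simps)
  have mK: "m * K = 1 - c\<^sup>2" using K(2) by (simp add: m_def)
  have "c\<^sup>2 * (1 + J y \<bullet> J y) * K = c\<^sup>2 * D * (1 + q)"
  proof -
    have "c\<^sup>2 * (J y \<bullet> J y) = m\<^sup>2 * (c\<^sup>2 * q - 2 * c * p + 1) + 2 * m * (c * p - 1) + 1"
      unfolding JJ using c0 by (simp add: field_simps power2_eq_square)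
    then have "c\<^sup>2 * (J y \<bullet> J y) * K = (m\<^sup>2 * K + 2 * m * (c * p - 1) + 1) * K"
      unfolding K(1)[symmetric] by simp
    also have "\<dots> = m * K * (m * K) + 2 * (m * K) * (c * p - 1) + K"
      by (simp add: power2_eq_square algebra_simps)
    finally have "c\<^sup>2 * (J y \<bullet> J y) * K = m * K * (m * K) + 2 * (m * K) * (c * p - 1) + K" .
    then have 1: "c\<^sup>2 * (J y \<bullet> J y) * K = (1 - c\<^sup>2)\<^sup>2 + 2 * (1 - c\<^sup>2) * (c * p - 1) + K"
      unfolding mK by (simp add: power2_eq_square)
    have "D * (1 + q) = (1 + c\<^sup>2) * (1 + q) - 2 * c * p * (f * (1 + q))"
      unfolding D_eq by (simp add: algebra_simps)
    then have 2: "D * (1 + q) = (1 + c\<^sup>2) * (1 + q) - 4 * c * p" by (simp add: f)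
    have "c\<^sup>2 * (1 + J y \<bullet> J y) * K = c\<^sup>2 * K + c\<^sup>2 * (J y \<bullet> J y) * K" by (simp add: algebra_simps)
    also have "\<dots> = c\<^sup>2 * (D * (1 + q))"
      unfolding 1 2 unfolding K(1) by (simp add: power2_eq_square algebra_simps)
    finally show ?thesis by simp
  qed
  then have "(1 + J y \<bullet> J y) * K = D * (1 + q)" using c0 by simp
  moreover have "K \<noteq> 0" using K(2) by simp
  ultimately have "1 + J y \<bullet> J y = D * (1 + q) / K" by (metis nonzero_eq_divide_eq)
  then have fJ: "stereo_factor (J y) = f * K / D"
    unfolding stereo_factor_def f_def q_def by simp
  show "stretch e c (stereo y) * stereo_factor y = (1 / c\<^sup>2 - 1) / r * stereo_factor (J y)"
    unfolding lr fJ using K by (simp add: stretch_def f_def flip: D_def)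
  have "stereo_factor (J y) *\<^sub>R J y = (1 / D) *\<^sub>R ((1 - c\<^sup>2) *\<^sub>R (f *\<^sub>R y) + (2 * (c - f * p)) *\<^sub>R e)"
  proof -
    have "f * K / D * m = 1 / D * ((1 - c\<^sup>2) * f)" using K(2) by (simp add: m_def)
    moreover have "f * K / D * ((1 - m) / c) = 1 / D * (2 * (c - f * p))"
    proof -
      have "f * (K * (1 - m)) = f * (K - m * K)" by (simp add: algebra_simps)
      also have "\<dots> = f * c\<^sup>2 * (1 + q) - 2 * c * f * p"
        unfolding mK unfolding K(1) by (simp add: algebra_simps)
      also have "\<dots> = c\<^sup>2 * (f * (1 + q)) - 2 * c * f * p" by (simp only: mult_ac)
      also have "\<dots> = c * (2 * (c - f * p))"
        unfolding f(2) by (simp add: algebra_simps power2_eq_square)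
      finally have eq: "f * (K * (1 - m)) = c * (2 * (c - f * p))" .
      have "f * K / D * ((1 - m) / c) = f * (K * (1 - m)) / (c * D)" by (simp add: mult_ac)
      then show ?thesis unfolding eq using c0 by simp
    qed
    ultimately show ?thesis
      unfolding fJ unfolding J m_def[symmetric] by (simp only: scaleR_add_right scaleR_scaleR)
  qed
  moreover have "1 - stereo_factor (J y) = (1 / D) * ((1 - c\<^sup>2) * (1 - f))"
  proof -
    have "D - f * K = 1 + c\<^sup>2 - f - c * c * (f * q)"
      unfolding D_eq K(1) by (simp add: algebra_simps power2_eq_square)
    also have "f * q = 2 - f" using f(2) by (simp add: algebra_simps)
    finally have "D - f * K = (1 - c\<^sup>2) * (1 - f)" by (simp add: algebra_simps power2_eq_square)
    then show ?thesis unfolding fJ using D by (simp add: field_simps)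
  qed
  ultimately show "stereo (J y) = cap_refl e c (stereo y)"
    unfolding cap_refl_def D_def[symmetric]
    by (simp add: stereo_eq f_def p_def prod_eq_iff)
qed

end

lemma powr_diff_bound:
  fixes A B M p :: real
  assumes "0 < A" "0 < B" "A \<le> M" "B \<le> M" "p \<ge> 1"
  shows "\<bar>A powr p - B powr p\<bar> \<le> p * M powr (p - 1) * \<bar>A - B\<bar>"
proof -
  have *: "B powr p - A powr p \<le> p * M powr (p - 1) * (B - A)" if AB: "0 < A" "A < B" "B \<le> M" for A B
  proof -
    have "((\<lambda>x. x powr p) has_real_derivative p * x powr (p - 1)) (at x)" if "A \<le> x" for x
      using that AB(1) by (auto intro!: derivative_eq_intros)
    then obtain z where z: "A < z" "z < B" "B powr p - A powr p = (B - A) * (p * z powr (p - 1))"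
      using MVT2[OF AB(2), of "\<lambda>x. x powr p" "\<lambda>x. p * x powr (p - 1)"] by blast
    have "z powr (p - 1) \<le> M powr (p - 1)" using z AB assms(5) by (intro powr_mono2) auto
    then have "p * z powr (p - 1) \<le> p * M powr (p - 1)" using assms(5) by simp
    then show ?thesis using z(3) mult_left_mono[of _ _ "B - A"] AB by (simp add: mult.commute)
  qed
  have mono: "x powr p \<le> z powr p" if "0 < x" "x \<le> z" for x z
    using that assms(5) by (intro powr_mono2) auto
  consider "A < B" | "A = B" | "B < A" by linarith
  then show ?thesis
  proof cases
    case 1
    then show ?thesis using *[OF assms(1) 1 assms(4)] mono[of A B] assms(1) by simp
  next
    case 3
    then show ?thesis using *[OF assms(2) 3 assms(3)] mono[of B A] assms(2) by simp
  qed simp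
qed

lemma tendsto_cap_den:
  "(c \<longlongrightarrow> c0) F \<Longrightarrow> (\<theta> \<longlongrightarrow> \<theta>0) F \<Longrightarrow> ((\<lambda>x. cap_den e (c x) (\<theta> x)) \<longlongrightarrow> cap_den e c0 \<theta>0) F"
  unfolding cap_den_def by (intro tendsto_intros)

lemma tendsto_stretch:
  assumes "(c \<longlongrightarrow> c0) F" "(\<theta> \<longlongrightarrow> \<theta>0) F" "norm e = 1" "0 \<le> c0" "c0 < 1" "norm \<theta>0 = 1"
  shows "((\<lambda>x. stretch e (c x) (\<theta> x)) \<longlongrightarrow> stretch e c0 \<theta>0) F"
  unfolding stretch_def using cap_den_pos[OF assms(3-6)]
  by (intro tendsto_intros tendsto_cap_den assms) auto

lemma tendsto_cap_refl:
  assumes "(c \<longlongrightarrow> c0) F" "(\<theta> \<longlongrightarrow> \<theta>0) F" "norm e = 1" "0 \<le> c0" "c0 < 1" "norm \<theta>0 = 1"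
  shows "((\<lambda>x. cap_refl e (c x) (\<theta> x)) \<longlongrightarrow> cap_refl e c0 \<theta>0) F"
  unfolding cap_refl_def using cap_den_pos[OF assms(3-6)]
  by (intro tendsto_intros tendsto_cap_den assms) auto

lemma tendsto_stereo_factor: "(g \<longlongrightarrow> y) F \<Longrightarrow> ((\<lambda>x. stereo_factor (g x)) \<longlongrightarrow> stereo_factor y) F"
  unfolding stereo_factor_def using one_plus_inner_pos[of y] by (intro tendsto_intros) auto

lemma tendsto_stereo: "(g \<longlongrightarrow> y) F \<Longrightarrow> ((\<lambda>x. stereo (g x)) \<longlongrightarrow> stereo y) F"
  unfolding stereo_eq by (intro tendsto_intros tendsto_stereo_factor)

lemma tendsto_stereo_coord:
  "(g \<longlongrightarrow> \<theta>) F \<Longrightarrow> snd \<theta> \<noteq> 1 \<Longrightarrow> ((\<lambda>x. stereo_coord (g x)) \<longlongrightarrow> stereo_coord \<theta>) F"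
  unfolding stereo_coord_def by (intro tendsto_intros) auto

lemma fst_stereo_eq_0: "fst (stereo y) = 0 \<longleftrightarrow> y = 0"
  using stereo_factor_pos[of y] by (simp add: stereo_eq)

lemma stereo_in_punctured: "stereo y \<in> punctured_sphere \<longleftrightarrow> y \<noteq> 0"
  by (simp add: punctured_sphere_iff norm_stereo fst_stereo_eq_0)

lemma snd_stereo_eq_0: "snd (stereo y) = 0 \<longleftrightarrow> norm y = 1"
  using one_plus_inner_pos[of y] by (simp add: stereo_eq stereo_factor_def norm_eq_1 divide_eq_eq)

lemma punctured_stereo_coord:
  fixes \<theta> :: "(real ^ 'n) \<times> real"
  assumes "norm \<theta> = 1" "fst \<theta> \<noteq> 0"
  shows "stereo (stereo_coord \<theta>) = \<theta>" "stereo_coord \<theta> \<noteq> 0" "snd \<theta> \<noteq> 1"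
proof -
  have "\<theta> \<noteq> north" using assms(2) by (auto simp: north_def)
  then show 1: "stereo (stereo_coord \<theta>) = \<theta>" using assms(1) by (intro stereo_stereo_coord) auto
  show "stereo_coord \<theta> \<noteq> 0" using 1 assms(2) fst_stereo_eq_0[of "stereo_coord \<theta>"] by auto
  have "snd \<theta> = 1 - stereo_factor (stereo_coord \<theta>)" by (subst 1[symmetric]) (simp add: stereo_eq)
  then show "snd \<theta> \<noteq> 1" using stereo_factor_pos[of "stereo_coord \<theta>"] by simp
qed

text \<open>
  The open cap without the (at most two) points that the reflection sends to a pole.
\<close>
definition cap_region :: "real ^ 'n \<Rightarrow> real \<Rightarrow> ((real ^ 'n) \<times> real) set" where
  "cap_region e c = {\<theta>. norm \<theta> = 1 \<and> c < fst \<theta> \<bullet> e \<and> fst (cap_refl e c \<theta>) \<noteq> 0}"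

lemma cap_region_punctured:
  assumes "norm e = 1" "0 \<le> c" "c < 1" "\<theta> \<in> cap_region e c"
  shows "\<theta> \<in> punctured_sphere" "cap_refl e c \<theta> \<in> punctured_sphere"
  using assms norm_refl[OF assms(1-3), of \<theta>] by (auto simp: cap_region_def punctured_sphere_iff)

lemma cap_region_eventually:
  assumes "norm e = 1" "0 \<le> c" "c < 1" "stereo y \<in> cap_region e c"
  shows "\<forall>\<^sub>F z in nhds y. stereo z \<in> cap_region e c"
proof -
  have st: "((\<lambda>z. stereo z) \<longlongrightarrow> stereo y) (nhds y)"
    by (rule tendsto_stereo) (rule filterlim_ident)
  have "((\<lambda>z. fst (stereo z) \<bullet> e) \<longlongrightarrow> fst (stereo y) \<bullet> e) (nhds y)"
    by (intro tendsto_intros st)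
  then have 1: "\<forall>\<^sub>F z in nhds y. c < fst (stereo z) \<bullet> e"
    by (rule order_tendstoD) (use assms(4) in \<open>simp add: cap_region_def\<close>)
  have "((\<lambda>z. fst (cap_refl e c (stereo z))) \<longlongrightarrow> fst (cap_refl e c (stereo y))) (nhds y)"
    by (intro tendsto_fst tendsto_cap_refl tendsto_const st assms norm_stereo)
  then have 2: "\<forall>\<^sub>F z in nhds y. fst (cap_refl e c (stereo z)) \<noteq> 0"
    by (rule tendsto_imp_eventually_ne) (use assms(4) in \<open>simp add: cap_region_def\<close>)
  from 1 2 show ?thesis by eventually_elim (simp add: cap_region_def norm_stereo)
qed

lemma pole_cases:
  fixes \<theta> N :: "(real ^ 'n) \<times> real"
  assumes "norm \<theta> = 1" "fst \<theta> = 0" "norm N = 1" "fst N = 0"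
  shows "\<theta> = N \<or> snd \<theta> * snd N < 0"
proof -
  obtain t u where tu: "\<theta> = (0, t)" "N = (0, u)" using assms by (metis prod.collapse)
  then have "\<bar>t\<bar> = 1" "\<bar>u\<bar> = 1" using assms by (simp_all add: norm_Pair)
  then show ?thesis using tu by (auto simp: abs_if split: if_splits)
qed

lemma pole_image:
  fixes N :: "(real ^ 'n) \<times> real"
  assumes "norm e = 1" "0 < c" "c < 1" "norm N = 1" "fst N = 0"
  shows "norm (cap_refl e c N) = 1" "c < fst (cap_refl e c N) \<bullet> e"
    "cap_refl e c (cap_refl e c N) = N" "cap_refl e c N \<in> punctured_sphere"
proof -
  note direction = assms(1) less_imp_le[OF assms(2)] assms(3)
  show 1: "norm (cap_refl e c N) = 1" by (rule norm_refl[OF direction assms(4)])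
  have "c * stretch e c N > 0" using stretch_pos[OF direction assms(4)] assms(2) by simp
  then show 2: "c < fst (cap_refl e c N) \<bullet> e"
    using c_minus_refl[OF direction assms(4)] assms(5) by simp
  show "cap_refl e c (cap_refl e c N) = N" by (rule refl_refl[OF direction assms(4)])
  show "cap_refl e c N \<in> punctured_sphere" using 1 2 assms(2) by (auto simp: punctured_sphere_iff)
qed

lemma norm_poles: "norm north = 1" "norm south = 1"
  by (simp_all add: north_def south_def norm_Pair)

lemma fst_poles: "fst north = 0" "fst south = 0"
  by (simp_all add: north_def south_def)

lemma pole_north_or_south:
  fixes N :: "(real ^ 'n) \<times> real"
  assumes "norm N = 1" "fst N = 0"
  shows "N = north \<or> N = south"
  using assms punctured_sphere_iff[of N] by (auto simp: punctured_sphere_def)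

section \<open>Barriers\<close>

lemma has_laplacian_unit_sphere_sq:
  "has_laplacian (\<lambda>z. (z \<bullet> z - 1)\<^sup>2) (\<lambda>z. (2 * (z \<bullet> z - 1)) *\<^sub>R (2 *\<^sub>R z)) (y :: real ^ 'n)
     (8 * (y \<bullet> y) + 4 * real CARD('n) * (y \<bullet> y - 1))"
proof -
  have "has_laplacian (\<lambda>z. ((z - 0) \<bullet> (z - 0) - 1)\<^sup>2)
      (\<lambda>z. (2 * ((z - 0) \<bullet> (z - 0) - 1)) *\<^sub>R (2 *\<^sub>R (z - 0))) y
      (2 * ((y - 0) \<bullet> (y - 0) - 1) * (2 * real CARD('n)) + 2 * ((2 *\<^sub>R (y - 0)) \<bullet> (2 *\<^sub>R (y - 0))))"
    by (rule has_laplacian_compose[OF has_laplacian_sq_dist open_UNIV, where h = "\<lambda>s. (s - 1)\<^sup>2"])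
      (auto intro!: derivative_eq_intros)
  then show ?thesis by (auto elim!: has_laplacian_eq simp: algebra_simps)
qed

text \<open>
  On the sphere \<open>q = R\<close> the Laplacian is \<open>- 8 K R\<close> while the function equals 1. If \<open>R > 0\<close>, large \<open>K\<close> therefore
  makes this positive function a strict supersolution near that sphere for any prescribed
  zeroth-order coefficient.
\<close>
lemma has_laplacian_gaussian:
  fixes y x :: "real ^ 'n" and K R :: real
  defines "q \<equiv> \<lambda>z. (z - x) \<bullet> (z - x)" and "n \<equiv> real CARD('n)"
  shows "\<exists>G. has_laplacian (\<lambda>z. exp (- K * (q z - R)\<^sup>2)) G y
    (exp (- K * (q y - R)\<^sup>2) * ((4 * K\<^sup>2 * (q y - R)\<^sup>2 - 2 * K) * (4 * q y) - 4 * n * K * (q y - R)))"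
proof -
  let ?h = "\<lambda>s. exp (- K * (s - R)\<^sup>2)"
  have "has_laplacian (\<lambda>z. ?h (q z)) (\<lambda>z. (- 2 * K * (q z - R) * ?h (q z)) *\<^sub>R (2 *\<^sub>R (z - x))) y
    (- 2 * K * (q y - R) * ?h (q y) * (2 * n) +
     ((4 * K\<^sup>2 * (q y - R)\<^sup>2 - 2 * K) * ?h (q y)) * ((2 *\<^sub>R (y - x)) \<bullet> (2 *\<^sub>R (y - x))))"
  proof (rule has_laplacian_compose[OF _ open_UNIV, where h = ?h and q = q])
    show "has_laplacian q (\<lambda>z. 2 *\<^sub>R (z - x)) y (2 * n)"
      unfolding q_def n_def by (rule has_laplacian_sq_dist)
    show d: "(?h has_real_derivative - 2 * K * (s - R) * ?h s) (at s)" for s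
      by (auto intro!: derivative_eq_intros)
    have "((\<lambda>s. - 2 * K * (s - R)) has_real_derivative - 2 * K) (at (q y))"
      by (auto intro!: derivative_eq_intros)
    from DERIV_mult[OF this d]
    show "((\<lambda>s. - 2 * K * (s - R) * ?h s) has_real_derivative
        (4 * K\<^sup>2 * (q y - R)\<^sup>2 - 2 * K) * ?h (q y)) (at (q y))"
      by (rule DERIV_cong) (simp add: power2_eq_square algebra_simps)
  qed simp
  moreover have "(2 *\<^sub>R (y - x)) \<bullet> (2 *\<^sub>R (y - x)) = 4 * q y" by (simp add: q_def)
  ultimately show ?thesis
    by (intro exI) (erule has_laplacian_eq, simp add: algebra_simps)
qed

text \<open>
  Compare \<open>W\<close> on a small ball with a small multiple of \<open>b + A (|y|\<^sup>2 - 1)\<^sup>2 - |y - a|\<^sup>2\<close>. Close to the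
  unit sphere this has a large positive Laplacian and is nonpositive on the boundary of the ball; away
  from the unit sphere \<open>W\<close> is bounded below by compactness. As the barrier is positive at
  \<open>a\<close>, so is \<open>W\<close>. In the application the unit sphere is the equator, where strict
  monotonicity of the nonlinearity is not available.
\<close>
lemma positive_across_unit_sphere:
  fixes W :: "real ^ 'n \<Rightarrow> real"
  assumes a: "norm a = 1" and r0: "r0 > 0" and h: "h > 0" and C: "C \<ge> 0"
    and lap: "\<And>y. y \<in> ball a r0 \<Longrightarrow> \<exists>G L. has_laplacian W G y L \<and> (W y \<le> h \<longrightarrow> L \<le> C * W y)"
    and W0: "\<And>y. y \<in> ball a r0 \<Longrightarrow> W y \<ge> 0"
    and W1: "\<And>y. y \<in> ball a r0 \<Longrightarrow> norm y \<noteq> 1 \<Longrightarrow> W y > 0"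
  shows "W a > 0"
proof (rule ccontr)
  assume "\<not> W a > 0"
  then have Wa: "W a = 0" using W0[of a] r0 by simp
  define n where "n = real CARD('n)"
  have n: "n > 0" by (simp add: n_def)
  define A where "A = 2 * n + C + 1"
  have A: "A > 0" using C n by (simp add: A_def)
  define r where "r = min (1 / 2) (r0 / 2)"
  have r: "0 < r" "r \<le> 1 / 2" "r < r0" using r0 by (auto simp: r_def min_def)
  define b where "b = r\<^sup>2 / 2"
  \<comment> \<open>The width of the strip around the unit sphere: small against \<open>r\<close> and against the Laplacian of \<open>|y|\<^sup>2\<close>.\<close>
  define d where "d = min (r / sqrt (2 * A)) (1 / (4 * n))"
  have d: "d > 0" "4 * n * d \<le> 1" using r A n by (auto simp: d_def min_def field_simps)
  have Ad: "A * d\<^sup>2 \<le> b"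
  proof -
    have "d\<^sup>2 \<le> (r / sqrt (2 * A))\<^sup>2" using d by (intro power_mono) (auto simp: d_def)
    also have "\<dots> = r\<^sup>2 / (2 * A)" using A by (simp add: power_divide)
    finally show ?thesis using A by (simp add: b_def field_simps)
  qed
  let ?q = "\<lambda>z :: real ^ 'n. z \<bullet> z - 1"
  define \<zeta> where "\<zeta> = (\<lambda>z. b + A * (?q z)\<^sup>2 - (z - a) \<bullet> (z - a))"
  have sub: "cball a r \<subseteq> ball a r0" using r by auto
  have contW: "continuous_on (cball a r) W"
    using lap sub has_laplacian_isCont by (intro continuous_at_imp_continuous_on) blast
  have cont\<zeta>: "continuous_on (cball a r) \<zeta>"
    unfolding \<zeta>_def by (intro continuous_intros)
  have "compact (\<zeta> ` cball a r)" by (rule compact_continuous_image[OF cont\<zeta>]) simp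
  then obtain M0 where M0: "\<And>y. y \<in> cball a r \<Longrightarrow> \<zeta> y \<le> M0"
    by (metis bounded_imp_bdd_above compact_imp_bounded bdd_above.E imageI)
  define M where "M = max 1 M0"
  have M: "M > 0" "\<And>y. y \<in> cball a r \<Longrightarrow> \<zeta> y \<le> M" using M0 by (auto simp: M_def le_max_iff_disj)
  define K where "K = cball a r \<inter> {y. d \<le> \<bar>?q y\<bar>}"
  have K: "compact K" unfolding K_def
    by (intro compact_Int_closed closed_Collect_le continuous_intros) simp
  have "\<exists>m>0. \<forall>y\<in>K. m \<le> W y"
  proof (cases "K = {}")
    case False
    have "continuous_on K W" using contW by (rule continuous_on_subset) (auto simp: K_def)
    from continuous_attains_inf[OF K False this] obtain y0 where
      y0: "y0 \<in> K" "\<forall>y\<in>K. W y0 \<le> W y" by blast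
    have "norm y0 \<noteq> 1" using y0(1) d by (auto simp: K_def norm_eq_1)
    then have "W y0 > 0" using W1 y0(1) sub by (auto simp: K_def)
    then show ?thesis using y0(2) by blast
  qed (auto intro: exI[of _ 1])
  then obtain m where m: "m > 0" "\<And>y. y \<in> K \<Longrightarrow> m \<le> W y" by blast
  define \<epsilon> where "\<epsilon> = min h (m / M)"
  have \<epsilon>: "\<epsilon> > 0" "\<epsilon> \<le> h" "\<epsilon> * M \<le> m" using h m M by (auto simp: \<epsilon>_def min_def field_simps)
  have "continuous_on (cball a r) (\<lambda>y. W y - \<epsilon> * \<zeta> y)"
    by (intro continuous_intros contW cont\<zeta>)
  from continuous_attains_inf[OF _ _ this] obtain y where
    y: "y \<in> cball a r" "\<And>z. z \<in> cball a r \<Longrightarrow> W y - \<epsilon> * \<zeta> y \<le> W z - \<epsilon> * \<zeta> z"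
    using r by auto
  have "a \<bullet> a = 1" using a by (simp add: norm_eq_1)
  then have "\<zeta> a = b" by (simp add: \<zeta>_def)
  moreover have "b > 0" using r by (simp add: b_def)
  ultimately have "W a - \<epsilon> * \<zeta> a < 0" using Wa \<epsilon>(1) by simp
  then have neg: "W y < \<epsilon> * \<zeta> y" using y(2)[of a] r by simp
  have yr0: "y \<in> ball a r0" using y(1) sub by blast
  have q: "\<bar>?q y\<bar> < d"
  proof (rule ccontr)
    assume "\<not> ?thesis"
    then have "y \<in> K" using y(1) by (simp add: K_def)
    then have "m \<le> W y" by (rule m(2))
    moreover have "\<epsilon> * \<zeta> y \<le> \<epsilon> * M" using M(2)[OF y(1)] \<epsilon>(1) by simp
    ultimately show False using neg \<epsilon>(3) by linarith
  qed
  then have "A * (?q y)\<^sup>2 \<le> A * d\<^sup>2" using A by (intro mult_left_mono) (auto simp: abs_le_square_iff[symmetric])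
  then have \<zeta>y: "\<zeta> y \<le> 2 * b - (y - a) \<bullet> (y - a)" using Ad by (simp add: \<zeta>_def)
  have dist: "(y - a) \<bullet> (y - a) = (dist a y)\<^sup>2"
    unfolding dist_commute[of a y] by (simp add: dist_norm power2_norm_eq_inner)
  have "\<zeta> y > 0" using neg W0[OF yr0] \<epsilon>(1) by (smt (verit) mult_nonneg_nonpos)
  then have "(dist a y)\<^sup>2 < r\<^sup>2" using \<zeta>y by (simp add: dist b_def)
  then have yin: "y \<in> ball a r" using r(1) by (simp add: power_less_imp_less_base)
  have \<zeta>1: "\<zeta> y \<le> 1"
  proof -
    have "r\<^sup>2 \<le> 1" using r by (simp add: power_le_one)
    moreover have "0 \<le> (y - a) \<bullet> (y - a)" by simp
    ultimately show ?thesis using \<zeta>y unfolding b_def by linarith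
  qed
  obtain G L where GL: "has_laplacian W G y L" "W y \<le> h \<longrightarrow> L \<le> C * W y" using lap[OF yr0] by blast
  have lap\<zeta>: "has_laplacian \<zeta> (\<lambda>z. 0 + A *\<^sub>R ((2 * (z \<bullet> z - 1)) *\<^sub>R (2 *\<^sub>R z)) - 2 *\<^sub>R (z - a)) y
     (0 + A * (8 * (y \<bullet> y) + 4 * n * (y \<bullet> y - 1)) - 2 * n)"
    unfolding \<zeta>_def n_def
    by (intro has_laplacian_diff has_laplacian_add has_laplacian_const has_laplacian_cmult
        has_laplacian_unit_sphere_sq has_laplacian_sq_dist)
  have "\<forall>\<^sub>F z in nhds y. z \<in> ball a r" by (rule eventually_nhds_in_open[OF open_ball yin])
  then have "\<forall>\<^sub>F z in nhds y. W y - \<epsilon> * \<zeta> y \<le> W z - \<epsilon> * \<zeta> z"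
    by (rule eventually_mono) (use y(2) in auto)
  from laplacian_nonneg_at_min[OF has_laplacian_diff[OF GL(1) has_laplacian_cmult[OF lap\<zeta>]] this]
  have min: "\<epsilon> * (A * (8 * (y \<bullet> y) + 4 * n * (y \<bullet> y - 1)) - 2 * n) \<le> L" by simp
  have "W y \<le> \<epsilon>" using neg mult_left_mono[OF \<zeta>1, of \<epsilon>] \<epsilon>(1) by linarith
  then have "L \<le> C * W y" "C * W y \<le> C * \<epsilon>" using GL(2) \<epsilon>(2) C by (auto intro: mult_left_mono)
  with min have "\<epsilon> * (A * (8 * (y \<bullet> y) + 4 * n * (y \<bullet> y - 1)) - 2 * n) \<le> \<epsilon> * C"
    by (simp add: mult.commute)
  then have le: "A * (8 * (y \<bullet> y) + 4 * n * (y \<bullet> y - 1)) - 2 * n \<le> C" using \<epsilon>(1) by simp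
  have yy: "y \<bullet> y \<ge> 1 / 4"
  proof -
    have "1 = norm (y + (a - y))" using a by simp
    also have "\<dots> \<le> norm y + dist a y" by (simp only: dist_norm) (rule norm_triangle_ineq)
    finally have "norm y \<ge> 1 / 2" using y(1) r(2) by simp
    then have "(1 / 2)\<^sup>2 \<le> (norm y)\<^sup>2" by (intro power_mono) auto
    then show ?thesis by (simp add: power2_norm_eq_inner power_divide)
  qed
  have "4 * n * (y \<bullet> y - 1) \<ge> 4 * n * (- d)" using q n by (intro mult_left_mono) auto
  moreover have "4 * n * (- d) \<ge> -1" using d(2) by simp
  ultimately have "8 * (y \<bullet> y) + 4 * n * (y \<bullet> y - 1) \<ge> 1" using yy by linarith
  then have "A * (8 * (y \<bullet> y) + 4 * n * (y \<bullet> y - 1)) \<ge> A * 1" using A by (intro mult_left_mono) auto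
  then show False using le by (simp add: A_def)
qed

text \<open>
  The quadratic function \<open>\<xi>\<close> is a strict subsolution between 1/2 and 1 on a small ball. Adding
  \<open>\<delta>\<close> times the fundamental solution, which is harmonic and infinite at the singularity, turns
  \<open>W\<close> into a function that lies above \<open>\<epsilon> \<xi>\<close> near the singularity as well; then \<open>\<delta>\<close> tends
  to 0.
\<close>
lemma positive_near_isolated_singularity:
  fixes W :: "real ^ 'n \<Rightarrow> real"
  assumes n3: "CARD('n) \<ge> 3" and r0: "r0 > 0" and h: "h > 0" and C: "C \<ge> 0"
    and lap: "\<And>y. y \<in> ball a r0 - {a} \<Longrightarrow> \<exists>G L. has_laplacian W G y L \<and> (W y \<le> h \<longrightarrow> L \<le> C * W y)"
    and W1: "\<And>y. y \<in> ball a r0 - {a} \<Longrightarrow> W y > 0"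
  obtains \<epsilon> r where "\<epsilon> > 0" "r > 0" "\<And>y. y \<in> ball a r - {a} \<Longrightarrow> \<epsilon> \<le> W y"
proof -
  define n where "n = real CARD('n)"
  define \<alpha> where "\<alpha> = (n - 2) / 2"
  have n: "n \<ge> 3" using n3 by (simp add: n_def)
  have \<alpha>: "\<alpha> > 0" using n by (simp add: \<alpha>_def)
  define r where "r = min (r0 / 2) (1 / (C + 1))"
  have r: "0 < r" "r < r0" using r0 C by (auto simp: r_def min_def field_simps)
  have rC: "C * r\<^sup>2 < n"
  proof -
    have "r \<le> 1 / (C + 1)" by (simp add: r_def)
    then have "(C + 1) * r \<le> 1" using C by (simp add: field_simps)
    then have Cr: "C * r \<le> 1" "r \<le> 1" using r C by (simp_all add: algebra_simps) (smt (verit) mult_nonneg_nonneg)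
    have "C * r\<^sup>2 = (C * r) * r" by (simp add: power2_eq_square)
    also have "\<dots> \<le> 1 * 1" using Cr r C by (intro mult_mono) auto
    finally show ?thesis using n by simp
  qed
  have Wc: "isCont W y" if "y \<in> ball a r0 - {a}" for y
    using lap[OF that] has_laplacian_isCont by blast
  define S where "S = sphere a r"
  have "compact S" by (simp add: S_def)
  moreover have "S \<noteq> {}" using r by (simp add: S_def sphere_eq_empty)
  moreover have Ssub: "S \<subseteq> ball a r0 - {a}" using r by (auto simp: S_def)
  then have "continuous_on S W" using Wc by (intro continuous_at_imp_continuous_on) blast
  ultimately obtain y0 where y0: "y0 \<in> S" "\<forall>y\<in>S. W y0 \<le> W y"
    using continuous_attains_inf by blast
  define m where "m = W y0"
  have m: "m > 0" "\<And>y. y \<in> S \<Longrightarrow> m \<le> W y" using y0 W1[of y0] Ssub unfolding m_def by blast+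
  define \<epsilon> where "\<epsilon> = min h m"
  have \<epsilon>: "\<epsilon> > 0" "\<epsilon> \<le> h" "\<epsilon> \<le> m" using h m by (auto simp: \<epsilon>_def)
  let ?s = "\<lambda>z. (z - a) \<bullet> (z - a)"
  define \<xi> where "\<xi> = (\<lambda>z. 1 / 2 + 1 / (2 * r\<^sup>2) * ?s z)"
  have s: "?s z = (dist a z)\<^sup>2" for z
    unfolding dist_commute[of a z] by (simp add: dist_norm power2_norm_eq_inner)
  have \<xi>1: "\<xi> z \<le> 1" if "z \<in> cball a r" for z
  proof -
    have "(dist a z)\<^sup>2 \<le> r\<^sup>2" using that by (intro power_mono) auto
    then show ?thesis using r by (simp add: \<xi>_def s field_simps)
  qed
  have key: "0 \<le> W y - \<epsilon> * \<xi> y + \<delta> * ?s y powr (- \<alpha>)" if y: "y \<in> cball a r - {a}" and \<delta>: "\<delta> > 0" for y \<delta>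
  proof (rule ccontr)
    define F where "F = (\<lambda>z. W z - \<epsilon> * \<xi> z + \<delta> * ?s z powr (- \<alpha>))"
    assume "\<not> 0 \<le> W y - \<epsilon> * \<xi> y + \<delta> * ?s y powr (- \<alpha>)"
    then have Fy: "F y < 0" by (simp add: F_def)
    \<comment> \<open>On the sphere of squared radius \<open>t\<close> the singular term is at least \<open>\<epsilon>\<close>, so no negative minimum lies there.\<close>
    define t where "t = min ((\<epsilon> / \<delta>) powr (- (1 / \<alpha>))) (?s y)"
    have t: "t > 0" "t \<le> ?s y" using y \<epsilon> \<delta> by (auto simp: t_def)
    have "t powr (- \<alpha>) \<ge> ((\<epsilon> / \<delta>) powr (- (1 / \<alpha>))) powr (- \<alpha>)"
      using t \<alpha> by (intro powr_mono2') (auto simp: t_def)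
    then have "t powr (- \<alpha>) \<ge> \<epsilon> / \<delta>" using \<alpha> \<epsilon> \<delta> by (simp add: powr_powr)
    then have t\<epsilon>: "\<delta> * t powr (- \<alpha>) \<ge> \<epsilon>" using \<delta> by (simp add: field_simps)
    define K where "K = cball a r \<inter> {z. t \<le> ?s z}"
    have "compact K" unfolding K_def
      by (intro compact_Int_closed closed_Collect_le continuous_intros) simp
    moreover have "y \<in> K" using y t by (simp add: K_def)
    moreover have Ksub: "K \<subseteq> ball a r0 - {a}" using r t by (auto simp: K_def)
    have "continuous_on K W"
      using Wc Ksub by (intro continuous_at_imp_continuous_on) blast
    then have "continuous_on K F" unfolding F_def \<xi>_def
      by (intro continuous_intros) (use t in \<open>auto simp: K_def\<close>)
    ultimately obtain z where z: "z \<in> K" "\<forall>u\<in>K. F z \<le> F u"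
      using continuous_attains_inf[of K F] by blast
    have Fz: "F z < 0" using z(2) \<open>y \<in> K\<close> Fy by force
    have zr0: "z \<in> ball a r0 - {a}" using z(1) Ksub by blast
    have zc: "z \<in> cball a r" using z(1) by (simp add: K_def)
    have \<epsilon>\<xi>: "\<epsilon> * \<xi> z \<le> \<epsilon>" using \<xi>1[OF zc] \<epsilon>(1) by simp
    have P: "\<delta> * ?s z powr (- \<alpha>) \<ge> 0" using \<delta> by simp
    have "?s z \<noteq> t"
    proof
      assume "?s z = t"
      then have "F z \<ge> W z" using \<epsilon>\<xi> t\<epsilon> by (simp add: F_def)
      then show False using Fz W1[OF zr0] by simp
    qed
    then have st: "t < ?s z" using z(1) by (simp add: K_def)
    have "dist a z \<noteq> r"
    proof
      assume "dist a z = r"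
      then have "m \<le> W z" by (intro m(2)) (simp add: S_def)
      then show False using Fz \<epsilon>\<xi> \<epsilon>(3) P by (simp add: F_def)
    qed
    then have zb: "z \<in> ball a r" using zc by simp
    have "\<forall>\<^sub>F u in nhds z. u \<in> ball a r \<inter> {u. t < ?s u}"
      by (rule eventually_nhds_in_open)
        (use zb st in \<open>auto intro!: open_Int open_Collect_less continuous_intros\<close>)
    then have ev: "\<forall>\<^sub>F u in nhds z. F z \<le> F u"
      by (rule eventually_mono) (use z(2) in \<open>auto simp: K_def\<close>)
    obtain G L where GL: "has_laplacian W G z L" "W z \<le> h \<longrightarrow> L \<le> C * W z" using lap[OF zr0] by blast
    have za: "z \<noteq> a" using zr0 by simp
    have "\<exists>G. has_laplacian \<xi> G z (n / r\<^sup>2)"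
      unfolding \<xi>_def
      by (rule exI, rule has_laplacian_eq[OF has_laplacian_add[OF has_laplacian_const
            has_laplacian_cmult[OF has_laplacian_sq_dist]]]) (simp add: n_def)
    then obtain G1 where G1: "has_laplacian \<xi> G1 z (n / r\<^sup>2)" by blast
    have "n + 2 * (- \<alpha>) - 2 = 0" by (simp add: \<alpha>_def field_simps)
    with has_laplacian_sq_dist_powr[OF za, of "- \<alpha>"]
    have "\<exists>G. has_laplacian (\<lambda>z. ?s z powr (- \<alpha>)) G z 0"
      unfolding n_def[symmetric] by (intro exI) (simp only: mult_zero_right mult_zero_left)
    then obtain G2 where G2: "has_laplacian (\<lambda>z. ?s z powr (- \<alpha>)) G2 z 0" by blast
    from laplacian_nonneg_at_min[OF has_laplacian_add[OF has_laplacian_diff[OF GL(1)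
          has_laplacian_cmult[OF G1, of \<epsilon>]] has_laplacian_cmult[OF G2, of \<delta>]]] ev
    have L: "\<epsilon> * (n / r\<^sup>2) \<le> L" by (simp add: F_def)
    have "W z \<le> \<epsilon>" using Fz \<epsilon>\<xi> P unfolding F_def by linarith
    then have "L \<le> C * W z" "C * W z \<le> C * \<epsilon>" using GL(2) \<epsilon>(2) C by (auto intro: mult_left_mono)
    with L have "\<epsilon> * (n / r\<^sup>2) \<le> \<epsilon> * C" by (simp add: mult.commute)
    then have "n / r\<^sup>2 \<le> C" using \<epsilon>(1) by (simp only: mult_le_cancel_left_pos)
    then show False using rC r by (simp add: field_simps)
  qed
  show thesis
  proof (rule that[of "\<epsilon> / 2" r])
    fix y assume y: "y \<in> ball a r - {a}"
    then have y': "y \<in> cball a r - {a}" by auto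
    have "\<epsilon> * \<xi> y - W y \<le> 0"
    proof (rule field_le_epsilon)
      fix x :: real assume "0 < x"
      have p: "?s y powr (- \<alpha>) > 0" using y by simp
      from key[OF y', of "x / ?s y powr (- \<alpha>)"] \<open>0 < x\<close> p
      show "\<epsilon> * \<xi> y - W y \<le> 0 + x" by simp
    qed
    moreover have "\<epsilon> * (1 / 2) \<le> \<epsilon> * \<xi> y" using \<epsilon>(1) by (intro mult_left_mono) (auto simp: \<xi>_def)
    ultimately show "\<epsilon> / 2 \<le> W y" by simp
  qed (use \<epsilon> r in auto)
qed

section \<open>The equation and its reflected copies\<close>

text \<open>
  The nonlinearity enters only through \<open>k = v\<^sup>-\<^sup>p g(\<cdot>, v)\<close> along the solution. The last two
  assumptions are what conditions (1) to (4) give for a point and an image of it that lies closer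
  to the pole of the same hemisphere; \<open>m\<close> is the ratio of the heights.
\<close>
locale sphere_equation =
  fixes v k :: "(real ^ 'n) \<times> real \<Rightarrow> real" and a p :: real
  assumes dim: "CARD('n) \<ge> 3"
    and a_def: "a = (real CARD('n) - 2) / 2"
    and p_def: "p = (real CARD('n) + 2) / (real CARD('n) - 2)"
    and v_cont: "continuous_on punctured_sphere v"
    and k_cont: "continuous_on punctured_sphere k"
    and v_pos: "\<And>\<theta>. \<theta> \<in> punctured_sphere \<Longrightarrow> v \<theta> > 0"
    and eqn: "\<And>y. y \<noteq> 0 \<Longrightarrow> \<exists>G. has_laplacian (\<lambda>z. stereo_factor z powr a * v (stereo z)) G y
      (- ((stereo_factor y powr a * v (stereo y)) powr p * k (stereo y)))"
    and k_mono: "\<And>\<theta> \<theta>' m. \<theta> \<in> punctured_sphere \<Longrightarrow> \<theta>' \<in> punctured_sphere \<Longrightarrow>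
      v \<theta>' \<le> v \<theta> \<Longrightarrow> m \<ge> 1 \<Longrightarrow> snd \<theta>' = m * snd \<theta> \<Longrightarrow> k \<theta> \<le> k \<theta>'"
    and k_strict: "\<And>\<theta> \<theta>' m. \<theta> \<in> punctured_sphere \<Longrightarrow> \<theta>' \<in> punctured_sphere \<Longrightarrow>
      v \<theta>' < v \<theta> \<Longrightarrow> m > 1 \<Longrightarrow> snd \<theta>' = m * snd \<theta> \<Longrightarrow> snd \<theta> \<noteq> 0 \<Longrightarrow> k \<theta> < k \<theta>'"
begin

lemma a_pos: "a > 0" using dim by (simp add: a_def)

lemma p_ge_1: "p \<ge> 1" using dim by (simp add: p_def field_simps)

lemma a_times_p: "a * p = a + 2"
  using dim by (simp add: a_def p_def field_simps)

text \<open>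
  The pull-back of \<open>v\<close> by the reflection as a density of conformal weight \<open>a\<close>, so that it solves the
  reflected equation.
\<close>
definition kelvin_copy :: "real ^ 'n \<Rightarrow> real \<Rightarrow> (real ^ 'n) \<times> real \<Rightarrow> real" where
  "kelvin_copy e c \<theta> = stretch e c \<theta> powr a * v (cap_refl e c \<theta>)"

lemma tendsto_v:
  assumes "(g \<longlongrightarrow> \<theta>) F" "\<theta> \<in> punctured_sphere" "\<forall>\<^sub>F x in F. norm (g x) = 1"
  shows "((\<lambda>x. v (g x)) \<longlongrightarrow> v \<theta>) F" "((\<lambda>x. k (g x)) \<longlongrightarrow> k \<theta>) F"
proof -
  have "((\<lambda>x. fst (g x)) \<longlongrightarrow> fst \<theta>) F" using assms(1) by (rule tendsto_fst)
  then have "\<forall>\<^sub>F x in F. fst (g x) \<noteq> 0"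
    using assms(2) by (intro tendsto_imp_eventually_ne) (auto simp: punctured_sphere_iff)
  with assms(3) have ev: "\<forall>\<^sub>F x in F. g x \<in> punctured_sphere"
    by eventually_elim (simp add: punctured_sphere_iff)
  show "((\<lambda>x. v (g x)) \<longlongrightarrow> v \<theta>) F" "((\<lambda>x. k (g x)) \<longlongrightarrow> k \<theta>) F"
    using continuous_on_tendsto_compose[OF v_cont assms(1,2) ev]
      continuous_on_tendsto_compose[OF k_cont assms(1,2) ev] by auto
qed

lemma tendsto_kelvin_copy:
  assumes "(c \<longlongrightarrow> c0) F" "(g \<longlongrightarrow> \<theta>) F" "norm e = 1" "0 \<le> c0" "c0 < 1" "norm \<theta> = 1"
    and "\<forall>\<^sub>F x in F. norm (g x) = 1 \<and> 0 \<le> c x" "fst (cap_refl e c0 \<theta>) \<noteq> 0"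
  shows "((\<lambda>x. kelvin_copy e (c x) (g x)) \<longlongrightarrow> kelvin_copy e c0 \<theta>) F"
proof -
  have "\<forall>\<^sub>F x in F. c x < 1" using assms(1,5) by (rule order_tendstoD)
  with assms(7) have "\<forall>\<^sub>F x in F. norm (cap_refl e (c x) (g x)) = 1"
    by eventually_elim (use norm_refl[OF assms(3)] in auto)
  moreover have "cap_refl e c0 \<theta> \<in> punctured_sphere"
    using assms(8) norm_refl[OF assms(3-6)] by (simp add: punctured_sphere_iff)
  ultimately have "((\<lambda>x. v (cap_refl e (c x) (g x))) \<longlongrightarrow> v (cap_refl e c0 \<theta>)) F"
    by (intro tendsto_v(1) tendsto_cap_refl assms(1-6)) auto
  then show ?thesis unfolding kelvin_copy_def
    using stretch_pos[OF assms(3-6)] tendsto_stretch[OF assms(1-6)] by (intro tendsto_intros) auto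
qed

abbreviation "chart u y \<equiv> stereo_factor y powr a * u (stereo y)"

lemma tendsto_chart_v: "y \<noteq> 0 \<Longrightarrow> (chart v \<longlongrightarrow> chart v y) (nhds y)"
proof -
  assume y: "y \<noteq> 0"
  have "((\<lambda>z. v (stereo z)) \<longlongrightarrow> v (stereo y)) (nhds y)"
    using y by (intro tendsto_v(1) tendsto_stereo filterlim_ident)
      (auto simp: stereo_in_punctured norm_stereo)
  then show ?thesis
    using stereo_factor_pos[of y] by (intro tendsto_intros tendsto_stereo_factor filterlim_ident) auto
qed

definition dominated :: "real ^ 'n \<Rightarrow> real \<Rightarrow> bool" where
  "dominated e c \<longleftrightarrow> (\<forall>\<theta>\<in>cap_region e c. v \<theta> \<le> kelvin_copy e c \<theta>)"

text \<open>
  At the point \<open>P\<close> that the reflection exchanges with the pole \<open>N\<close> the function \<open>v\<close> is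
  continuous, while its copy is controlled by \<open>v\<close> near \<open>N\<close>. The condition says that the copy
  stays above \<open>v P\<close> by a positive amount near \<open>P\<close>, rewritten as a condition near the fixed point
  \<open>N\<close>. The bound refers to \<open>v\<close> near the pole alone and the left-hand side is continuous in \<open>c\<close>, which
  makes the condition open in \<open>c\<close>.
\<close>
definition pole_margin :: "real ^ 'n \<Rightarrow> real \<Rightarrow> bool" where
  "pole_margin e c \<longleftrightarrow> (\<forall>N. norm N = 1 \<longrightarrow> fst N = 0 \<longrightarrow>
     (\<exists>b. v (cap_refl e c N) * stretch e c N powr a < b \<and>
          (\<forall>\<^sub>F \<eta> in at N within punctured_sphere. b \<le> v \<eta>)))"

context
  fixes e :: "real ^ 'n" and c :: real
  assumes e: "norm e = 1" and c: "0 < c" "c < 1"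
begin

lemmas direction = e less_imp_le[OF c(1)] c(2)

lemma kelvin_copy_chart:
  assumes y: "y \<noteq> (1 / c) *\<^sub>R e"
  defines "J \<equiv> inversion ((1 / c) *\<^sub>R e) (1 / c\<^sup>2 - 1)"
  defines "r \<equiv> (y - (1 / c) *\<^sub>R e) \<bullet> (y - (1 / c) *\<^sub>R e)"
  shows "stereo_factor y powr a * kelvin_copy e c (stereo y) =
    ((1 / c\<^sup>2 - 1) / r) powr a * (stereo_factor (J y) powr a * v (stereo (J y)))"
proof -
  have r: "r > 0" using y by (simp add: r_def)
  have l: "1 / c\<^sup>2 - 1 > 0" using one_minus_csq[OF direction] c by (simp add: field_simps)
  have "stereo_factor y powr a * kelvin_copy e c (stereo y) =
      (stretch e c (stereo y) * stereo_factor y) powr a * v (stereo (J y))"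
    using stretch_pos[OF direction norm_stereo, of y] stereo_factor_pos[of y] stereo_inversion(1)[OF direction c(1) y]
    by (simp add: kelvin_copy_def powr_mult J_def)
  also have "stretch e c (stereo y) * stereo_factor y = (1 / c\<^sup>2 - 1) / r * stereo_factor (J y)"
    using stereo_inversion(2)[OF direction c(1) y] by (simp only: J_def r_def)
  also have "\<dots> powr a = ((1 / c\<^sup>2 - 1) / r) powr a * stereo_factor (J y) powr a"
    by (rule powr_mult)
  finally show ?thesis by (simp add: mult.assoc)
qed

text \<open>
  The Kelvin transform of the chart equation. The exponent \<open>p\<close> is the one for which \<open>a p = a + 2\<close>, so the
  power of the conformal factor is absorbed into the power of the copy.
\<close>
lemma kelvin_copy_equation:
  assumes y: "fst (cap_refl e c (stereo y)) \<noteq> 0"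
  shows "\<exists>F. has_laplacian (\<lambda>z. stereo_factor z powr a * kelvin_copy e c (stereo z)) F y
     (- ((stereo_factor y powr a * kelvin_copy e c (stereo y)) powr p * k (cap_refl e c (stereo y))))"
proof -
  define x where "x = (1 / c) *\<^sub>R e"
  define l where "l = 1 / c\<^sup>2 - 1"
  let ?r = "\<lambda>z. (z - x) \<bullet> (z - x)"
  let ?U = "\<lambda>z. stereo_factor z powr a * v (stereo z)"
  have l: "l > 0" using one_minus_csq[OF direction] c by (simp add: l_def field_simps)
  have yx: "y \<noteq> x"
  proof
    assume "y = x"
    have "1 + c\<^sup>2 > 0" by (simp add: add_pos_nonneg)
    have "x \<bullet> x = 1 / c\<^sup>2" using e by (simp add: x_def norm_eq_1 power2_eq_square)
    then have "stereo_factor x = 2 / (1 + 1 / c\<^sup>2)" by (simp add: stereo_factor_def)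
    also have "\<dots> = 2 * c\<^sup>2 / (1 + c\<^sup>2)" using c by (simp add: field_simps)
    finally have f: "stereo_factor x * (1 / c) = 2 * c / (1 + c\<^sup>2)" using c by (simp add: power2_eq_square)
    then have s: "fst (stereo x) = (2 * c / (1 + c\<^sup>2)) *\<^sub>R e" by (simp add: stereo_eq x_def)
    then have "fst (stereo x) \<bullet> e = 2 * c / (1 + c\<^sup>2)" using e by (simp add: norm_eq_1)
    then have "fst (cap_refl e c (stereo x)) = (1 / cap_den e c (stereo x)) *\<^sub>R
       (((1 - c\<^sup>2) * (2 * c / (1 + c\<^sup>2)) + 2 * (c - 2 * c / (1 + c\<^sup>2))) *\<^sub>R e)"
      by (simp add: fst_refl[OF direction] s scaleR_add_left)
    also have "(1 - c\<^sup>2) * (2 * c / (1 + c\<^sup>2)) + 2 * (c - 2 * c / (1 + c\<^sup>2)) = 0"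
      using \<open>1 + c\<^sup>2 > 0\<close> by (simp add: field_simps)
    finally show False using y \<open>y = x\<close> by simp
  qed
  have Jst: "stereo (inversion x l y) = cap_refl e c (stereo y)"
    using stereo_inversion(1)[OF direction c(1)] yx by (simp add: x_def l_def)
  then have "inversion x l y \<noteq> 0" using y fst_stereo_eq_0[of "inversion x l y"] by auto
  from eqn[OF this] obtain G where G: "has_laplacian ?U G (inversion x l y)
      (- (?U (inversion x l y) powr p * k (cap_refl e c (stereo y))))"
    unfolding Jst by blast
  from kelvin_transform[OF G yx l] obtain F where
    F: "has_laplacian (\<lambda>z. (l / ?r z) powr a * ?U (inversion x l z)) F y
     ((l / ?r y) powr (a + 2) * (- (?U (inversion x l y) powr p * k (cap_refl e c (stereo y)))))"
    unfolding a_def[symmetric] by blast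
  have eq: "stereo_factor z powr a * kelvin_copy e c (stereo z) = (l / ?r z) powr a * ?U (inversion x l z)"
    if "z \<noteq> x" for z
    using kelvin_copy_chart[of z] that by (simp add: x_def l_def)
  have "\<forall>\<^sub>F z in nhds y. z \<noteq> x" using yx by (rule t1_space_nhds)
  then have ev: "\<forall>\<^sub>F z in nhds y. stereo_factor z powr a * kelvin_copy e c (stereo z) =
      (l / ?r z) powr a * ?U (inversion x l z)"
    by eventually_elim (rule eq)
  have "?r y > 0" using yx by simp
  then have lr: "l / ?r y > 0" using l by simp
  have "?U (inversion x l y) \<ge> 0"
    using v_pos[of "stereo (inversion x l y)"] \<open>inversion x l y \<noteq> 0\<close> by (simp add: stereo_in_punctured)
  then have "(stereo_factor y powr a * kelvin_copy e c (stereo y)) powr p =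
      (l / ?r y) powr (a + 2) * ?U (inversion x l y) powr p"
    unfolding eq[OF yx] using lr by (subst powr_mult) (auto simp: powr_powr a_times_p)
  then show ?thesis
    using has_laplacian_transform[OF F ev] by (intro exI[of _ F]) (simp add: mult.assoc)
qed

lemma cap_region_stretch:
  assumes "\<theta> \<in> cap_region e c"
  shows "stretch e c \<theta> > 1" "kelvin_copy e c \<theta> > 0" "v (cap_refl e c \<theta>) < kelvin_copy e c \<theta>"
proof -
  show s: "stretch e c \<theta> > 1" using assms by (intro stretch_gt_1[OF direction _ _ c(1)]) (auto simp: cap_region_def)
  have R: "v (cap_refl e c \<theta>) > 0" using cap_region_punctured[OF direction assms] v_pos by auto
  then show "kelvin_copy e c \<theta> > 0" using s by (simp add: kelvin_copy_def)
  have "stretch e c \<theta> powr a > 1" using s a_pos by (simp add: gr_one_powr)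
  then show "v (cap_refl e c \<theta>) < kelvin_copy e c \<theta>" using R by (simp add: kelvin_copy_def)
qed

abbreviation "gap y \<equiv> stereo_factor y powr a * (kelvin_copy e c (stereo y) - v (stereo y))"

lemma gap_laplacian:
  assumes y: "stereo y \<in> cap_region e c"
  obtains G where "has_laplacian (\<lambda>z. gap z) G y
    (chart v y powr p * k (stereo y) - chart (kelvin_copy e c) y powr p * k (cap_refl e c (stereo y)))"
proof -
  have "y \<noteq> 0" using cap_region_punctured(1)[OF direction y] by (simp add: stereo_in_punctured)
  from eqn[OF this] obtain G where G: "has_laplacian (\<lambda>z. chart v z) G y
      (- (chart v y powr p * k (stereo y)))" by blast
  obtain F where F: "has_laplacian (\<lambda>z. chart (kelvin_copy e c) z) F y
     (- (chart (kelvin_copy e c) y powr p * k (cap_refl e c (stereo y))))"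
    using kelvin_copy_equation y by (auto simp: cap_region_def)
  from has_laplacian_diff[OF F G] show ?thesis
    by (intro that[of "\<lambda>z. F z - G z"]) (simp add: right_diff_distrib)
qed

text \<open>
  The monotonicity of \<open>k\<close> allows both powers to be multiplied by the same coefficient, after which
  the mean value theorem applies.
\<close>
lemma gap_laplacian_le:
  assumes y: "stereo y \<in> cap_region e c" and le: "v (cap_refl e c (stereo y)) \<le> v (stereo y)"
    and M: "chart v y \<le> M" "chart (kelvin_copy e c) y \<le> M"
  shows "chart v y powr p * k (stereo y) - chart (kelvin_copy e c) y powr p * k (cap_refl e c (stereo y))
    \<le> \<bar>k (stereo y)\<bar> * (p * M powr (p - 1)) * \<bar>gap y\<bar>"
proof -
  note PS = cap_region_punctured[OF direction y]
  define u u' where "u = chart v y" and "u' = chart (kelvin_copy e c) y"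
  have u: "u > 0" "u' > 0"
    using v_pos[OF PS(1)] cap_region_stretch(2)[OF y] stereo_factor_pos[of y] by (simp_all add: u_def u'_def)
  have "k (stereo y) \<le> k (cap_refl e c (stereo y))"
    by (rule k_mono[OF PS le _ snd_refl[OF direction]]) (use cap_region_stretch[OF y] in simp)
  then have "u' powr p * k (stereo y) \<le> u' powr p * k (cap_refl e c (stereo y))"
    by (intro mult_left_mono) auto
  then have "u powr p * k (stereo y) - u' powr p * k (cap_refl e c (stereo y)) \<le>
      (u powr p - u' powr p) * k (stereo y)" by (simp add: left_diff_distrib)
  also have "\<dots> \<le> \<bar>u powr p - u' powr p\<bar> * \<bar>k (stereo y)\<bar>" by (simp flip: abs_mult)
  also have "\<dots> \<le> (p * M powr (p - 1) * \<bar>u - u'\<bar>) * \<bar>k (stereo y)\<bar>"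
    using u M p_ge_1 by (intro mult_right_mono powr_diff_bound) (auto simp: u_def u'_def)
  also have "\<bar>u - u'\<bar> = \<bar>gap y\<bar>"
    by (simp add: u_def u'_def right_diff_distrib abs_minus_commute)
  finally show ?thesis by (simp add: u_def u'_def mult_ac)
qed

lemma gap_bound_coefficient:
  assumes y: "stereo y \<in> cap_region e c" and le: "v (cap_refl e c (stereo y)) \<le> v (stereo y)"
  obtains G L where "has_laplacian (\<lambda>z. gap z) G y L"
    "L \<le> \<bar>k (stereo y)\<bar> * (p * (stretch e c (stereo y) powr a * chart v y) powr (p - 1)) * \<bar>gap y\<bar>"
proof -
  let ?M = "stretch e c (stereo y) powr a * chart v y"
  have "stretch e c (stereo y) powr a \<ge> 1"
    using cap_region_stretch(1)[OF y] a_pos by (simp add: ge_one_powr_ge_zero)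
  moreover have "chart v y \<ge> 0" using v_pos[OF cap_region_punctured(1)[OF direction y]] by simp
  ultimately have 1: "chart v y \<le> ?M" by (simp add: mult_le_cancel_right1)
  have 2: "chart (kelvin_copy e c) y \<le> ?M"
    using le by (simp add: kelvin_copy_def mult_left_mono mult.left_commute)
  show ?thesis using gap_laplacian[OF y] gap_laplacian_le[OF y le 1 2] that by blast
qed

lemma no_touching_off_equator:
  assumes y: "stereo y \<in> cap_region e c" and eq: "kelvin_copy e c (stereo y) = v (stereo y)"
    and sn: "snd (stereo y) \<noteq> 0" and mn: "\<forall>\<^sub>F z in nhds y. 0 \<le> gap z"
  shows False
proof -
  note PS = cap_region_punctured[OF direction y]
  obtain G where G: "has_laplacian (\<lambda>z. gap z) G y
    (chart v y powr p * k (stereo y) - chart (kelvin_copy e c) y powr p * k (cap_refl e c (stereo y)))"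
    by (rule gap_laplacian[OF y])
  have "\<forall>\<^sub>F z in nhds y. gap y \<le> gap z" using mn by (simp add: eq)
  from laplacian_nonneg_at_min[OF G this]
  have "chart v y powr p * k (cap_refl e c (stereo y)) \<le> chart v y powr p * k (stereo y)"
    by (simp add: eq)
  moreover have "chart v y powr p > 0"
    using v_pos[OF PS(1)] stereo_factor_pos[of y] by simp
  ultimately have "k (cap_refl e c (stereo y)) \<le> k (stereo y)" by simp
  moreover have "k (stereo y) < k (cap_refl e c (stereo y))"
    by (rule k_strict[OF PS _ _ snd_refl[OF direction] sn]) (use cap_region_stretch[OF y] eq in simp_all)
  ultimately show False by simp
qed

section \<open>Strict comparison and the behaviour at the poles\<close>

lemma coefficient_bounded:
  assumes y: "y \<noteq> 0"
  obtains C where "C \<ge> 0" "\<forall>\<^sub>F z in nhds y.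
    \<bar>k (stereo z)\<bar> * (p * (stretch e c (stereo z) powr a * chart v z) powr (p - 1)) \<le> C"
proof -
  let ?f = "\<lambda>z. \<bar>k (stereo z)\<bar> * (p * (stretch e c (stereo z) powr a * chart v z) powr (p - 1))"
  have st: "((\<lambda>z. stereo z) \<longlongrightarrow> stereo y) (nhds y)"
    by (rule tendsto_stereo) (rule filterlim_ident)
  have k: "((\<lambda>z. k (stereo z)) \<longlongrightarrow> k (stereo y)) (nhds y)"
    using y by (intro tendsto_v(2) st) (auto simp: stereo_in_punctured norm_stereo)
  have s: "((\<lambda>z. stretch e c (stereo z)) \<longlongrightarrow> stretch e c (stereo y)) (nhds y)"
    by (intro tendsto_stretch tendsto_const st direction norm_stereo)
  have "stretch e c (stereo y) > 0" by (rule stretch_pos[OF direction norm_stereo])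
  moreover have "chart v y > 0"
    using v_pos[of "stereo y"] stereo_factor_pos[of y] y by (simp add: stereo_in_punctured)
  ultimately have "(?f \<longlongrightarrow> ?f y) (nhds y)"
    by (intro tendsto_intros k s tendsto_chart_v y) auto
  then have "\<forall>\<^sub>F z in nhds y. ?f z < ?f y + 1" by (rule order_tendstoD) simp
  then have "\<forall>\<^sub>F z in nhds y. ?f z \<le> ?f y + 1" by (rule eventually_mono) simp
  moreover have "?f y + 1 \<ge> 0" using p_ge_1 by (intro add_nonneg_nonneg mult_nonneg_nonneg) auto
  ultimately show ?thesis by (rule that[rotated])
qed

text \<open>
  Near a zero of the gap the reflected value of \<open>v\<close> is strictly smaller, so the linear
  differential inequality holds there. Off the equator a zero contradicts the strict monotonicity at
  once; on the equator the barrier for the unit sphere applies.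
\<close>
lemma dominated_imp_less:
  assumes dominated: "dominated e c" and \<theta>: "\<theta> \<in> cap_region e c"
  shows "v \<theta> < kelvin_copy e c \<theta>"
proof (rule ccontr)
  assume "\<not> ?thesis"
  then have eq0: "kelvin_copy e c \<theta> = v \<theta>" using dominated \<theta> by (force simp: dominated_def)
  define y where "y = stereo_coord \<theta>"
  have y: "stereo y = \<theta>" "y \<noteq> 0"
    using cap_region_punctured(1)[OF direction \<theta>] punctured_stereo_coord[of \<theta>]
    by (auto simp: y_def punctured_sphere_iff)
  have yR: "stereo y \<in> cap_region e c" and eq: "kelvin_copy e c (stereo y) = v (stereo y)"
    using y \<theta> eq0 by simp_all
  have reg: "\<forall>\<^sub>F z in nhds y. stereo z \<in> cap_region e c" by (rule cap_region_eventually[OF direction yR])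
  have gap0: "0 \<le> gap z" if "stereo z \<in> cap_region e c" for z
    using dominated that by (simp add: dominated_def)
  have touch: False if z: "stereo z \<in> cap_region e c" "gap z \<le> 0" "norm z \<noteq> 1" for z
  proof (rule no_touching_off_equator[OF z(1)])
    show "kelvin_copy e c (stereo z) = v (stereo z)"
      using gap0[OF z(1)] z(2) stereo_factor_pos[of z] by (simp add: mult_le_0_iff zero_le_mult_iff)
    show "snd (stereo z) \<noteq> 0" using z(3) by (simp add: snd_stereo_eq_0)
    show "\<forall>\<^sub>F u in nhds z. 0 \<le> gap u"
      using cap_region_eventually[OF direction z(1)] by (rule eventually_mono) (rule gap0)
  qed
  have norm1: "norm y = 1" using touch[OF yR] eq by auto
  obtain C where C: "C \<ge> 0" "\<forall>\<^sub>F z in nhds y.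
    \<bar>k (stereo z)\<bar> * (p * (stretch e c (stereo z) powr a * chart v z) powr (p - 1)) \<le> C"
    using coefficient_bounded[OF y(2)] by blast
  have st: "((\<lambda>z. stereo z) \<longlongrightarrow> stereo y) (nhds y)"
    by (rule tendsto_stereo) (rule filterlim_ident)
  have "((\<lambda>z. v (stereo z) - v (cap_refl e c (stereo z))) \<longlongrightarrow> v (stereo y) - v (cap_refl e c (stereo y))) (nhds y)"
    using cap_region_punctured[OF direction yR]
    by (intro tendsto_diff tendsto_v(1) tendsto_cap_refl tendsto_const st direction norm_stereo)
      (auto simp: norm_stereo norm_refl[OF direction])
  then have "\<forall>\<^sub>F z in nhds y. 0 < v (stereo z) - v (cap_refl e c (stereo z))"
    by (rule order_tendstoD) (use cap_region_stretch(3)[OF yR] eq in simp)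
  with reg C(2) have "\<forall>\<^sub>F z in nhds y. stereo z \<in> cap_region e c \<and> v (cap_refl e c (stereo z)) \<le> v (stereo z) \<and>
    \<bar>k (stereo z)\<bar> * (p * (stretch e c (stereo z) powr a * chart v z) powr (p - 1)) \<le> C"
    by eventually_elim auto
  then obtain r where r: "r > 0" "\<And>z. dist z y < r \<Longrightarrow> stereo z \<in> cap_region e c \<and> v (cap_refl e c (stereo z)) \<le> v (stereo z) \<and>
    \<bar>k (stereo z)\<bar> * (p * (stretch e c (stereo z) powr a * chart v z) powr (p - 1)) \<le> C"
    unfolding eventually_nhds_metric by blast
  have "gap y > 0"
  proof (rule positive_across_unit_sphere[OF norm1 r(1) zero_less_one C(1)])
    fix z assume "z \<in> ball y r"
    then have z: "stereo z \<in> cap_region e c" "v (cap_refl e c (stereo z)) \<le> v (stereo z)"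
      "\<bar>k (stereo z)\<bar> * (p * (stretch e c (stereo z) powr a * chart v z) powr (p - 1)) \<le> C"
      using r(2)[of z] by (auto simp: dist_commute)
    show "0 \<le> gap z" by (rule gap0[OF z(1)])
    show "norm z \<noteq> 1 \<Longrightarrow> 0 < gap z" using touch[OF z(1)] by (meson not_le)
    obtain G L where GL: "has_laplacian (\<lambda>z. gap z) G z L"
      "L \<le> \<bar>k (stereo z)\<bar> * (p * (stretch e c (stereo z) powr a * chart v z) powr (p - 1)) * \<bar>gap z\<bar>"
      by (rule gap_bound_coefficient[OF z(1,2)])
    have "L \<le> C * \<bar>gap z\<bar>"
      using GL(2) mult_right_mono[OF z(3), of "\<bar>gap z\<bar>"] by simp
    then show "\<exists>G L. has_laplacian (\<lambda>z. gap z) G z L \<and> (gap z \<le> 1 \<longrightarrow> L \<le> C * gap z)"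
      using GL(1) gap0[OF z(1)] by auto
  qed
  then show False using eq by simp
qed

text \<open>
  In the chart the gap is positive on a punctured neighbourhood of the singular point.
  Where it is below a threshold, \<open>stretch > 1\<close> forces the reflected value of \<open>v\<close> to be at most \<open>v\<close>, so
  the linear inequality and the barrier for isolated singularities apply.
\<close>
lemma dominated_imp_pole_margin:
  assumes dominated: "dominated e c"
  shows "pole_margin e c"
  unfolding pole_margin_def
proof (intro allI impI)
  fix N :: "(real ^ 'n) \<times> real" assume N: "norm N = 1" "fst N = 0"
  define P where "P = cap_refl e c N"
  note P = pole_image[OF e c N, folded P_def]
  have P0: "fst P \<noteq> 0" using P(4) by (simp add: punctured_sphere_iff)
  define y where "y = stereo_coord P"
  have y: "stereo y = P" "y \<noteq> 0" using punctured_stereo_coord[OF P(1) P0] by (auto simp: y_def)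
  have sP: "stretch e c P > 1" using P(1,2) c(1) by (intro stretch_gt_1[OF direction])
  have vP: "v P > 0" using P(4) by (rule v_pos)
  have st: "((\<lambda>z. stereo z) \<longlongrightarrow> P) (nhds y)"
    unfolding y(1)[symmetric] by (rule tendsto_stereo) (rule filterlim_ident)
  have R: "((\<lambda>z. cap_refl e c (stereo z)) \<longlongrightarrow> N) (nhds y)"
    using tendsto_cap_refl[OF tendsto_const st direction P(1)] by (simp add: P(3))
  have 1: "\<forall>\<^sub>F z in nhds y. c < fst (stereo z) \<bullet> e"
    by (rule order_tendstoD(1)[OF tendsto_inner[OF tendsto_fst[OF st] tendsto_const] P(2)])
  have "snd N * snd N > 0" using N by (metis fst_zero not_real_square_gt_zero prod.collapse snd_zero norm_zero zero_neq_one zero_prod_def)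
  then have 2: "\<forall>\<^sub>F z in nhds y. 0 < snd (cap_refl e c (stereo z)) * snd N"
    by (rule order_tendstoD(1)[OF tendsto_mult[OF tendsto_snd[OF R] tendsto_const]])
  have reg: "stereo z \<in> cap_region e c"
    if "c < fst (stereo z) \<bullet> e" "0 < snd (cap_refl e c (stereo z)) * snd N" "z \<noteq> y" for z
  proof -
    have nR: "norm (cap_refl e c (stereo z)) = 1" by (rule norm_refl[OF direction norm_stereo])
    have "fst (cap_refl e c (stereo z)) \<noteq> 0"
    proof
      assume "fst (cap_refl e c (stereo z)) = 0"
      then have "cap_refl e c (stereo z) = N" using pole_cases[OF nR _ N] that(2) by auto
      then have "stereo z = stereo y" using refl_refl[OF direction norm_stereo, of z] y(1) by (simp add: P_def)
      then have "z = y" by (metis stereo_coord_stereo)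
      then show False using that(3) by simp
    qed
    then show ?thesis using that(1) by (simp add: cap_region_def norm_stereo)
  qed
  \<comment> \<open>The size of the gap at which the reflected value of \<open>v\<close> would equal \<open>v\<close>.\<close>
  define H where "H = (\<lambda>z. stereo_factor z powr a * ((stretch e c (stereo z) powr a - 1) * v (stereo z)))"
  have stl: "((\<lambda>z. stretch e c (stereo z)) \<longlongrightarrow> stretch e c P) (nhds y)"
    by (intro tendsto_stretch tendsto_const st direction P(1))
  have vl: "((\<lambda>z. v (stereo z)) \<longlongrightarrow> v P) (nhds y)"
    by (intro tendsto_v(1) st P(4)) (simp add: norm_stereo)
  have "(H \<longlongrightarrow> H y) (nhds y)"
    unfolding H_def y(1) using sP stereo_factor_pos[of y]
    by (intro tendsto_intros stl vl tendsto_stereo_factor filterlim_ident) auto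
  moreover have Hy: "H y > 0"
    using sP vP a_pos stereo_factor_pos[of y] by (simp add: H_def y(1) gr_one_powr)
  ultimately have 3: "\<forall>\<^sub>F z in nhds y. H y / 2 < H z" by (intro order_tendstoD(1)) auto
  obtain C where C: "C \<ge> 0" "\<forall>\<^sub>F z in nhds y.
    \<bar>k (stereo z)\<bar> * (p * (stretch e c (stereo z) powr a * chart v z) powr (p - 1)) \<le> C"
    using coefficient_bounded[OF y(2)] by blast
  from eventually_conj[OF 1 eventually_conj[OF 2 eventually_conj[OF 3 C(2)]]]
  obtain r where r: "r > 0" "\<And>z. dist z y < r \<Longrightarrow> c < fst (stereo z) \<bullet> e \<and>
      0 < snd (cap_refl e c (stereo z)) * snd N \<and> H y / 2 < H z \<and>
    \<bar>k (stereo z)\<bar> * (p * (stretch e c (stereo z) powr a * chart v z) powr (p - 1)) \<le> C"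
    unfolding eventually_nhds_metric by blast
  obtain \<epsilon> r' where \<epsilon>: "\<epsilon> > 0" "r' > 0" "\<And>z. z \<in> ball y r' - {y} \<Longrightarrow> \<epsilon> \<le> gap z"
  proof (rule positive_near_isolated_singularity[OF dim r(1) _ C(1), of "H y / 2" y "\<lambda>z. gap z"])
    show "0 < H y / 2" using Hy by simp
    fix z assume z: "z \<in> ball y r - {y}"
    then have zr: "c < fst (stereo z) \<bullet> e" "0 < snd (cap_refl e c (stereo z)) * snd N" "H y / 2 < H z"
      "\<bar>k (stereo z)\<bar> * (p * (stretch e c (stereo z) powr a * chart v z) powr (p - 1)) \<le> C"
      using r(2)[of z] by (auto simp: dist_commute)
    have zR: "stereo z \<in> cap_region e c" using reg zr z by auto
    show pos: "0 < gap z"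
      using dominated_imp_less[OF dominated zR] stereo_factor_pos[of z] by simp
    show "\<exists>G L. has_laplacian (\<lambda>z. gap z) G z L \<and> (gap z \<le> H y / 2 \<longrightarrow> L \<le> C * gap z)"
    proof (cases "gap z \<le> H y / 2")
      case True
      then have "gap z \<le> H z" using zr(3) by simp
      then have "kelvin_copy e c (stereo z) - v (stereo z) \<le> (stretch e c (stereo z) powr a - 1) * v (stereo z)"
        using stereo_factor_pos[of z] by (simp add: H_def)
      then have "stretch e c (stereo z) powr a * v (cap_refl e c (stereo z)) \<le> stretch e c (stereo z) powr a * v (stereo z)"
        by (simp add: kelvin_copy_def algebra_simps)
      then have "v (cap_refl e c (stereo z)) \<le> v (stereo z)"
        using stretch_pos[OF direction norm_stereo, of z] by simp
      then obtain G L where GL: "has_laplacian (\<lambda>z. gap z) G z L"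
        "L \<le> \<bar>k (stereo z)\<bar> * (p * (stretch e c (stereo z) powr a * chart v z) powr (p - 1)) * \<bar>gap z\<bar>"
        by (rule gap_bound_coefficient[OF zR])
      have "L \<le> C * \<bar>gap z\<bar>"
        using GL(2) mult_right_mono[OF zr(4), of "\<bar>gap z\<bar>"] by simp
      then show ?thesis using GL(1) pos by auto
    next
      case False
      then show ?thesis using gap_laplacian[OF zR] by blast
    qed
  qed (rule that)
  \<comment> \<open>The conformal factor of the chart is at most 2.\<close>
  define \<epsilon>' where "\<epsilon>' = \<epsilon> / 2 powr a"
  have \<epsilon>': "\<epsilon>' > 0" using \<epsilon>(1) by (simp add: \<epsilon>'_def)
  let ?F = "at N within punctured_sphere"
  have id: "((\<lambda>\<eta>. \<eta>) \<longlongrightarrow> N) ?F" by (rule tendsto_ident_at)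
  have RP: "((\<lambda>\<eta>. cap_refl e c \<eta>) \<longlongrightarrow> P) ?F"
    unfolding P_def by (rule tendsto_cap_refl[OF tendsto_const id direction N(1)])
  have ps: "\<forall>\<^sub>F \<eta> in ?F. \<eta> \<in> punctured_sphere \<and> \<eta> \<noteq> N"
    by (simp add: eventually_at_filter)
  have fs: "\<forall>\<^sub>F \<eta> in ?F. fst (cap_refl e c \<eta>) \<noteq> 0"
    by (rule tendsto_imp_eventually_ne[OF tendsto_fst[OF RP] P0])
  have "((\<lambda>\<eta>. stereo_coord (cap_refl e c \<eta>)) \<longlongrightarrow> y) ?F"
    unfolding y_def by (rule tendsto_stereo_coord[OF RP punctured_stereo_coord(3)[OF P(1) P0]])
  then have near: "\<forall>\<^sub>F \<eta> in ?F. dist (stereo_coord (cap_refl e c \<eta>)) y < r'"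
    using \<epsilon>(2) by (rule tendstoD)
  have low: "\<forall>\<^sub>F \<eta> in ?F. (v (cap_refl e c \<eta>) + \<epsilon>') * stretch e c \<eta> powr a \<le> v \<eta>"
    using ps fs near
  proof eventually_elim
    case (elim \<eta>)
    have n1: "norm \<eta> = 1" using elim by (simp add: punctured_sphere_iff)
    define z where "z = stereo_coord (cap_refl e c \<eta>)"
    have z: "stereo z = cap_refl e c \<eta>"
      unfolding z_def by (rule punctured_stereo_coord(1)[OF norm_refl[OF direction n1] elim(2)])
    have "cap_refl e c \<eta> \<noteq> P"
      using refl_refl[OF direction n1] P(3) elim(1) by auto
    then have "z \<noteq> y" using z y(1) by auto
    then have "\<epsilon> \<le> gap z" using \<epsilon>(3)[of z] elim(3) by (simp add: z_def dist_commute)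
    moreover have "stereo_factor z powr a \<le> 2 powr a"
      using a_pos stereo_factor_pos[of z] by (intro powr_mono2) (auto simp: stereo_factor_def divide_le_eq one_plus_inner_pos)
    moreover have "kelvin_copy e c (stereo z) - v (stereo z) \<ge> 0"
      using calculation(1) \<epsilon>(1) stereo_factor_pos[of z] by (smt (verit) mult_nonneg_nonpos powr_ge_zero)
    ultimately have "\<epsilon> \<le> 2 powr a * (kelvin_copy e c (stereo z) - v (stereo z))"
      by (smt (verit) mult_right_mono)
    then have le: "\<epsilon>' \<le> kelvin_copy e c (stereo z) - v (stereo z)"
      by (simp add: \<epsilon>'_def pos_divide_le_eq mult.commute)
    have s: "stretch e c \<eta> > 0" by (rule stretch_pos[OF direction n1])
    have "kelvin_copy e c (stereo z) * stretch e c \<eta> powr a = v \<eta>"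
      unfolding z kelvin_copy_def refl_refl[OF direction n1] stretch_refl[OF direction n1]
      using s by (simp add: powr_divide)
    moreover have "(v (stereo z) + \<epsilon>') * stretch e c \<eta> powr a \<le> kelvin_copy e c (stereo z) * stretch e c \<eta> powr a"
      using le by (intro mult_right_mono) auto
    ultimately show ?case by (simp add: z)
  qed
  define b where "b = (v P + \<epsilon>' / 2) * stretch e c N powr a"
  have sN: "stretch e c N > 0" by (rule stretch_pos[OF direction N(1)])
  have "((\<lambda>\<eta>. (v (cap_refl e c \<eta>) + \<epsilon>') * stretch e c \<eta> powr a) \<longlongrightarrow> (v P + \<epsilon>') * stretch e c N powr a) ?F"
  proof (intro tendsto_intros tendsto_v(1) RP P(4) tendsto_stretch[OF tendsto_const id direction N(1)])
    show "\<forall>\<^sub>F \<eta> in ?F. norm (cap_refl e c \<eta>) = 1"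
      using ps by eventually_elim (auto intro: norm_refl[OF direction] simp: punctured_sphere_iff)
  qed (use sN in auto)
  moreover have "b < (v P + \<epsilon>') * stretch e c N powr a" using \<epsilon>' sN by (simp add: b_def)
  ultimately have "\<forall>\<^sub>F \<eta> in ?F. b < (v (cap_refl e c \<eta>) + \<epsilon>') * stretch e c \<eta> powr a"
    by (rule order_tendstoD)
  with low have "\<forall>\<^sub>F \<eta> in ?F. b \<le> v \<eta>" by eventually_elim simp
  moreover have "v (cap_refl e c N) * stretch e c N powr a < b"
    using \<epsilon>' sN by (simp add: b_def P_def)
  ultimately show "\<exists>b. v (cap_refl e c N) * stretch e c N powr a < b \<and>
          (\<forall>\<^sub>F \<eta> in at N within punctured_sphere. b \<le> v \<eta>)" by blast
qed

text \<open>
  Stated for a varying parameter and a varying point, since it serves both for a fixed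
  reflection and for sequences of reflections.
\<close>
lemma pole_margin_less:
  assumes Q: "pole_margin e c" and N: "norm N = 1" "fst N = 0"
    and lim: "(cs \<longlongrightarrow> c) F" "(g \<longlongrightarrow> cap_refl e c N) F"
    and ev: "\<forall>\<^sub>F x in F. 0 \<le> cs x \<and> norm (g x) = 1 \<and> fst (cap_refl e (cs x) (g x)) \<noteq> 0"
  shows "\<forall>\<^sub>F x in F. v (g x) < kelvin_copy e (cs x) (g x)"
proof -
  note P = pole_image[OF e c N]
  have sN: "stretch e c N > 0" by (rule stretch_pos[OF direction N(1)])
  obtain b where b: "v (cap_refl e c N) * stretch e c N powr a < b"
    "\<forall>\<^sub>F \<eta> in at N within punctured_sphere. b \<le> v \<eta>"
    using Q N unfolding pole_margin_def by blast
  have R: "((\<lambda>x. cap_refl e (cs x) (g x)) \<longlongrightarrow> N) F"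
    using tendsto_cap_refl[OF lim direction P(1)] by (simp add: P(3))
  have "\<forall>\<^sub>F x in F. cs x < 1" using lim(1) c(2) by (rule order_tendstoD)
  with ev have "\<forall>\<^sub>F x in F. cap_refl e (cs x) (g x) \<in> punctured_sphere \<and> cap_refl e (cs x) (g x) \<noteq> N"
    by eventually_elim (use norm_refl[OF e] N(2) in \<open>auto simp: punctured_sphere_iff\<close>)
  with R have "filterlim (\<lambda>x. cap_refl e (cs x) (g x)) (at N within punctured_sphere) F"
    by (auto simp: filterlim_at)
  from eventually_compose_filterlim[OF b(2) this]
  have 1: "\<forall>\<^sub>F x in F. b \<le> v (cap_refl e (cs x) (g x))" .
  have sP: "stretch e c (cap_refl e c N) = 1 / stretch e c N" by (rule stretch_refl[OF direction N(1)])
  have "((\<lambda>x. stretch e (cs x) (g x) powr a * b - v (g x)) \<longlongrightarrow>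
      stretch e c (cap_refl e c N) powr a * b - v (cap_refl e c N)) F"
    using sN by (intro tendsto_intros tendsto_stretch[OF lim direction P(1)] tendsto_v(1) lim P(4))
      (use ev sP in \<open>auto elim: eventually_mono\<close>)
  moreover have "v (cap_refl e c N) < stretch e c (cap_refl e c N) powr a * b"
    unfolding sP using b(1) sN by (simp add: powr_divide pos_less_divide_eq)
  ultimately have "\<forall>\<^sub>F x in F. 0 < stretch e (cs x) (g x) powr a * b - v (g x)"
    by (intro order_tendstoD(1)) auto
  with 1 show ?thesis
  proof eventually_elim
    case (elim x)
    have "stretch e (cs x) (g x) powr a * b \<le> kelvin_copy e (cs x) (g x)"
      unfolding kelvin_copy_def using elim(1) by (intro mult_left_mono) auto
    then show ?case using elim(2) by simp
  qed
qed

text \<open>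
  Near the singular points the gap is positive by the margin condition, and on the boundary of the cap
  it vanishes, so a negative minimum over the remaining compact set is attained inside.
\<close>
lemma negative_minimum:
  assumes Q: "pole_margin e c" and ng: "\<not> dominated e c"
    and \<phi>: "continuous_on {\<theta>. norm \<theta> = 1 \<and> c \<le> fst \<theta> \<bullet> e} \<phi>"
    and \<phi>_pos: "\<And>\<theta>. norm \<theta> = 1 \<Longrightarrow> c \<le> fst \<theta> \<bullet> e \<Longrightarrow> \<phi> \<theta> > 0"
  obtains \<theta> where "\<theta> \<in> cap_region e c" "kelvin_copy e c \<theta> < v \<theta>"
    "\<And>\<theta>'. \<theta>' \<in> cap_region e c \<Longrightarrow> (kelvin_copy e c \<theta> - v \<theta>) / \<phi> \<theta> \<le> (kelvin_copy e c \<theta>' - v \<theta>') / \<phi> \<theta>'"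
proof -
  let ?D = "\<lambda>\<theta>. (kelvin_copy e c \<theta> - v \<theta>) / \<phi> \<theta>"
  have "\<exists>T. open T \<and> cap_refl e c N \<in> T \<and> (\<forall>\<theta>\<in>cap_region e c. \<theta> \<in> T \<longrightarrow> v \<theta> < kelvin_copy e c \<theta>)"
    if N: "norm N = 1" "fst N = 0" for N
  proof -
    have "\<forall>\<^sub>F \<theta> in at (cap_refl e c N) within cap_region e c. v \<theta> < kelvin_copy e c \<theta>"
      using c by (intro pole_margin_less[OF Q N tendsto_const tendsto_ident_at])
        (auto simp: eventually_at_filter cap_region_def)
    moreover have "cap_refl e c N \<notin> cap_region e c" using pole_image(3)[OF e c N] N by (simp add: cap_region_def)
    ultimately show ?thesis unfolding eventually_at_topological by metis
  qed
  then obtain T where T: "\<And>N. norm N = 1 \<Longrightarrow> fst N = 0 \<Longrightarrow>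
     open (T N) \<and> cap_refl e c N \<in> T N \<and> (\<forall>\<theta>\<in>cap_region e c. \<theta> \<in> T N \<longrightarrow> v \<theta> < kelvin_copy e c \<theta>)"
    by metis
  have poles: "norm (north :: (real ^ 'n) \<times> real) = 1" "fst (north :: (real ^ 'n) \<times> real) = 0"
    "norm (south :: (real ^ 'n) \<times> real) = 1" "fst (south :: (real ^ 'n) \<times> real) = 0"
    by (simp_all add: north_def south_def norm_Pair)
  define K where "K = sphere 0 1 \<inter> ({\<theta>. c \<le> fst \<theta> \<bullet> e} \<inter> (- T north \<inter> - T south))"
  have "compact K" unfolding K_def using T[OF poles(1,2)] T[OF poles(3,4)]
    by (intro compact_Int_closed closed_Int closed_Compl closed_Collect_le continuous_intros) auto
  have KI: "\<theta> \<in> cap_region e c \<or> fst \<theta> \<bullet> e = c" and KR: "fst (cap_refl e c \<theta>) \<noteq> 0"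
    and K1: "norm \<theta> = 1" "c \<le> fst \<theta> \<bullet> e" if "\<theta> \<in> K" for \<theta>
  proof -
    show 1: "norm \<theta> = 1" "c \<le> fst \<theta> \<bullet> e" using that by (auto simp: K_def)
    show 2: "fst (cap_refl e c \<theta>) \<noteq> 0"
    proof
      assume f: "fst (cap_refl e c \<theta>) = 0"
      have "cap_refl e c \<theta> = north \<or> cap_refl e c \<theta> = south"
        using f norm_refl[OF direction 1(1)] by (metis DiffI insertE mem_sphere_0 punctured_sphere_def punctured_sphere_iff singletonD)
      then have "\<theta> = cap_refl e c north \<or> \<theta> = cap_refl e c south" using refl_refl[OF direction 1(1)] by metis
      then show False using that T[OF poles(1,2)] T[OF poles(3,4)] by (auto simp: K_def)
    qed
    show "\<theta> \<in> cap_region e c \<or> fst \<theta> \<bullet> e = c" using 1 2 by (auto simp: cap_region_def)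
  qed
  have KPS: "\<theta> \<in> punctured_sphere" if "\<theta> \<in> K" for \<theta>
    using K1[OF that] c by (auto simp: punctured_sphere_iff)
  have "continuous_on K ?D"
  proof (intro continuous_intros)
    show "continuous_on K (kelvin_copy e c)" unfolding continuous_on_def
    proof (intro ballI tendsto_kelvin_copy tendsto_const tendsto_ident_at direction)
      fix \<theta> assume "\<theta> \<in> K"
      then show "norm \<theta> = 1" "fst (cap_refl e c \<theta>) \<noteq> 0" using K1 KR by auto
      show "\<forall>\<^sub>F x in at \<theta> within K. norm x = 1 \<and> 0 \<le> c"
        using K1 c by (simp add: eventually_at_filter)
    qed
    show "continuous_on K v" using v_cont by (rule continuous_on_subset) (use KPS in blast)
    show "continuous_on K \<phi>" using \<phi> by (rule continuous_on_subset) (use K1 in blast)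
    show "\<forall>\<theta>\<in>K. \<phi> \<theta> \<noteq> 0" using \<phi>_pos K1 by force
  qed
  have inK: "\<theta> \<in> K \<or> v \<theta> < kelvin_copy e c \<theta>" if "\<theta> \<in> cap_region e c" for \<theta>
  proof -
    have "\<theta> \<in> T north \<Longrightarrow> v \<theta> < kelvin_copy e c \<theta>" "\<theta> \<in> T south \<Longrightarrow> v \<theta> < kelvin_copy e c \<theta>"
      using that T[OF poles(1,2)] T[OF poles(3,4)] by blast+
    then show ?thesis using that by (auto simp: K_def cap_region_def)
  qed
  obtain \<theta>0 where \<theta>0: "\<theta>0 \<in> cap_region e c" "kelvin_copy e c \<theta>0 < v \<theta>0"
    using ng by (auto simp: dominated_def not_le)
  then have "\<theta>0 \<in> K" using inK[of \<theta>0] by auto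
  from continuous_attains_inf[OF \<open>compact K\<close> _ \<open>continuous_on K ?D\<close>] this
  obtain \<theta> where \<theta>: "\<theta> \<in> K" "\<And>\<theta>'. \<theta>' \<in> K \<Longrightarrow> ?D \<theta> \<le> ?D \<theta>'" by blast
  have "?D \<theta>0 < 0" using \<theta>0(2) \<phi>_pos K1[OF \<open>\<theta>0 \<in> K\<close>] by (simp add: divide_less_0_iff)
  then have neg: "?D \<theta> < 0" using \<theta>(2)[OF \<open>\<theta>0 \<in> K\<close>] by simp
  have p\<theta>: "\<phi> \<theta> > 0" using \<phi>_pos K1[OF \<theta>(1)] by simp
  have lt: "kelvin_copy e c \<theta> < v \<theta>" using neg p\<theta> by (simp add: divide_less_0_iff)
  have "\<theta> \<in> cap_region e c"
  proof (rule ccontr)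
    assume "\<theta> \<notin> cap_region e c"
    then have s: "fst \<theta> \<bullet> e = c" using KI[OF \<theta>(1)] by blast
    have "cap_den e c \<theta> = 1 - c\<^sup>2" using s by (simp add: cap_den_def power2_eq_square)
    then have "stretch e c \<theta> = 1" "cap_refl e c \<theta> = \<theta>"
      using one_minus_csq[OF direction] s by (simp_all add: stretch_def cap_refl_def zero_prod_def[symmetric])
    then show False using lt by (simp add: kelvin_copy_def)
  qed
  moreover have "?D \<theta> \<le> ?D \<theta>'" if "\<theta>' \<in> cap_region e c" for \<theta>'
  proof (cases "\<theta>' \<in> K")
    case False
    then have "v \<theta>' < kelvin_copy e c \<theta>'" using inK[OF that] by blast
    moreover have "\<phi> \<theta>' > 0" using that by (intro \<phi>_pos) (auto simp: cap_region_def)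
    ultimately have "0 \<le> ?D \<theta>'" by simp
    then show ?thesis using neg by linarith
  qed (rule \<theta>(2))
  ultimately show ?thesis using that lt by blast
qed

text \<open>
  With \<open>m < 0\<close> the minimal quotient, the gap minus \<open>m \<Phi>\<close> has a minimum with value 0. The gap is
  negative there, which makes the reflected value of \<open>v\<close> smaller and gives the linear inequality.
\<close>
lemma barrier_at_minimum:
  assumes y: "stereo y \<in> cap_region e c" and lt: "kelvin_copy e c (stereo y) < v (stereo y)"
    and pos: "\<And>z. \<Phi> z > 0"
    and mn: "\<And>z. stereo z \<in> cap_region e c \<Longrightarrow> gap y / \<Phi> y \<le> gap z / \<Phi> z"
    and lap: "has_laplacian \<Phi> G y L"
  shows "- L \<le> \<bar>k (stereo y)\<bar> * (p * chart v y powr (p - 1)) * \<Phi> y"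
proof -
  define m where "m = gap y / \<Phi> y"
  have f: "stereo_factor y powr a > 0" using stereo_factor_pos[of y] by simp
  have "gap y < 0" using lt f by (simp add: mult_less_0_iff)
  then have m: "m < 0" "gap y = m * \<Phi> y" using pos[of y] by (simp_all add: m_def divide_less_0_iff) 
  have le: "v (cap_refl e c (stereo y)) \<le> v (stereo y)" using cap_region_stretch(3)[OF y] lt by simp
  obtain G' where G': "has_laplacian (\<lambda>z. gap z) G' y
    (chart v y powr p * k (stereo y) - chart (kelvin_copy e c) y powr p * k (cap_refl e c (stereo y)))"
    by (rule gap_laplacian[OF y])
  have "chart (kelvin_copy e c) y \<le> chart v y" using lt f by simp
  from gap_laplacian_le[OF y le order_refl this]
  have b: "chart v y powr p * k (stereo y) - chart (kelvin_copy e c) y powr p * k (cap_refl e c (stereo y)) \<le>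
    \<bar>k (stereo y)\<bar> * (p * chart v y powr (p - 1)) * \<bar>gap y\<bar>" .
  have "\<forall>\<^sub>F z in nhds y. gap y - m * \<Phi> y \<le> gap z - m * \<Phi> z"
    using cap_region_eventually[OF direction y]
  proof eventually_elim
    case (elim z)
    have "m \<le> gap z / \<Phi> z" using mn[OF elim] by (simp add: m_def)
    then have "m * \<Phi> z \<le> gap z" using pos[of z] by (simp add: pos_le_divide_eq)
    then show ?case using m(2) by simp
  qed
  from laplacian_nonneg_at_min[OF has_laplacian_diff[OF G' has_laplacian_cmult[OF lap]] this] b
  have "m * L \<le> \<bar>k (stereo y)\<bar> * (p * chart v y powr (p - 1)) * \<bar>gap y\<bar>" by simp
  also have "\<bar>gap y\<bar> = - m * \<Phi> y" using m pos[of y] by (simp add: abs_mult)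
  finally have "(- m) * (- L) \<le> (- m) * (\<bar>k (stereo y)\<bar> * (p * chart v y powr (p - 1)) * \<Phi> y)"
    by (simp add: algebra_simps)
  then show ?thesis using m(1) by (simp only: mult_le_cancel_left_pos neg_0_less_iff_less)
qed

end

section \<open>Moving the spheres\<close>

text \<open>
  The contradiction behind the continuity argument, for a critical parameter \<open>c0\<close> as well as for
  the start \<open>c0 = 1\<close>. The minima of the gap over the barrier accumulate at a point of the closed cap of
  \<open>c0\<close>. Strict positivity of the limiting gap and its margin at the singular points leave only the
  boundary of the cap, where the Gaussian barrier with large \<open>K\<close> violates the inequality that
  holds at the minima. In the chart that boundary lies on a sphere \<open>|y - x|\<^sup>2 = R\<close>.
\<close>
lemma moving_spheres_step:
  assumes e: "norm e = 1" and c0: "0 < c0" "c0 \<le> 1"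
    and cs: "\<And>i. 0 < cs i" "\<And>i. cs i < 1" "cs \<longlonglongrightarrow> c0"
    and bad: "\<And>i. pole_margin e (cs i)" "\<And>i. \<not> dominated e (cs i)"
    and lim: "c0 < 1 \<Longrightarrow> dominated e c0"
    and R: "R > 0" "\<And>y. fst (stereo y) \<bullet> e = c0 \<Longrightarrow> (y - x) \<bullet> (y - x) = R"
  shows False
proof -
  define n where "n = real CARD('n)"
  define B :: "((real ^ 'n) \<times> real) set" where "B = sphere 0 1 \<inter> {\<theta>. fst \<theta> \<bullet> e = c0}"
  \<comment> \<open>The coefficient of \<open>barrier_at_minimum\<close>, expressed on the sphere, where the chart factor is \<open>1 - snd \<theta>\<close>.\<close>
  define h where "h = (\<lambda>\<theta>. \<bar>k \<theta>\<bar> * (p * ((1 - snd \<theta>) powr a * v \<theta>) powr (p - 1)))"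
  have snd_lt: "1 - snd \<theta> > 0" if ps: "\<theta> \<in> punctured_sphere" for \<theta>
  proof -
    obtain y where "stereo y = \<theta>"
      using ps punctured_stereo_coord(1)[of \<theta>] unfolding punctured_sphere_iff by blast
    then have "snd \<theta> = 1 - stereo_factor y" by (auto simp: stereo_eq)
    then show ?thesis using stereo_factor_pos[of y] by simp
  qed
  have h_tendsto: "((\<lambda>i. h (g i)) \<longlongrightarrow> h \<theta>) F"
    if "(g \<longlongrightarrow> \<theta>) F" "\<theta> \<in> punctured_sphere" "\<forall>\<^sub>F i in F. norm (g i) = 1" for g \<theta> and F :: "'z filter"
    unfolding h_def using snd_lt[OF that(2)] v_pos[OF that(2)]
    by (intro tendsto_intros tendsto_v that) auto
  have Bps: "B \<subseteq> punctured_sphere" using c0 by (auto simp: B_def punctured_sphere_iff)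
  have "compact B" unfolding B_def
    by (intro compact_Int_closed closed_Collect_eq continuous_intros) simp
  have "continuous_on B h" unfolding continuous_on_def
  proof (intro ballI h_tendsto tendsto_ident_at)
    fix \<theta> assume "\<theta> \<in> B" then show "\<theta> \<in> punctured_sphere" using Bps by blast
    show "\<forall>\<^sub>F x in at \<theta> within B. norm x = 1" by (simp add: eventually_at_filter B_def)
  qed
  then have "compact (h ` B)" using \<open>compact B\<close> by (rule compact_continuous_image)
  then obtain C1 where C1: "\<And>\<theta>. \<theta> \<in> B \<Longrightarrow> h \<theta> \<le> C1"
    by (metis bounded_imp_bdd_above compact_imp_bounded bdd_above.E imageI)
  define C where "C = max 0 C1"
  have C: "C \<ge> 0" "\<And>\<theta>. \<theta> \<in> B \<Longrightarrow> h \<theta> \<le> C" using C1 by (auto simp: C_def le_max_iff_disj)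
  \<comment> \<open>Then \<open>- \<Delta> \<Phi> = (C + 1) \<Phi>\<close> on the boundary of the limiting cap.\<close>
  define K where "K = (C + 1) / (8 * R)"
  have KR: "8 * K * R = C + 1" using R(1) by (simp add: K_def)
  define q where "q = (\<lambda>z. (z - x) \<bullet> (z - x))"
  define \<Phi> where "\<Phi> = (\<lambda>z. exp (- K * (q z - R)\<^sup>2))"
  define L\<Phi> where "L\<Phi> = (\<lambda>y. exp (- K * (q y - R)\<^sup>2) *
    ((4 * K\<^sup>2 * (q y - R)\<^sup>2 - 2 * K) * (4 * q y) - 4 * n * K * (q y - R)))"
  have lap: "\<exists>G. has_laplacian \<Phi> G y (L\<Phi> y)" for y
    unfolding \<Phi>_def L\<Phi>_def q_def n_def by (rule has_laplacian_gaussian)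
  have \<Phi>_pos: "\<Phi> z > 0" for z by (simp add: \<Phi>_def)
  define \<phi> where "\<phi> = (\<lambda>\<theta>. \<Phi> (stereo_coord \<theta>) / (1 - snd \<theta>) powr a)"
  have quot: "w / \<phi> (stereo z) = stereo_factor z powr a * w / \<Phi> z" for w z
    by (simp add: \<phi>_def stereo_coord_stereo) (simp add: stereo_eq)
  have "\<exists>\<theta>\<in>cap_region e (cs i). kelvin_copy e (cs i) \<theta> < v \<theta> \<and>
     (\<forall>\<theta>'\<in>cap_region e (cs i). (kelvin_copy e (cs i) \<theta> - v \<theta>) / \<phi> \<theta> \<le> (kelvin_copy e (cs i) \<theta>' - v \<theta>') / \<phi> \<theta>')" for i
  proof -
    let ?S = "{\<theta>. norm \<theta> = 1 \<and> cs i \<le> fst \<theta> \<bullet> e}"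
    have S: "\<theta> \<in> punctured_sphere" if "norm \<theta> = 1" "cs i \<le> fst \<theta> \<bullet> e" for \<theta>
      using that cs(1)[of i] by (auto simp: punctured_sphere_iff)
    have 1: "continuous_on ?S \<phi>"
      unfolding \<phi>_def \<Phi>_def q_def stereo_coord_def
      by (intro continuous_intros) (use snd_lt S in force)+
    have 2: "\<phi> \<theta> > 0" if "norm \<theta> = 1" "cs i \<le> fst \<theta> \<bullet> e" for \<theta>
      using snd_lt[OF S[OF that]] \<Phi>_pos by (simp add: \<phi>_def)
    obtain \<theta> where "\<theta> \<in> cap_region e (cs i)" "kelvin_copy e (cs i) \<theta> < v \<theta>"
      "\<And>\<theta>'. \<theta>' \<in> cap_region e (cs i) \<Longrightarrow>
        (kelvin_copy e (cs i) \<theta> - v \<theta>) / \<phi> \<theta> \<le> (kelvin_copy e (cs i) \<theta>' - v \<theta>') / \<phi> \<theta>'"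
      by (rule negative_minimum[OF e cs(1)[of i] cs(2)[of i] bad(1)[of i] bad(2)[of i] 1 2]) blast+
    then show ?thesis by blast
  qed
  then obtain g where g: "\<And>i. g i \<in> cap_region e (cs i)" "\<And>i. kelvin_copy e (cs i) (g i) < v (g i)"
     "\<And>i \<theta>'. \<theta>' \<in> cap_region e (cs i) \<Longrightarrow>
        (kelvin_copy e (cs i) (g i) - v (g i)) / \<phi> (g i) \<le> (kelvin_copy e (cs i) \<theta>' - v \<theta>') / \<phi> \<theta>'"
    by metis
  have gps: "g i \<in> punctured_sphere" for i
    using cap_region_punctured(1)[OF e less_imp_le[OF cs(1)] cs(2) g(1)] .
  define ys where "ys = (\<lambda>i. stereo_coord (g i))"
  have ys: "stereo (ys i) = g i" for i
    using gps[of i] punctured_stereo_coord(1)[of "g i"] by (simp add: ys_def punctured_sphere_iff)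
  have le: "- L\<Phi> (ys i) \<le> h (g i) * \<Phi> (ys i)" for i
  proof -
    obtain G where G: "has_laplacian \<Phi> G (ys i) (L\<Phi> (ys i))" using lap by blast
    have "- L\<Phi> (ys i) \<le> \<bar>k (stereo (ys i))\<bar> * (p * chart v (ys i) powr (p - 1)) * \<Phi> (ys i)"
    proof (rule barrier_at_minimum[OF e cs(1,2) _ _ \<Phi>_pos _ G])
      show "stereo (ys i) \<in> cap_region e (cs i)" "kelvin_copy e (cs i) (stereo (ys i)) < v (stereo (ys i))"
        using g(1,2) by (simp_all add: ys)
      fix z assume "stereo z \<in> cap_region e (cs i)"
      from g(3)[OF this] show "gap e (cs i) (ys i) / \<Phi> (ys i) \<le> gap e (cs i) z / \<Phi> z"
        unfolding ys[symmetric] quot .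
    qed
    moreover have "1 - snd (g i) = stereo_factor (ys i)"
      unfolding ys[symmetric] by (simp add: stereo_eq)
    ultimately show ?thesis by (simp add: h_def ys)
  qed
  have "\<forall>i. g i \<in> sphere 0 1" using gps by (auto simp: punctured_sphere_iff)
  moreover have "compact (sphere (0 :: (real ^ 'n) \<times> real) 1)" by simp
  ultimately obtain l r where l: "l \<in> sphere 0 1" and r: "strict_mono r" and gl: "(g \<circ> r) \<longlonglongrightarrow> l"
    unfolding compact_def by blast
  have csr: "(\<lambda>i. cs (r i)) \<longlonglongrightarrow> c0"
    using LIMSEQ_subseq_LIMSEQ[OF cs(3) r] by (simp add: o_def)
  have gl: "(\<lambda>i. g (r i)) \<longlonglongrightarrow> l" using gl by (simp add: o_def)
  have l1: "norm l = 1" using l by simp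
  have gn: "norm (g i) = 1" for i using gps[of i] by (simp add: punctured_sphere_iff)
  have "(\<lambda>i. fst (g (r i)) \<bullet> e) \<longlonglongrightarrow> fst l \<bullet> e" by (intro tendsto_intros gl)
  then have lc: "c0 \<le> fst l \<bullet> e"
    by (rule LIMSEQ_le[OF csr]) (use g(1) in \<open>auto simp: cap_region_def intro!: exI less_imp_le\<close>)
  then have lps: "l \<in> punctured_sphere" using c0(1) l1 by (auto simp: punctured_sphere_iff)
  show False
  proof (cases "fst l \<bullet> e = c0")
    case False
    then have lc: "c0 < fst l \<bullet> e" using lc by simp
    then have c1: "c0 < 1" using sphere_inner_less[OF e l1] by simp
    note direction = e less_imp_le[OF c0(1)] c1
    have dominated: "dominated e c0" using lim[OF c1] .
    have "\<forall>\<^sub>F i in sequentially. v (g (r i)) < kelvin_copy e (cs (r i)) (g (r i))"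
    proof (cases "fst (cap_refl e c0 l) = 0")
      case True
      show ?thesis
      proof (rule pole_margin_less[OF e c0(1) c1 dominated_imp_pole_margin[OF e c0(1) c1 dominated]])
        show "norm (cap_refl e c0 l) = 1" "fst (cap_refl e c0 l) = 0"
          using norm_refl[OF direction l1] True by auto
        show "(\<lambda>i. g (r i)) \<longlonglongrightarrow> cap_refl e c0 (cap_refl e c0 l)"
          using gl by (simp add: refl_refl[OF direction l1])
        show "\<forall>\<^sub>F i in sequentially. 0 \<le> cs (r i) \<and> norm (g (r i)) = 1 \<and>
            fst (cap_refl e (cs (r i)) (g (r i))) \<noteq> 0"
          using g(1) cs(1) by (auto simp: cap_region_def intro!: always_eventually less_imp_le)
      qed (rule csr)
    next
      case False
      then have lr: "l \<in> cap_region e c0" using l1 lc by (simp add: cap_region_def)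
      have "(\<lambda>i. kelvin_copy e (cs (r i)) (g (r i)) - v (g (r i))) \<longlonglongrightarrow> kelvin_copy e c0 l - v l"
        using cs(1) gn False by (intro tendsto_diff tendsto_kelvin_copy tendsto_v(1) csr gl direction l1 lps)
          (auto intro!: always_eventually less_imp_le)
      moreover have "0 < kelvin_copy e c0 l - v l"
        using dominated_imp_less[OF e c0(1) c1 dominated lr] by simp
      ultimately have "\<forall>\<^sub>F i in sequentially. 0 < kelvin_copy e (cs (r i)) (g (r i)) - v (g (r i))"
        by (rule order_tendstoD)
      then show ?thesis by eventually_elim simp
    qed
    then have "\<forall>\<^sub>F i in sequentially. False"
      by eventually_elim (use g(2) in \<open>auto simp: not_less[symmetric] dest: less_asym\<close>)
    then show False by simp
  next
    case True
    define y where "y = stereo_coord l"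
    have l0: "fst l \<noteq> 0" using lps by (simp add: punctured_sphere_iff)
    have y: "stereo y = l" unfolding y_def by (rule punctured_stereo_coord(1)[OF l1 l0])
    have yl: "(\<lambda>i. ys (r i)) \<longlonglongrightarrow> y"
      unfolding ys_def y_def by (rule tendsto_stereo_coord[OF gl punctured_stereo_coord(3)[OF l1 l0]])
    have qy: "q y = R" unfolding q_def by (rule R(2)) (simp add: y True)
    have "(\<lambda>i. - L\<Phi> (ys (r i))) \<longlonglongrightarrow> - L\<Phi> y"
      unfolding L\<Phi>_def q_def by (intro tendsto_intros yl)
    moreover have "(\<lambda>i. h (g (r i)) * \<Phi> (ys (r i))) \<longlonglongrightarrow> h l * \<Phi> y"
      unfolding \<Phi>_def q_def by (intro tendsto_intros yl h_tendsto gl lps) (simp add: gn)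
    ultimately have "- L\<Phi> y \<le> h l * \<Phi> y"
      by (rule LIMSEQ_le) (use le in blast)
    then have "8 * K * R \<le> h l" by (simp add: L\<Phi>_def \<Phi>_def qy)
    moreover have "h l \<le> C" using l1 True by (intro C(2)) (simp add: B_def)
    ultimately show False using KR by simp
  qed
qed

lemma pole_margin_open:
  assumes e: "norm e = 1" "0 < c" "c < 1" and Q: "pole_margin e c" and cs: "(cs \<longlongrightarrow> c) F"
  shows "\<forall>\<^sub>F x in F. pole_margin e (cs x)"
proof -
  note direction = e(1) less_imp_le[OF e(2)] e(3)
  have *: "\<forall>\<^sub>F x in F. \<exists>b. v (cap_refl e (cs x) N) * stretch e (cs x) N powr a < b \<and>
          (\<forall>\<^sub>F \<eta> in at N within punctured_sphere. b \<le> v \<eta>)" if N: "norm N = 1" "fst N = 0" for N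
  proof -
    obtain b where b: "v (cap_refl e c N) * stretch e c N powr a < b"
      "\<forall>\<^sub>F \<eta> in at N within punctured_sphere. b \<le> v \<eta>"
      using Q N unfolding pole_margin_def by blast
    have "\<forall>\<^sub>F x in F. 0 < cs x" "\<forall>\<^sub>F x in F. cs x < 1"
      using order_tendstoD[OF cs] e by auto
    then have n: "\<forall>\<^sub>F x in F. norm (cap_refl e (cs x) N) = 1"
      by eventually_elim (use norm_refl[OF e(1) _ _ N(1)] in auto)
    have "((\<lambda>x. v (cap_refl e (cs x) N) * stretch e (cs x) N powr a) \<longlongrightarrow>
        v (cap_refl e c N) * stretch e c N powr a) F"
      using stretch_pos[OF direction N(1)]
      by (intro tendsto_intros tendsto_v(1) tendsto_cap_refl tendsto_stretch cs direction N(1) n pole_image(4)[OF e N]) auto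
    then have "\<forall>\<^sub>F x in F. v (cap_refl e (cs x) N) * stretch e (cs x) N powr a < b"
      using b(1) by (rule order_tendstoD)
    then show ?thesis by eventually_elim (use b(2) in blast)
  qed
  from eventually_conj[OF *[OF norm_poles(1) fst_poles(1)] *[OF norm_poles(2) fst_poles(2)]]
  show ?thesis
    unfolding pole_margin_def by (rule eventually_mono) (use pole_north_or_south in blast)
qed

text \<open>
  As \<open>c\<close> tends to 1 the conformal factor at the poles tends to 0, while the reflected poles tend
  to \<open>e\<close>, where \<open>v\<close> is continuous.
\<close>
lemma pole_margin_near_1:
  assumes e: "norm e = 1" and m: "m > 0" "\<And>\<theta>. \<theta> \<in> punctured_sphere \<Longrightarrow> m \<le> v \<theta>"
    and cs: "(cs \<longlongrightarrow> 1) F" "\<forall>\<^sub>F x in F. 0 < cs x \<and> cs x < 1"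
  shows "\<forall>\<^sub>F x in F. pole_margin e (cs x)"
proof -
  have *: "\<forall>\<^sub>F x in F. v (cap_refl e (cs x) N) * stretch e (cs x) N powr a < m"
    if N: "norm N = 1" "fst N = 0" for N
  proof -
    have den: "cap_den e c N = 1 + c\<^sup>2" for c by (simp add: cap_den_def N)
    have pos: "1 + (c :: real)\<^sup>2 \<noteq> 0" for c by (metis add_pos_nonneg less_irrefl zero_le_power2 zero_less_one)
    have "((\<lambda>x. (1 - (cs x)\<^sup>2) / (1 + (cs x)\<^sup>2)) \<longlongrightarrow> (1 - 1\<^sup>2) / (1 + 1\<^sup>2)) F"
      by (intro tendsto_intros cs(1)) simp
    then have s: "((\<lambda>x. stretch e (cs x) N) \<longlongrightarrow> 0) F" by (simp add: stretch_def den)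
    have s0: "\<forall>\<^sub>F x in F. 0 \<le> stretch e (cs x) N"
      using cs(2) by eventually_elim (use stretch_pos[OF e _ _ N(1)] in \<open>auto intro!: less_imp_le\<close>)
    have "((\<lambda>x. (1 / (1 + (cs x)\<^sup>2)) *\<^sub>R ((1 - (cs x)\<^sup>2) *\<^sub>R N + (2 * (cs x - 0)) *\<^sub>R (e, 0 :: real))) \<longlongrightarrow>
        (1 / (1 + 1\<^sup>2)) *\<^sub>R ((1 - 1\<^sup>2) *\<^sub>R N + (2 * (1 - 0)) *\<^sub>R (e, 0))) F"
      by (intro tendsto_intros cs(1)) simp
    then have R: "((\<lambda>x. cap_refl e (cs x) N) \<longlongrightarrow> (e, 0)) F" by (simp add: cap_refl_def den N)
    have "((\<lambda>x. v (cap_refl e (cs x) N) * stretch e (cs x) N powr a) \<longlongrightarrow> v (e, 0) * 0) F"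
    proof (intro tendsto_mult tendsto_v(1) R)
      show "(e, 0) \<in> punctured_sphere" using e by (auto simp: punctured_sphere_iff norm_Pair)
      show "\<forall>\<^sub>F x in F. norm (cap_refl e (cs x) N) = 1"
        using cs(2) by eventually_elim (use norm_refl[OF e _ _ N(1)] in auto)
      show "((\<lambda>x. stretch e (cs x) N powr a) \<longlongrightarrow> 0) F"
        by (rule tendsto_zero_powrI[OF s tendsto_const s0 a_pos])
    qed
    then show ?thesis by (rule order_tendstoD) (use m in simp)
  qed
  have mb: "\<forall>\<^sub>F \<eta> in at N within punctured_sphere. m \<le> v \<eta>" for N
    using m(2) by (simp add: eventually_at_filter)
  from eventually_conj[OF *[OF norm_poles(1) fst_poles(1)] *[OF norm_poles(2) fst_poles(2)]]
  show ?thesis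
    unfolding pole_margin_def by (rule eventually_mono) (use pole_north_or_south mb in blast)
qed

lemma dominated_from_above:
  assumes e: "norm e = 1" and c: "0 \<le> c" "c < 1" and dominated: "\<And>c'. c < c' \<Longrightarrow> c' < 1 \<Longrightarrow> dominated e c'"
  shows "dominated e c"
  unfolding dominated_def
proof
  fix \<theta> assume \<theta>: "\<theta> \<in> cap_region e c"
  then have n: "norm \<theta> = 1" "c < fst \<theta> \<bullet> e" "fst (cap_refl e c \<theta>) \<noteq> 0" by (auto simp: cap_region_def)
  let ?F = "at_right c"
  have id: "((\<lambda>c'. c') \<longlongrightarrow> c) ?F" by (rule tendsto_ident_at)
  have gt: "\<forall>\<^sub>F c' in ?F. c < c'" by (simp add: eventually_at_filter)
  have "((\<lambda>c'. fst (cap_refl e c' \<theta>)) \<longlongrightarrow> fst (cap_refl e c \<theta>)) ?F"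
    by (intro tendsto_fst tendsto_cap_refl id tendsto_const e c n(1))
  then have "\<forall>\<^sub>F c' in ?F. fst (cap_refl e c' \<theta>) \<noteq> 0" using n(3) by (rule tendsto_imp_eventually_ne)
  moreover have "\<forall>\<^sub>F c' in ?F. c' < fst \<theta> \<bullet> e" using id n(2) by (rule order_tendstoD)
  moreover have "\<forall>\<^sub>F c' in ?F. c' < 1" using id c(2) by (rule order_tendstoD)
  ultimately have "\<forall>\<^sub>F c' in ?F. v \<theta> \<le> kelvin_copy e c' \<theta>"
    using gt
  proof eventually_elim
    case (elim c')
    have "\<theta> \<in> cap_region e c'" using elim n(1) by (simp add: cap_region_def)
    then show ?case using dominated[OF elim(4,3)] unfolding dominated_def by blast
  qed
  moreover have "((\<lambda>c'. kelvin_copy e c' \<theta>) \<longlongrightarrow> kelvin_copy e c \<theta>) ?F"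
  proof (rule tendsto_kelvin_copy[OF id tendsto_const e c n(1) _ n(3)])
    show "\<forall>\<^sub>F c' in ?F. norm \<theta> = 1 \<and> 0 \<le> c'"
      using gt by eventually_elim (use n(1) c(1) in auto)
  qed
  ultimately show "v \<theta> \<le> kelvin_copy e c \<theta>"
    by (intro tendsto_lowerbound) auto
qed

text \<open>
  Otherwise let \<open>c0\<close> be the supremum of the exceptional parameters. If \<open>c0 < 1\<close> then domination
  holds at \<open>c0\<close> as a limit from above.
\<close>
lemma dominated_all:
  assumes e: "norm e = 1" and m: "m > 0" "\<And>\<theta>. \<theta> \<in> punctured_sphere \<Longrightarrow> m \<le> v \<theta>"
    and c: "0 < c" "c < 1"
  shows "dominated e c"
proof (rule ccontr)
  assume ng: "\<not> dominated e c"
  define S where "S = {c. 0 < c \<and> c < 1 \<and> \<not> dominated e c}"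
  have cS: "c \<in> S" using ng c by (simp add: S_def)
  have bdd: "bdd_above S" by (auto simp: S_def bdd_above_def intro: less_imp_le)
  define c0 where "c0 = Sup S"
  have c0: "0 < c0" "c0 \<le> 1"
    using cSup_upper[OF cS bdd] c(1) cSup_least[of S 1] cS by (auto simp: c0_def S_def)
  have "c0 \<in> closure S" unfolding c0_def using cS bdd by (intro closure_contains_Sup) auto
  then obtain cs where cs: "\<And>i. cs i \<in> S" "cs \<longlonglongrightarrow> c0" unfolding closure_sequential by blast
  have csS: "0 < cs i" "cs i < 1" "\<not> dominated e (cs i)" for i using cs(1)[of i] by (auto simp: S_def)
  have lim: "dominated e c0" if "c0 < 1"
  proof (rule dominated_from_above[OF e less_imp_le[OF c0(1)] that])
    fix c' assume c': "c0 < c'" "c' < 1"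
    show "dominated e c'"
    proof (rule ccontr)
      assume "\<not> dominated e c'"
      then have "c' \<in> S" using c' c0 by (simp add: S_def)
      then show False using cSup_upper[OF _ bdd] c'(1) by (force simp: c0_def)
    qed
  qed
  have "\<forall>\<^sub>F i in sequentially. pole_margin e (cs i)"
  proof (cases "c0 < 1")
    case True
    show ?thesis
      by (rule pole_margin_open[OF e c0(1) True dominated_imp_pole_margin[OF e c0(1) True lim[OF True]] cs(2)])
  next
    case False
    then have "c0 = 1" using c0 by simp
    then show ?thesis using cs(2) csS by (intro pole_margin_near_1[OF e m]) auto
  qed
  then obtain i0 where i0: "\<And>i. i \<ge> i0 \<Longrightarrow> pole_margin e (cs i)"
    by (auto simp: eventually_sequentially)
  \<comment> \<open>For \<open>c0 = 1\<close> the boundary of the cap degenerates to the point \<open>e\<close>, and any sphere through \<open>e\<close> serves.\<close>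
  have "\<exists>x R. R > 0 \<and> (\<forall>y. fst (stereo y) \<bullet> e = c0 \<longrightarrow> (y - x) \<bullet> (y - x) = R)"
  proof -
    have eq: "2 * (y \<bullet> e) = c0 * (1 + y \<bullet> y)" if "fst (stereo y) \<bullet> e = c0" for y
      using that one_plus_inner_pos[of y] by (simp add: stereo_eq stereo_factor_def divide_eq_eq)
    have ee: "e \<bullet> e = 1" using e by (simp add: norm_eq_1)
    show ?thesis
    proof (cases "c0 < 1")
      case True
      have "(y - (1 / c0) *\<^sub>R e) \<bullet> (y - (1 / c0) *\<^sub>R e) = 1 / c0\<^sup>2 - 1" if "fst (stereo y) \<bullet> e = c0" for y
      proof -
        have "(y - (1 / c0) *\<^sub>R e) \<bullet> (y - (1 / c0) *\<^sub>R e) = y \<bullet> y - (2 * (y \<bullet> e)) / c0 + 1 / c0\<^sup>2"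
          by (simp add: inner_diff_left inner_diff_right inner_commute ee power2_eq_square)
        then show ?thesis unfolding eq[OF that] using c0 by simp
      qed
      moreover have "1 / c0\<^sup>2 - 1 > 0"
        using one_minus_csq[OF e less_imp_le[OF c0(1)] True] c0(1) by (simp add: field_simps)
      ultimately show ?thesis by blast
    next
      case False
      then have c1: "c0 = 1" using c0 by simp
      have "(y - 0) \<bullet> (y - 0) = 1" if "fst (stereo y) \<bullet> e = c0" for y
      proof -
        have "(y - e) \<bullet> (y - e) = y \<bullet> y - 2 * (y \<bullet> e) + 1"
          by (simp add: inner_diff_left inner_diff_right inner_commute ee)
        also have "\<dots> = 0" unfolding eq[OF that] by (simp add: c1)
        finally have "y = e" by simp
        then show ?thesis by (simp add: ee)
      qed
      then show ?thesis by (intro exI[of _ 0] exI[of _ 1]) simp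
    qed
  qed
  then obtain x R where R: "R > 0" "\<And>y. fst (stereo y) \<bullet> e = c0 \<Longrightarrow> (y - x) \<bullet> (y - x) = R" by blast
  show False
  proof (rule moving_spheres_step[OF e c0 _ _ _ _ _ lim R])
    show "(\<lambda>i. cs (i + i0)) \<longlonglongrightarrow> c0" by (rule LIMSEQ_ignore_initial_segment[OF cs(2)])
  qed (use csS i0 in auto)
qed

text \<open>
  At \<open>c = 0\<close> the reflection is an isometry. Domination for \<open>e\<close> and for \<open>- e\<close> gives the two
  inequalities.
\<close>
lemma reflection_symmetry:
  assumes e: "norm e = 1" and m: "m > 0" "\<And>\<theta>. \<theta> \<in> punctured_sphere \<Longrightarrow> m \<le> v \<theta>"
    and \<theta>: "(x, t) \<in> punctured_sphere"
  shows "v (x - (2 * (x \<bullet> e)) *\<^sub>R e, t) = v (x, t)"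
proof -
  have R0: "cap_refl e 0 (x, t) = (x - (2 * (x \<bullet> e)) *\<^sub>R e, t)" for e x and t :: real
    by (simp add: cap_refl_def cap_den_def)
  have le: "v (x, t) \<le> v (x - (2 * (x \<bullet> e)) *\<^sub>R e, t) \<and> (x - (2 * (x \<bullet> e)) *\<^sub>R e, t) \<in> punctured_sphere"
    if e: "norm e = 1" and x: "x \<bullet> e > 0" and ps: "(x, t) \<in> punctured_sphere" for e x
  proof -
    have n: "norm (x, t) = 1" using ps by (simp add: punctured_sphere_iff)
    have n': "norm (x - (2 * (x \<bullet> e)) *\<^sub>R e, t) = 1"
      using norm_refl[OF e order_refl zero_less_one n] by (simp add: R0)
    have "(x - (2 * (x \<bullet> e)) *\<^sub>R e) \<bullet> e = - (x \<bullet> e)"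
      using e by (simp add: inner_diff_left norm_eq_1)
    then have f: "x - (2 * (x \<bullet> e)) *\<^sub>R e \<noteq> 0" using x by auto
    have "(x, t) \<in> cap_region e 0" using n x f by (simp add: cap_region_def R0)
    moreover have "dominated e 0" by (rule dominated_from_above[OF e]) (auto intro: dominated_all[OF e m])
    ultimately have "v (x, t) \<le> kelvin_copy e 0 (x, t)" by (simp add: dominated_def)
    then show ?thesis using n' f by (simp add: kelvin_copy_def stretch_def cap_den_def R0 punctured_sphere_iff)
  qed
  have pos: "v (x - (2 * (x \<bullet> e)) *\<^sub>R e, t) = v (x, t)"
    if e: "norm e = 1" and x: "x \<bullet> e > 0" for e
  proof -
    let ?x = "x - (2 * (x \<bullet> e)) *\<^sub>R e"
    have ee: "e \<bullet> e = 1" using e by (simp add: norm_eq_1)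
    have 1: "v (x, t) \<le> v (?x, t)" "(?x, t) \<in> punctured_sphere" using le[OF e x \<theta>] by auto
    have "?x \<bullet> (- e) = x \<bullet> e" by (simp add: inner_diff_left ee)
    then have "v (?x, t) \<le> v (x, t)" using le[of "- e" ?x] e x 1(2) by simp
    then show ?thesis using 1 by simp
  qed
  consider "x \<bullet> e > 0" | "x \<bullet> e = 0" | "x \<bullet> (- e) > 0" by fastforce
  then show ?thesis
  proof cases
    case 3
    then show ?thesis using pos[of "- e"] e by simp
  qed (use pos[OF e] in auto)
qed

text \<open>
  A rotation is replaced, one point at a time, by the reflection that exchanges that point and its image.
\<close>
lemma rotationally_symmetric_v:
  assumes m: "m > 0" "\<And>\<theta>. \<theta> \<in> punctured_sphere \<Longrightarrow> m \<le> v \<theta>"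
  shows "rotationally_symmetric v"
  unfolding rotationally_symmetric_def
proof (intro allI impI ballI, clarify)
  fix A :: "real ^ 'n ^ 'n" and x :: "real ^ 'n" and t :: real
  assume A: "rotation_matrix A" and xt: "(x, t) \<in> punctured_sphere"
  define y where "y = A *v x"
  have "orthogonal_transformation ((*v) A)"
    using A by (simp add: rotation_matrix_def orthogonal_transformation_matrix)
  then have "norm y = norm x" unfolding y_def by (rule orthogonal_transformation_norm)
  then have yy: "y \<bullet> y = x \<bullet> x" by (simp add: norm_eq)
  show "v (A *v x, t) = v (x, t)"
  proof (cases "y = x")
    case False
    define e where "e = (1 / norm (x - y)) *\<^sub>R (x - y)"
    have e: "norm e = 1" using False by (simp add: e_def)
    have "2 * (x \<bullet> (x - y)) = (x - y) \<bullet> (x - y)"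
      using yy by (simp add: inner_diff_left inner_diff_right inner_commute)
    then have "2 * (x \<bullet> e) = norm (x - y)"
      using False by (simp add: e_def power2_norm_eq_inner[symmetric] power2_eq_square)
    then have "x - (2 * (x \<bullet> e)) *\<^sub>R e = y" using False by (simp add: e_def)
    then show ?thesis using reflection_symmetry[OF e m xt] by (simp add: y_def)
  qed (simp add: y_def)
qed

end

section \<open>From the hypotheses on the nonlinearity to the symmetry theorem\<close>

text \<open>
  From dimension 2 on, a rotation can take any vector to any other of the same length.
\<close>
lemma same_latitude_rotation:
  fixes \<theta> \<theta>' :: "(real ^ 'n) \<times> real"
  assumes n: "CARD('n) \<ge> 2" and f: "rotationally_symmetric f"
    and ps: "\<theta> \<in> punctured_sphere" "\<theta>' \<in> punctured_sphere" and eq: "snd \<theta> = snd \<theta>'"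
  shows "f \<theta> = f \<theta>'"
proof -
  have "(norm (fst \<theta>))\<^sup>2 + (snd \<theta>)\<^sup>2 = (norm (fst \<theta>'))\<^sup>2 + (snd \<theta>')\<^sup>2"
    using ps by (simp add: punctured_sphere_iff norm_prod_def)
  then have "norm (fst \<theta>) = norm (fst \<theta>')" using eq by (simp add: power2_eq_iff_nonneg)
  then obtain h where h: "orthogonal_transformation h" "det (matrix h) = 1" "h (fst \<theta>) = fst \<theta>'"
    using rotation_exists[OF n] by blast
  have "rotation_matrix (matrix h)"
    using h by (simp add: rotation_matrix_def orthogonal_transformation_matrix)
  then have "\<forall>(x, t)\<in>punctured_sphere. f (matrix h *v x, t) = f (x, t)"
    using f unfolding rotationally_symmetric_def by blast
  from bspec[OF this ps(1)] have "f (matrix h *v fst \<theta>, snd \<theta>) = f \<theta>"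
    by (simp add: case_prod_unfold)
  moreover have "matrix h *v fst \<theta> = fst \<theta>'"
    using h orthogonal_transformation_linear[OF h(1)] by (simp add: matrix_works)
  ultimately show ?thesis using eq by simp
qed

text \<open>
  Condition (3) compares points on one meridian only; together with the rotational symmetry this
  point allows the comparison of arbitrary latitudes.
\<close>
lemma meridian_point:
  fixes \<theta> \<theta>' :: "(real ^ 'n) \<times> real"
  assumes ps: "\<theta> \<in> punctured_sphere" "\<theta>' \<in> punctured_sphere"
  obtains \<eta> where "\<eta> \<in> punctured_sphere" "snd \<eta> = snd \<theta>'" "same_polar_geodesic \<eta> \<theta>"
proof -
  define w where "w = (1 / norm (fst \<theta>)) *\<^sub>R fst \<theta>"
  have f: "fst \<theta> \<noteq> 0" "fst \<theta>' \<noteq> 0" using ps by (auto simp: punctured_sphere_iff)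
  have w: "norm w = 1" using f by (simp add: w_def)
  have geo: "(r *\<^sub>R w, t) \<in> polar_geodesic w" if "r\<^sup>2 + t\<^sup>2 = 1" for r t :: real
  proof -
    have "t\<^sup>2 + r\<^sup>2 = 1" using that by simp
    then obtain s where "t = cos s" "r = sin s" by (rule sincos_total_2pi)
    then show ?thesis unfolding polar_geodesic_def by (auto simp: north_def)
  qed
  have one: "(norm (fst \<eta>))\<^sup>2 + (snd \<eta>)\<^sup>2 = 1" if "\<eta> \<in> punctured_sphere" for \<eta> :: "(real ^ 'n) \<times> real"
    using that by (simp add: punctured_sphere_iff norm_prod_def)
  define \<eta> where "\<eta> = (norm (fst \<theta>') *\<^sub>R w, snd \<theta>')"
  have "norm \<eta> = 1" using one[OF ps(2)] w by (simp add: \<eta>_def norm_prod_def)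
  then have 1: "\<eta> \<in> punctured_sphere" using f w by (auto simp: punctured_sphere_iff \<eta>_def)
  have "\<theta> = (norm (fst \<theta>) *\<^sub>R w, snd \<theta>)" using f by (simp add: w_def)
  then have "\<theta> \<in> polar_geodesic w" using geo[OF one[OF ps(1)]] by simp
  moreover have "\<eta> \<in> polar_geodesic w" unfolding \<eta>_def by (rule geo[OF one[OF ps(2)]])
  ultimately have "same_polar_geodesic \<eta> \<theta>" using w unfolding same_polar_geodesic_def by blast
  with 1 show ?thesis by (intro that[of \<eta>]) (auto simp: \<eta>_def)
qed

lemma positive_lower_bound:
  fixes v :: "(real ^ 'n) \<times> real \<Rightarrow> real"
  assumes cont: "continuous_on punctured_sphere v"
    and pos: "\<And>\<theta>. \<theta> \<in> punctured_sphere \<Longrightarrow> v \<theta> > 0"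
    and north: "Liminf (at north within punctured_sphere) (\<lambda>\<theta>. ereal (v \<theta>)) > 0"
    and south: "Liminf (at south within punctured_sphere) (\<lambda>\<theta>. ereal (v \<theta>)) > 0"
  obtains m where "m > 0" "\<And>\<theta>. \<theta> \<in> punctured_sphere \<Longrightarrow> m \<le> v \<theta>"
proof -
  have "\<exists>c T. c > 0 \<and> open T \<and> N \<in> T \<and> (\<forall>\<theta>\<in>punctured_sphere. \<theta> \<in> T \<longrightarrow> c \<le> v \<theta>)"
    if L: "Liminf (at N within punctured_sphere) (\<lambda>\<theta>. ereal (v \<theta>)) > 0" and N: "N \<notin> punctured_sphere"
    for N :: "(real ^ 'n) \<times> real"
  proof -
    obtain c where c: "0 < ereal c" "ereal c < Liminf (at N within punctured_sphere) (\<lambda>\<theta>. ereal (v \<theta>))"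
      using ereal_dense2[OF L] by blast
    from less_LiminfD[OF c(2)] have "\<forall>\<^sub>F \<theta> in at N within punctured_sphere. c \<le> v \<theta>"
      by (rule eventually_mono) simp
    then obtain T where "open T" "N \<in> T" "\<forall>\<theta>\<in>punctured_sphere. \<theta> \<noteq> N \<longrightarrow> \<theta> \<in> T \<longrightarrow> c \<le> v \<theta>"
      unfolding eventually_at_topological by blast
    then show ?thesis using c(1) N by (intro exI[of _ c] exI[of _ T]) auto
  qed
  from this[OF north] this[OF south] obtain c1 T1 c2 T2 where
    1: "c1 > 0" "open T1" "north \<in> T1" "\<forall>\<theta>\<in>punctured_sphere. \<theta> \<in> T1 \<longrightarrow> c1 \<le> v \<theta>" and
    2: "c2 > 0" "open T2" "south \<in> T2" "\<forall>\<theta>\<in>punctured_sphere. \<theta> \<in> T2 \<longrightarrow> c2 \<le> v \<theta>"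
    by (auto simp: punctured_sphere_def)
  define K where "K = sphere 0 1 \<inter> (- T1 \<inter> - T2)"
  have K: "compact K" unfolding K_def using 1 2 by (intro compact_Int_closed closed_Int closed_Compl) auto
  have Kps: "K \<subseteq> punctured_sphere" using 1 2 by (auto simp: K_def punctured_sphere_def)
  have "\<exists>c>0. \<forall>\<theta>\<in>K. c \<le> v \<theta>"
  proof (cases "K = {}")
    case False
    obtain \<theta>0 where "\<theta>0 \<in> K" "\<forall>\<theta>\<in>K. v \<theta>0 \<le> v \<theta>"
      using continuous_attains_inf[OF K False continuous_on_subset[OF cont Kps]] by blast
    then show ?thesis using pos Kps by blast
  qed (auto intro: exI[of _ 1])
  then obtain c3 where 3: "c3 > 0" "\<forall>\<theta>\<in>K. c3 \<le> v \<theta>" by blast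
  show ?thesis
  proof (rule that[of "min c1 (min c2 c3)"])
    fix \<theta> :: "(real ^ 'n) \<times> real" assume \<theta>: "\<theta> \<in> punctured_sphere"
    then have "\<theta> \<in> T1 \<or> \<theta> \<in> T2 \<or> \<theta> \<in> K" by (auto simp: K_def punctured_sphere_def)
    then show "min c1 (min c2 c3) \<le> v \<theta>" using 1(4) 2(4) 3(2) \<theta> by (auto simp: min_le_iff_disj)
  qed (use 1 2 3 in auto)
qed

theorem theorem1p5:
  fixes g :: "(real ^ 'n) \<times> real \<Rightarrow> real \<Rightarrow> real"
    and v :: "(real ^ 'n) \<times> real \<Rightarrow> real"
  assumes n: "CARD('n) \<ge> 3"
    and g_cont: "continuous_on (punctured_sphere \<times> {0<..}) (\<lambda>(\<theta>, s). g \<theta> s)"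
    and g_bdd: "\<And>s. s > 0 \<Longrightarrow> bdd_below ((\<lambda>\<theta>. g \<theta> s) ` punctured_sphere)"
    and g_sym: "\<And>s. s > 0 \<Longrightarrow> rotationally_symmetric (\<lambda>\<theta>. g \<theta> s)"
    and g_decr: "\<And>\<theta>. \<theta> \<in> punctured_sphere \<Longrightarrow>
      antimono_on {0<..}
        (\<lambda>s. s powr (- ((real CARD('n) + 2) / (real CARD('n) - 2))) * g \<theta> s)"
    and g_mono: "\<And>s \<theta> \<theta>'. s > 0 \<Longrightarrow> \<theta> \<in> punctured_sphere \<Longrightarrow> \<theta>' \<in> punctured_sphere \<Longrightarrow>
      same_polar_geodesic \<theta> \<theta>' \<Longrightarrow>
      (snd \<theta> > snd \<theta>' \<and> snd \<theta>' > 0 \<longrightarrow> g \<theta> s \<ge> g \<theta>' s) \<and>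
      (snd \<theta> < snd \<theta>' \<and> snd \<theta>' < 0 \<longrightarrow> g \<theta> s \<ge> g \<theta>' s)"
    and strict:
      "(\<forall>s \<theta> \<theta>'. s > 0 \<longrightarrow> \<theta> \<in> punctured_sphere \<longrightarrow> \<theta>' \<in> punctured_sphere \<longrightarrow>
          same_polar_geodesic \<theta> \<theta>' \<longrightarrow>
          (snd \<theta> > snd \<theta>' \<and> snd \<theta>' > 0 \<longrightarrow> g \<theta> s > g \<theta>' s) \<and>
          (snd \<theta> < snd \<theta>' \<and> snd \<theta>' < 0 \<longrightarrow> g \<theta> s > g \<theta>' s))
       \<or> (\<forall>\<theta> \<in> punctured_sphere.
          strict_antimono_on {0<..}
            (\<lambda>s. s powr (- ((real CARD('n) + 2) / (real CARD('n) - 2))) * g \<theta> s))"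
    and v_C2: "C2_punctured_sphere v"
    and v_eq: "\<And>\<theta>. \<theta> \<in> punctured_sphere \<Longrightarrow> - conformal_laplacian v \<theta> = g \<theta> (v \<theta>)"
    and v_pos: "\<And>\<theta>. \<theta> \<in> punctured_sphere \<Longrightarrow> v \<theta> > 0"
    and v_north: "Liminf (at north within punctured_sphere) (\<lambda>\<theta>. ereal (v \<theta>)) > 0"
    and v_south: "Liminf (at south within punctured_sphere) (\<lambda>\<theta>. ereal (v \<theta>)) > 0"
  shows "rotationally_symmetric v"
proof -
  define N where "N = real CARD('n)"
  define a where "a = (N - 2) / 2"
  define p where "p = (N + 2) / (N - 2)"
  have N: "N \<ge> 3" using n by (simp add: N_def)
  have ap: "a * p = a + 2" using N by (simp add: a_def p_def field_simps)
  define h where "h = (\<lambda>\<theta> s. s powr (- p) * g \<theta> s)"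
  define k where "k = (\<lambda>\<theta>. h \<theta> (v \<theta>))"
  let ?V = "v \<circ> stereo"
  have p_eq: "(real CARD('n) + 2) / (real CARD('n) - 2) = p" by (simp add: p_def N_def)
  obtain G where G: "\<And>y. y \<in> - {0} \<Longrightarrow> \<exists>L. has_laplacian ?V G y L"
    using C2_on_has_laplacian[of "- {0}" ?V] v_C2 unfolding C2_punctured_sphere_def by auto
  have v_cont: "continuous_on punctured_sphere v"
  proof -
    have "isCont ?V y" if "y \<noteq> 0" for y using G[of y] that has_laplacian_isCont by auto
    then have V: "continuous_on (- {0}) ?V" by (intro continuous_at_imp_continuous_on) blast
    have ne: "\<theta> \<in> punctured_sphere \<Longrightarrow> snd \<theta> \<noteq> 1" for \<theta> :: "(real ^ 'n) \<times> real"
      using punctured_stereo_coord(3) unfolding punctured_sphere_iff by blast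
    have "continuous_on punctured_sphere (stereo_coord :: _ \<Rightarrow> real ^ 'n)"
      unfolding stereo_coord_def by (intro continuous_intros) (use ne in force)
    then have "continuous_on punctured_sphere (\<lambda>\<theta>. ?V (stereo_coord \<theta>))"
      by (rule continuous_on_compose2[OF V])
        (use punctured_stereo_coord(2) in \<open>force simp: punctured_sphere_iff\<close>)
    moreover have "?V (stereo_coord \<theta>) = v \<theta>" if "\<theta> \<in> punctured_sphere" for \<theta>
      using that punctured_stereo_coord(1)[of \<theta>] by (simp add: punctured_sphere_iff)
    ultimately show ?thesis by (simp cong: continuous_on_cong)
  qed
  have k_cont: "continuous_on punctured_sphere k"
  proof -
    have "continuous_on punctured_sphere (\<lambda>\<theta>. (\<lambda>(\<theta>, s). g \<theta> s) (\<theta>, v \<theta>))"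
      by (rule continuous_on_compose2[OF g_cont]) (use v_pos in \<open>auto intro!: continuous_intros v_cont\<close>)
    then have "continuous_on punctured_sphere (\<lambda>\<theta>. g \<theta> (v \<theta>))" by simp
    then show ?thesis unfolding k_def h_def
      by (intro continuous_intros v_cont) (use v_pos in force)+
  qed
  have g_eq: "g \<theta> s = g \<theta>' s"
    if "s > 0" "\<theta> \<in> punctured_sphere" "\<theta>' \<in> punctured_sphere" "snd \<theta> = snd \<theta>'" for s \<theta> \<theta>'
    using same_latitude_rotation[OF _ g_sym[OF that(1)] that(2-4)] n by simp
  have h_decr: "h \<theta> s' \<ge> h \<theta> s" if "\<theta> \<in> punctured_sphere" "0 < s'" "s' \<le> s" for \<theta> s s'
    using g_decr[OF that(1)] that(2,3) unfolding monotone_on_def p_eq h_def by auto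
  have g_le: "g \<theta> s \<le> g \<theta>' s"
    if s: "s > 0" and ps: "\<theta> \<in> punctured_sphere" "\<theta>' \<in> punctured_sphere"
      and m: "m \<ge> 1" "snd \<theta>' = m * snd \<theta>" for s \<theta> \<theta>' m
  proof (cases "snd \<theta> = snd \<theta>'")
    case False
    obtain \<eta> where \<eta>: "\<eta> \<in> punctured_sphere" "snd \<eta> = snd \<theta>'" "same_polar_geodesic \<eta> \<theta>"
      using meridian_point[OF ps] .
    have "m > 1" using m False by (cases "m = 1") auto
    then have "(snd \<eta> > snd \<theta> \<and> snd \<theta> > 0) \<or> (snd \<eta> < snd \<theta> \<and> snd \<theta> < 0)"
      using False m(2) \<eta>(2) by (cases "snd \<theta>" "0 :: real" rule: linorder_cases) auto
    then have "g \<theta> s \<le> g \<eta> s" using g_mono[OF s \<eta>(1) ps(1) \<eta>(3)] by blast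
    also have "g \<eta> s = g \<theta>' s" by (rule g_eq[OF s \<eta>(1) ps(2) \<eta>(2)])
    finally show ?thesis .
  qed (use g_eq[OF s ps] in simp)
  have h_le: "h \<theta> s \<le> h \<theta>' s"
    if "s > 0" "\<theta> \<in> punctured_sphere" "\<theta>' \<in> punctured_sphere" "m \<ge> 1" "snd \<theta>' = m * snd \<theta>" for s \<theta> \<theta>' m
    unfolding h_def using g_le[OF that] by (intro mult_left_mono) auto
  \<comment> \<open>Along the solution the conditions on \<open>g\<close> become the two monotonicity properties of \<open>k\<close>.\<close>
  interpret sphere_equation v k a p
  proof
    show "CARD('n) \<ge> 3" by (rule n)
    show "a = (real CARD('n) - 2) / 2" "p = (real CARD('n) + 2) / (real CARD('n) - 2)"
      by (simp_all add: a_def p_def N_def)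
    show "continuous_on punctured_sphere v" "continuous_on punctured_sphere k" by fact+
    show "\<And>\<theta>. \<theta> \<in> punctured_sphere \<Longrightarrow> v \<theta> > 0" by fact
    fix \<theta> \<theta>' :: "(real ^ 'n) \<times> real" and m :: real
    assume ps: "\<theta> \<in> punctured_sphere" "\<theta>' \<in> punctured_sphere" and m: "snd \<theta>' = m * snd \<theta>"
    note vp = v_pos[OF ps(1)] v_pos[OF ps(2)]
    show "k \<theta> \<le> k \<theta>'" if "v \<theta>' \<le> v \<theta>" "m \<ge> 1"
      unfolding k_def
      by (rule order_trans[OF h_le[OF vp(1) ps that(2) m] h_decr[OF ps(2) vp(2) that(1)]])
    show "k \<theta> < k \<theta>'" if lt: "v \<theta>' < v \<theta>" and m1: "m > 1" and t: "snd \<theta> \<noteq> 0"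
      using strict
    proof
      assume *: "\<forall>\<theta> \<in> punctured_sphere. strict_antimono_on {0<..}
            (\<lambda>s. s powr (- ((real CARD('n) + 2) / (real CARD('n) - 2))) * g \<theta> s)"
      have "h \<theta>' (v \<theta>) < h \<theta>' (v \<theta>')"
        using bspec[OF * ps(2)] lt vp unfolding monotone_on_def p_eq h_def by auto
      then show ?thesis unfolding k_def using h_le[OF vp(1) ps less_imp_le[OF m1] m] by linarith
    next
      assume *: "\<forall>s \<theta> \<theta>'. s > 0 \<longrightarrow> \<theta> \<in> punctured_sphere \<longrightarrow> \<theta>' \<in> punctured_sphere \<longrightarrow>
          same_polar_geodesic \<theta> \<theta>' \<longrightarrow>
          (snd \<theta> > snd \<theta>' \<and> snd \<theta>' > 0 \<longrightarrow> g \<theta> s > g \<theta>' s) \<and>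
          (snd \<theta> < snd \<theta>' \<and> snd \<theta>' < 0 \<longrightarrow> g \<theta> s > g \<theta>' s)"
      obtain \<eta> where \<eta>: "\<eta> \<in> punctured_sphere" "snd \<eta> = snd \<theta>'" "same_polar_geodesic \<eta> \<theta>"
        using meridian_point[OF ps] .
      have "(snd \<eta> > snd \<theta> \<and> snd \<theta> > 0) \<or> (snd \<eta> < snd \<theta> \<and> snd \<theta> < 0)"
        using t m m1 \<eta>(2) by (cases "snd \<theta>" "0 :: real" rule: linorder_cases) auto
      then have "g \<theta> (v \<theta>) < g \<eta> (v \<theta>)" using * vp(1) \<eta> ps(1) by blast
      also have "g \<eta> (v \<theta>) = g \<theta>' (v \<theta>)" by (rule g_eq[OF vp(1) \<eta>(1) ps(2) \<eta>(2)])
      finally have "h \<theta> (v \<theta>) < h \<theta>' (v \<theta>)" using vp(1) by (simp add: h_def)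
      then show ?thesis unfolding k_def using h_decr[OF ps(2) vp(2) less_imp_le[OF lt]] by linarith
    qed
  next
    fix y :: "real ^ 'n" assume y: "y \<noteq> 0"
    then obtain L where "has_laplacian ?V G y L" using G by blast
    from has_laplacian_conformal[OF this] obtain F where
      F: "has_laplacian (\<lambda>z. stereo_factor z powr a * ?V z) F y
       (stereo_factor y powr (a + 2) * (laplace_beltrami stereo ?V y - N * (N - 2) / 4 * ?V y))"
      unfolding N_def[symmetric] a_def[symmetric] by blast
    have ps: "stereo y \<in> punctured_sphere" using y by (simp add: stereo_in_punctured)
    have "laplace_beltrami stereo ?V y - N * (N - 2) / 4 * ?V y = conformal_laplacian v (stereo y)"
      by (simp add: conformal_laplacian_def sphere_laplacian_def stereo_coord_stereo N_def)
    also have "\<dots> = - g (stereo y) (v (stereo y))" using v_eq[OF ps] by simp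
    finally have c: "laplace_beltrami stereo ?V y - N * (N - 2) / 4 * ?V y = - g (stereo y) (v (stereo y))" .
    have "(stereo_factor y powr a * v (stereo y)) powr p = stereo_factor y powr (a + 2) * v (stereo y) powr p"
      using stereo_factor_pos[of y] v_pos[OF ps] by (subst powr_mult) (auto simp: powr_powr ap)
    moreover have "v (stereo y) powr p * k (stereo y) = g (stereo y) (v (stereo y))"
      using v_pos[OF ps] by (simp add: k_def h_def powr_minus)
    ultimately have "(stereo_factor y powr a * v (stereo y)) powr p * k (stereo y) =
        stereo_factor y powr (a + 2) * g (stereo y) (v (stereo y))" by (simp add: mult.assoc)
    then show "\<exists>G. has_laplacian (\<lambda>z. stereo_factor z powr a * v (stereo z)) G y
      (- ((stereo_factor y powr a * v (stereo y)) powr p * k (stereo y)))"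
      using F unfolding c by auto
  qed
  obtain m where "m > 0" "\<And>\<theta>. \<theta> \<in> punctured_sphere \<Longrightarrow> m \<le> v \<theta>"
    using positive_lower_bound[OF v_cont v_pos v_north v_south] by blast
  then show ?thesis by (rule rotationally_symmetric_v)
qed

end
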